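(* Let $A=E_1\times E_2$ be a decomposable Abelian surface with $\rho(A)=3$. Then the decompositions $\{(\alpha_\sigma(E_{\sigma,1}),\alpha_\sigma(E_{\sigma,2}))\}_{\sigma\in\Sigma}$ of $A$ (constructed from $(E_1,E_2)$ as in the context) represent $\mathrm{Dec}(A)$ completely; that is, each isomorphism class of decompositions of $A$ contains exactly one member of this family indexed by $\Sigma$.
   Context: An Abelian surface means a complex Abelian surface; $\rho(A)$ is the Picard number. A decomposition of $A$ is an ordered pair $(F_1,F_2)$ of elliptic curves in $A$ such that the natural homomorphism $F_1\times F_2\to A$ is an isomorphism. Two decompositions $(F_1,F_2)$, $(F_1',F_2')$ are isomorphic if $F_1\simeq F_1'$, $F_2\simeq F_2'$, or $F_1\simeq F_2'$, $F_2\simeq F_1'$. $\mathrm{Dec}(A)$ is the set of isomorphism classes of decompositions. Let $N$ be the positive integer with $NS_A\simeq U\oplus\langle -2N\rangle$ ($U$ the hyperbolic plane), i.e. $N=\frac12\det(NS_A)$. There is an isogeny $\phi:E_1\to E_2$ of degree $N$ (the minimal degree of an isogeny $E_1\to E_2$); its kernel $G=\mathrm{Ker}(\phi)\subset E_1$ is cyclic of order $N$ and determined by $(E_1,E_2)$. Let $$\Sigma:=\{(r_\sigma,s_\sigma)\mid r_\sigma,s_\sigma\in\mathbb{Z}_{>0},\ \gcd(r_\sigma,s_\sigma)=1,\ r_\sigma s_\sigma=N,\ r_\sigma\le s_\sigma\}.$$ For each $\sigma\in\Sigma$ fix integers $a_\sigma,b_\sigma$ with $a_\sigma r_\sigma+b_\sigma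 s_\sigma=1$. Let $G_{\sigma,1}$ (resp. $G_{\sigma,2}$) be the sum of the $p$-primary components of $G$ over primes $p\mid r_\sigma$ (resp. $p\mid s_\sigma$), so $G=G_{\sigma,1}\oplus G_{\sigma,2}$, and set $E_{\sigma,i}:=E_1/G_{\sigma,i}$. The isogeny $\phi$ factors as $E_1\xrightarrow{\phi_{\sigma,i}^+}E_{\sigma,i}\xrightarrow{\phi_{\sigma,i}^-}E_2$ ($i=1,2$), with $\phi_{\sigma,i}^+$ the quotient map, $\deg\phi_{\sigma,1}^+=\deg\phi_{\sigma,2}^-=r_\sigma$ and $\deg\phi_{\sigma,2}^+=\deg\phi_{\sigma,1}^-=s_\sigma$. With $\widehat{\ }$ denoting the dual isogeny, put $$\alpha_\sigma:=\begin{pmatrix}\widehat{\phi_{\sigma,1}^+}& b_\sigma\widehat{\phi_{\sigma,2}^+}\\ -\phi_{\sigma,1}^-& a_\sigma\phi_{\sigma,2}^-\end{pmatrix}:E_{\sigma,1}\times E_{\sigma,2}\to E_1\times E_2=A.$$ This is an isomorphism, so $(\alpha_\sigma(E_{\sigma,1}),\alpha_\sigma(E_{\sigma,2}))$ is a decomposition of $A$. *)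

theory Defs
  imports "HOL-Analysis.Analysis" "HOL-Algebra.Coset" "HOL-Algebra.Generated_Groups"
    "HOL-Computational_Algebra.Primes"
begin

section \<open>Finite-dimensional complex vector spaces\<close>

class complex_space = euclidean_space +
  fixes scaleC :: "complex \<Rightarrow> 'a \<Rightarrow> 'a" (infixr \<open>*\<^sub>C\<close> 75)
  assumes scaleC_add_right: "c *\<^sub>C (x + y) = c *\<^sub>C x + c *\<^sub>C y"
    and scaleC_add_left: "(c + d) *\<^sub>C x = c *\<^sub>C x + d *\<^sub>C x"
    and scaleC_scaleC: "c *\<^sub>C d *\<^sub>C x = (c * d) *\<^sub>C x"
    and scaleC_of_real: "complex_of_real r *\<^sub>C x = r *\<^sub>R x"

instantiation complex :: complex_space
begin
definition scaleC_complex :: "complex \<Rightarrow> complex \<Rightarrow> complex" where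
  "scaleC_complex c x = c * x"
instance
  by standard (simp_all add: scaleC_complex_def algebra_simps scaleR_conv_of_real)
end

instantiation prod :: (complex_space, complex_space) complex_space
begin
definition scaleC_prod :: "complex \<Rightarrow> 'a \<times> 'b \<Rightarrow> 'a \<times> 'b" where
  "scaleC_prod c x = (c *\<^sub>C fst x, c *\<^sub>C snd x)"
instance
  by standard (simp_all add: scaleC_prod_def scaleC_add_right scaleC_add_left scaleC_scaleC
      scaleC_of_real prod_eq_iff)
end

text \<open>Complex differentiability in one or several variables: the real derivative exists and is
  complex linear.\<close>
definition cdifferentiable_on :: "('a::complex_space \<Rightarrow> 'b::complex_space) \<Rightarrow> 'a set \<Rightarrow> bool" where
  "cdifferentiable_on h U \<longleftrightarrow>
     (\<forall>x\<in>U. \<exists>D. (h has_derivative D) (at x) \<and> (\<forall>c v. D (c *\<^sub>C v) = c *\<^sub>C D v))"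


section \<open>Complex tori and their homomorphisms\<close>

definition Z_span :: "'a::real_vector set \<Rightarrow> 'a set" where
  "Z_span B = {\<Sum>b\<in>B. of_int (n b) *\<^sub>R b | n :: 'a \<Rightarrow> int. True}"

definition Z_basis :: "'a::euclidean_space set \<Rightarrow> 'a set \<Rightarrow> bool" where
  "Z_basis L B \<longleftrightarrow> independent B \<and> span B = UNIV \<and> L = Z_span B"

definition is_lattice :: "'a::euclidean_space set \<Rightarrow> bool" where
  "is_lattice L \<longleftrightarrow> (\<exists>B. Z_basis L B)"

definition add_grp :: "'a::ab_group_add monoid" where
  "add_grp = \<lparr>carrier = UNIV, mult = (+), one = 0\<rparr>"

text \<open>
  A lattice \<open>L\<close> in a complex vector space \<open>V\<close> stands for the complex torus \<open>V / L\<close>, whose points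
  are the cosets of \<open>L\<close>. An elliptic curve is a torus given by a lattice in \<open>complex\<close>, and
  \<open>L1 \<times> L2\<close> stands for the product of the tori \<open>L1\<close> and \<open>L2\<close>. The pair of points \<open>P\<close>, \<open>Q\<close> is the
  coset \<open>P \<times> Q\<close> of \<open>L1 \<times> L2\<close>, and the components of a point \<open>R\<close> of the product are the images
  \<open>fst ` R\<close> and \<open>snd ` R\<close>. The group law is written multiplicatively.
\<close>
definition torus :: "'a::complex_space set \<Rightarrow> 'a set monoid" where
  "torus L = add_grp Mod L"

definition torus_proj :: "'a::complex_space set \<Rightarrow> 'a \<Rightarrow> 'a set" where
  "torus_proj L x = L #>\<^bsub>add_grp\<^esub> x"

text \<open>The charts of a torus are the local inverses of the projection, so a map is holomorphic if
  it is locally given by holomorphic maps between the universal covers.\<close>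
definition torus_holomorphic ::
    "'a::complex_space set \<Rightarrow> 'b::complex_space set \<Rightarrow> ('a set \<Rightarrow> 'b set) \<Rightarrow> bool" where
  "torus_holomorphic L M f \<longleftrightarrow>
     (\<forall>x. \<exists>U h. open U \<and> x \<in> U \<and> cdifferentiable_on h U \<and>
        (\<forall>y\<in>U. f (torus_proj L y) = torus_proj M (h y)))"

definition torus_hom ::
    "'a::complex_space set \<Rightarrow> 'b::complex_space set \<Rightarrow> ('a set \<Rightarrow> 'b set) set" where
  "torus_hom L M = {f \<in> hom (torus L) (torus M). torus_holomorphic L M f}"

definition torus_iso ::
    "'a::complex_space set \<Rightarrow> 'b::complex_space set \<Rightarrow> ('a set \<Rightarrow> 'b set) \<Rightarrow> bool" where
  "torus_iso L M f \<longleftrightarrow> f \<in> torus_hom L M \<and>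
     (\<exists>g\<in>torus_hom M L. (\<forall>P\<in>carrier (torus L). g (f P) = P) \<and>
                        (\<forall>Q\<in>carrier (torus M). f (g Q) = Q))"

definition isogeny ::
    "'a::complex_space set \<Rightarrow> 'b::complex_space set \<Rightarrow> ('a set \<Rightarrow> 'b set) \<Rightarrow> bool" where
  "isogeny L M f \<longleftrightarrow> f \<in> torus_hom L M \<and> f ` carrier (torus L) = carrier (torus M) \<and>
     finite (kernel (torus L) (torus M) f)"

definition isogeny_degree ::
    "'a::complex_space set \<Rightarrow> 'b::complex_space set \<Rightarrow> ('a set \<Rightarrow> 'b set) \<Rightarrow> nat" where
  "isogeny_degree L M f = card (kernel (torus L) (torus M) f)"

text \<open>The homomorphism \<open>g\<close> from \<open>K\<close> to \<open>M\<close> with \<open>g \<circ> q = f\<close>, for \<open>q\<close> a surjective homomorphism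
  from \<open>L\<close> to \<open>K\<close> and \<open>f\<close> a homomorphism from \<open>L\<close> to \<open>M\<close> trivial on the kernel of \<open>q\<close>.\<close>
definition factor_map ::
    "'a::complex_space set \<Rightarrow> 'b::complex_space set \<Rightarrow> 'c::complex_space set \<Rightarrow>
     ('a set \<Rightarrow> 'b set) \<Rightarrow> ('a set \<Rightarrow> 'c set) \<Rightarrow> 'b set \<Rightarrow> 'c set" where
  "factor_map L K M q f =
     (THE g. g \<in> torus_hom K M \<and> g \<in> extensional (carrier (torus K)) \<and>
             (\<forall>P\<in>carrier (torus L). g (q P) = f P))"

definition dual_isogeny ::
    "complex set \<Rightarrow> complex set \<Rightarrow> (complex set \<Rightarrow> complex set) \<Rightarrow> complex set \<Rightarrow> complex set" where
  "dual_isogeny L M f = factor_map L M L f (\<lambda>P. P [^]\<^bsub>torus L\<^esub> isogeny_degree L M f)"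

text \<open>For a subgroup \<open>H\<close> of the torus \<open>L\<close>, the quotient by \<open>H\<close> is the torus of the preimage
  of \<open>H\<close> in the universal cover, i.e. of the union of the cosets belonging to \<open>H\<close>.\<close>
definition quot_lattice :: "'a::complex_space set set \<Rightarrow> 'a set" where
  "quot_lattice H = \<Union>H"

definition quot_map :: "'a::complex_space set set \<Rightarrow> 'a set \<Rightarrow> 'a set" where
  "quot_map H P = quot_lattice H <#>\<^bsub>add_grp\<^esub> P"


section \<open>The N\'eron--Severi lattice\<close>

text \<open>By the Appell--Humbert theorem, the first Chern class identifies the group of line bundles
  modulo algebraic equivalence on the torus \<open>L\<close> with the following group of real-valued
  alternating forms.\<close>
definition NS :: "'a::complex_space set \<Rightarrow> ('a \<Rightarrow> 'a \<Rightarrow> real) set" where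
  "NS L = {E. bilinear E \<and> (\<forall>x. E x x = 0) \<and> (\<forall>x y. E (\<i> *\<^sub>C x) (\<i> *\<^sub>C y) = E x y) \<and>
              (\<forall>x\<in>L. \<forall>y\<in>L. E x y \<in> \<int>)}"

definition Z_independent_forms :: "('a \<Rightarrow> 'a \<Rightarrow> real) set \<Rightarrow> bool" where
  "Z_independent_forms B \<longleftrightarrow>
     (\<forall>n :: ('a \<Rightarrow> 'a \<Rightarrow> real) \<Rightarrow> int.
        (\<forall>x y. (\<Sum>E\<in>B. of_int (n E) * E x y) = 0) \<longrightarrow> (\<forall>E\<in>B. n E = 0))"

text \<open>The rank of the N\'eron--Severi group. The cardinalities below are bounded, so the supremum
  is a maximum.\<close>
definition picard_number :: "'a::complex_space set \<Rightarrow> nat" where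
  "picard_number L = Sup {card B | B. finite B \<and> B \<subseteq> NS L \<and> Z_independent_forms B}"

definition wedge ::
    "('a \<Rightarrow> 'a \<Rightarrow> real) \<Rightarrow> ('a \<Rightarrow> 'a \<Rightarrow> real) \<Rightarrow> 'a \<Rightarrow> 'a \<Rightarrow> 'a \<Rightarrow> 'a \<Rightarrow> real" where
  "wedge E F v1 v2 v3 v4 =
     E v1 v2 * F v3 v4 - E v1 v3 * F v2 v4 + E v1 v4 * F v2 v3
   + E v2 v3 * F v1 v4 - E v2 v4 * F v1 v3 + E v3 v4 * F v1 v2"

text \<open>The two factors are $dx_1 \wedge dy_1$ and $dx_2 \wedge dy_2$, where $z_j = x_j + i y_j$ are
  the coordinates.\<close>
definition std_volume_form ::
    "complex \<times> complex \<Rightarrow> complex \<times> complex \<Rightarrow> complex \<times> complex \<Rightarrow> complex \<times> complex \<Rightarrow> real" where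
  "std_volume_form = wedge (\<lambda>v w. Im (cnj (fst v) * fst w)) (\<lambda>v w. Im (cnj (snd v) * snd w))"

text \<open>The intersection number is the cup product of the Chern classes evaluated on the fundamental
  class: the integral of \<open>E \<and> F\<close> over the torus, oriented by its complex structure, is the value
  of this 4-form on any positively oriented \<open>\<int>\<close>-basis of the lattice.\<close>
definition intersection_number ::
    "(complex \<times> complex) set \<Rightarrow> (complex \<times> complex \<Rightarrow> complex \<times> complex \<Rightarrow> real) \<Rightarrow>
     (complex \<times> complex \<Rightarrow> complex \<times> complex \<Rightarrow> real) \<Rightarrow> real" where
  "intersection_number L E F =
     (THE c. \<forall>v1 v2 v3 v4. distinct [v1, v2, v3, v4] \<longrightarrow> Z_basis L {v1, v2, v3, v4} \<longrightarrow>
        std_volume_form v1 v2 v3 v4 > 0 \<longrightarrow> wedge E F v1 v2 v3 v4 = c)"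

text \<open>The form of \<open>U \<oplus> \<langle>-2N\<rangle>\<close>.\<close>
definition U_plus_form :: "nat \<Rightarrow> int \<times> int \<times> int \<Rightarrow> int \<times> int \<times> int \<Rightarrow> int" where
  "U_plus_form N = (\<lambda>(x, y, z) (x', y', z'). x * y' + y * x' - 2 * int N * z * z')"

definition NS_isometric_U_plus :: "(complex \<times> complex) set \<Rightarrow> nat \<Rightarrow> bool" where
  "NS_isometric_U_plus L N \<longleftrightarrow>
     (\<exists>\<psi>. bij_betw \<psi> UNIV (NS L) \<and>
          (\<forall>m n. \<psi> (m + n) = (\<lambda>v w. \<psi> m v w + \<psi> n v w)) \<and>
          (\<forall>m n. intersection_number L (\<psi> m) (\<psi> n) = of_int (U_plus_form N m n)))"


section \<open>Decompositions of an Abelian surface\<close>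

text \<open>\<open>\<iota>\<close> identifies the elliptic curve \<open>K\<close> with the elliptic curve \<open>F\<close> in the surface \<open>A\<close>.\<close>
definition curve_embedding ::
    "(complex \<times> complex) set \<Rightarrow> complex set \<Rightarrow> (complex set \<Rightarrow> (complex \<times> complex) set) \<Rightarrow>
     (complex \<times> complex) set set \<Rightarrow> bool" where
  "curve_embedding A K \<iota> F \<longleftrightarrow> is_lattice K \<and> \<iota> \<in> torus_hom K A \<and>
     inj_on \<iota> (carrier (torus K)) \<and> \<iota> ` carrier (torus K) = F"

definition curve_isomorphic ::
    "(complex \<times> complex) set \<Rightarrow> (complex \<times> complex) set set \<Rightarrow> (complex \<times> complex) set set \<Rightarrow> bool" where
  "curve_isomorphic A F F' \<longleftrightarrow>
     (\<exists>K \<iota> K' \<iota>' f. curve_embedding A K \<iota> F \<and> curve_embedding A K' \<iota>' F' \<and> torus_iso K K' f)"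

definition decompositions ::
    "(complex \<times> complex) set \<Rightarrow> ((complex \<times> complex) set set \<times> (complex \<times> complex) set set) set" where
  "decompositions A =
     {(F1, F2). \<exists>K1 \<iota>1 K2 \<iota>2. curve_embedding A K1 \<iota>1 F1 \<and> curve_embedding A K2 \<iota>2 F2 \<and>
        torus_iso (K1 \<times> K2) A (\<lambda>R. \<iota>1 (fst ` R) \<otimes>\<^bsub>torus A\<^esub> \<iota>2 (snd ` R))}"

definition decomposition_iso ::
    "(complex \<times> complex) set \<Rightarrow>
     (((complex \<times> complex) set set \<times> (complex \<times> complex) set set) \<times>
      ((complex \<times> complex) set set \<times> (complex \<times> complex) set set)) set" where
  "decomposition_iso A =
     {((F1, F2), (F1', F2')). (F1, F2) \<in> decompositions A \<and> (F1', F2') \<in> decompositions A \<and>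
        (curve_isomorphic A F1 F1' \<and> curve_isomorphic A F2 F2' \<or>
         curve_isomorphic A F1 F2' \<and> curve_isomorphic A F2 F1')}"

definition Dec ::
    "(complex \<times> complex) set \<Rightarrow> ((complex \<times> complex) set set \<times> (complex \<times> complex) set set) set set" where
  "Dec A = decompositions A // decomposition_iso A"


section \<open>The decompositions constructed from a cyclic isogeny\<close>

definition coprime_splittings :: "nat \<Rightarrow> (nat \<times> nat) set" where
  "coprime_splittings N = {(r, s). r > 0 \<and> s > 0 \<and> coprime r s \<and> r * s = N \<and> r \<le> s}"

definition primary_component :: "('a, 'b) monoid_scheme \<Rightarrow> 'a set \<Rightarrow> nat \<Rightarrow> 'a set" where
  "primary_component T G p = {P \<in> G. \<exists>k. P [^]\<^bsub>T\<^esub> (p ^ k) = \<one>\<^bsub>T\<^esub>}"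

text \<open>The sum of the \<open>p\<close>-primary components of the kernel of \<open>\<phi>\<close> over the primes \<open>p\<close> dividing \<open>m\<close>.\<close>
definition kernel_part ::
    "complex set \<Rightarrow> complex set \<Rightarrow> (complex set \<Rightarrow> complex set) \<Rightarrow> nat \<Rightarrow> complex set set" where
  "kernel_part L1 L2 \<phi> m =
     generate (torus L1)
       (\<Union>p\<in>{p. prime p \<and> p dvd m}.
          primary_component (torus L1) (kernel (torus L1) (torus L2) \<phi>) p)"

text \<open>\<open>mid_curve L1 L2 \<phi> m\<close> is the quotient of \<open>L1\<close> by \<open>kernel_part L1 L2 \<phi> m\<close>, and \<open>\<phi>\<close> factors as
  \<open>phi_minus L1 L2 \<phi> m \<circ> phi_plus L1 L2 \<phi> m\<close> through it. For \<open>\<sigma> = (r, s)\<close>, the objects with index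
  \<open>(\<sigma>, 1)\<close> are those for \<open>m = r\<close>, and the objects with index \<open>(\<sigma>, 2)\<close> are those for \<open>m = s\<close>.\<close>
definition mid_curve ::
    "complex set \<Rightarrow> complex set \<Rightarrow> (complex set \<Rightarrow> complex set) \<Rightarrow> nat \<Rightarrow> complex set" where
  "mid_curve L1 L2 \<phi> m = quot_lattice (kernel_part L1 L2 \<phi> m)"

definition phi_plus ::
    "complex set \<Rightarrow> complex set \<Rightarrow> (complex set \<Rightarrow> complex set) \<Rightarrow> nat \<Rightarrow> complex set \<Rightarrow> complex set" where
  "phi_plus L1 L2 \<phi> m = quot_map (kernel_part L1 L2 \<phi> m)"

definition phi_minus ::
    "complex set \<Rightarrow> complex set \<Rightarrow> (complex set \<Rightarrow> complex set) \<Rightarrow> nat \<Rightarrow> complex set \<Rightarrow> complex set" where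
  "phi_minus L1 L2 \<phi> m = factor_map L1 (mid_curve L1 L2 \<phi> m) L2 (phi_plus L1 L2 \<phi> m) \<phi>"

definition phi_plus_dual ::
    "complex set \<Rightarrow> complex set \<Rightarrow> (complex set \<Rightarrow> complex set) \<Rightarrow> nat \<Rightarrow> complex set \<Rightarrow> complex set" where
  "phi_plus_dual L1 L2 \<phi> m = dual_isogeny L1 (mid_curve L1 L2 \<phi> m) (phi_plus L1 L2 \<phi> m)"

definition alpha ::
    "complex set \<Rightarrow> complex set \<Rightarrow> (complex set \<Rightarrow> complex set) \<Rightarrow>
     (nat \<times> nat \<Rightarrow> int) \<Rightarrow> (nat \<times> nat \<Rightarrow> int) \<Rightarrow> nat \<times> nat \<Rightarrow>
     (complex \<times> complex) set \<Rightarrow> (complex \<times> complex) set" where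
  "alpha L1 L2 \<phi> a b = (\<lambda>(r, s) R.
     let P = fst ` R; Q = snd ` R in
       (phi_plus_dual L1 L2 \<phi> r P \<otimes>\<^bsub>torus L1\<^esub> phi_plus_dual L1 L2 \<phi> s Q [^]\<^bsub>torus L1\<^esub> b (r, s)) \<times>
       (inv\<^bsub>torus L2\<^esub> phi_minus L1 L2 \<phi> r P \<otimes>\<^bsub>torus L2\<^esub> phi_minus L1 L2 \<phi> s Q [^]\<^bsub>torus L2\<^esub> a (r, s)))"

definition alpha_decomposition ::
    "complex set \<Rightarrow> complex set \<Rightarrow> (complex set \<Rightarrow> complex set) \<Rightarrow>
     (nat \<times> nat \<Rightarrow> int) \<Rightarrow> (nat \<times> nat \<Rightarrow> int) \<Rightarrow> nat \<times> nat \<Rightarrow>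
     (complex \<times> complex) set set \<times> (complex \<times> complex) set set" where
  "alpha_decomposition L1 L2 \<phi> a b = (\<lambda>(r, s).
     let E1 = torus (mid_curve L1 L2 \<phi> r); E2 = torus (mid_curve L1 L2 \<phi> s) in
       ((\<lambda>P. alpha L1 L2 \<phi> a b (r, s) (P \<times> \<one>\<^bsub>E2\<^esub>)) ` carrier E1,
        (\<lambda>Q. alpha L1 L2 \<phi> a b (r, s) (\<one>\<^bsub>E1\<^esub> \<times> Q)) ` carrier E2))"

end

theory Submission
  imports Defs
begin

text \<open>
  Everything is carried out on universal covers. A holomorphic homomorphism of complex tori lifts to
  a complex linear map (\<open>torus_hom_lift\<close>). Hence isomorphic elliptic curves are those with homothetic
  lattices, the isogeny \<open>\<phi>\<close> is multiplication by some \<open>\<nu> \<noteq> 0\<close>, and a decomposition of the surface \<open>A\<close>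
  is a linear isomorphism between \<open>A\<close> and a product of two curves. An embedded curve determines its
  source up to homothety (\<open>curve_embedding_unique\<close>), so isomorphism of decompositions is a statement
  about unordered pairs of homothety classes of lattices.

  The hypotheses on the N\'eron--Severi group enter only through \<open>hom_cyclic\<close>: every homomorphism
  from \<open>L1\<close> to \<open>L2\<close> is an integral multiple of \<open>\<phi>\<close>. Two integrally independent homomorphisms would
  give, together with the classes of the two factors, four independent classes, which contradicts
  Picard number 3 (\<open>hom_relation\<close>). Moreover a homomorphism of degree \<open>d\<close> and the two factors span
  a sublattice of discriminant \<open>2 d\<close>, so \<open>d\<close> is \<open>N\<close> times a square
  (\<open>degree_hom_eq_square_times\<close>), and \<open>\<phi>\<close>, having degree \<open>N\<close>, cannot be divided.
  By the elementary divisor theorem (\<open>stacked_basis\<close>) one may then write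
  \<open>L2 = \<int> w1 + \<int> w2\<close> and \<open>\<nu> L1 = \<int> w1 + \<int> N w2\<close>: the kernel of \<open>\<phi>\<close> is cyclic of order \<open>N\<close>, and the
  quotient of \<open>L1\<close> by the part of order \<open>r\<close>, with \<open>r s = N\<close>, has the lattice \<open>mid s\<close>, which is
  \<open>\<int> w1 + \<int> s w2\<close> up to the factor \<open>\<nu>\<close>.

  In these coordinates \<open>\<alpha>\<close> is given by a matrix of determinant \<open>(a r + b s) \<nu> = \<nu>\<close> whose inverse also
  preserves the lattices, so it yields a decomposition into curves isomorphic to \<open>mid s\<close> and \<open>mid r\<close>.
  For distinct divisors \<open>s\<close> of \<open>N\<close> the lattices \<open>mid s\<close> are not homothetic, because a homothety
  factor and its inverse would both be integers (\<open>homothetic_mid\<close>). Conversely, a curve of a decomposition has a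
  tangent direction with coprime integral coordinates \<open>(P : Q \<nu>)\<close>, hence is some \<open>mid s\<close> with
  \<open>s = N / gcd N P\<close>, and surjectivity of the map from the product of two such curves forces the
  indices \<open>s\<close> and \<open>s'\<close> of a decomposition to be coprime with product \<open>N\<close>
  (\<open>complementary_cofactors\<close>). Thus a decomposition determines an unordered coprime factorisation
  of \<open>N\<close>, and each factorisation comes from exactly one pair \<open>(r, s)\<close> with \<open>r \<le> s\<close>.
\<close>

section \<open>Tori as groups, and lifts of their homomorphisms\<close>

definition add_subgroup :: "'a::ab_group_add set \<Rightarrow> bool" where
  "add_subgroup L \<longleftrightarrow> 0 \<in> L \<and> (\<forall>x\<in>L. \<forall>y\<in>L. x - y \<in> L)"

lemma add_subgroupD:
  assumes "add_subgroup L"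
  shows "0 \<in> L" "x \<in> L \<Longrightarrow> y \<in> L \<Longrightarrow> x - y \<in> L" "x \<in> L \<Longrightarrow> - x \<in> L"
    "x \<in> L \<Longrightarrow> y \<in> L \<Longrightarrow> x + y \<in> L"
proof -
  show 1: "0 \<in> L" and 2: "\<And>x y. x \<in> L \<Longrightarrow> y \<in> L \<Longrightarrow> x - y \<in> L"
    using assms by (auto simp: add_subgroup_def)
  show 3: "x \<in> L \<Longrightarrow> - x \<in> L" for x using 1 2[of 0 x] by simp
  show "x \<in> L \<Longrightarrow> y \<in> L \<Longrightarrow> x + y \<in> L" using 2[of x "- y"] 3 by simp
qed

lemma add_subgroup_of_int:
  fixes x :: "'a::real_vector"
  assumes L: "add_subgroup L" and x: "x \<in> L"
  shows "of_int n *\<^sub>R x \<in> L"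
proof -
  have nat: "of_nat k *\<^sub>R x \<in> L" for k
    by (induction k) (auto simp: scaleR_add_left add_subgroupD[OF L] x)
  show ?thesis
  proof (cases "n \<ge> 0")
    case True
    then show ?thesis using nat[of "nat n"] by simp
  next
    case False
    then have "of_int n *\<^sub>R x = - (of_nat (nat (- n)) *\<^sub>R x)" by simp
    then show ?thesis using nat add_subgroupD(3)[OF L] by metis
  qed
qed

lemma add_subgroup_Times: "add_subgroup L \<Longrightarrow> add_subgroup M \<Longrightarrow> add_subgroup (L \<times> M)"
  by (auto simp: add_subgroup_def zero_prod_def)

text \<open>An isolated origin; for an additive subgroup this is discreteness.\<close>
definition discrete_set :: "'a::real_normed_vector set \<Rightarrow> bool" where
  "discrete_set L \<longleftrightarrow> (\<exists>e>0. \<forall>x\<in>L. norm x < e \<longrightarrow> x = 0)"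

lemma discrete_set_Times:
  assumes "discrete_set L" "discrete_set M"
  shows "discrete_set (L \<times> M)"
proof -
  obtain e where e: "e > 0" "\<And>x. x \<in> L \<Longrightarrow> norm x < e \<Longrightarrow> x = 0"
    using assms(1) unfolding discrete_set_def by blast
  obtain d where d: "d > 0" "\<And>x. x \<in> M \<Longrightarrow> norm x < d \<Longrightarrow> x = 0"
    using assms(2) unfolding discrete_set_def by blast
  have "x = 0" if "x \<in> L \<times> M" "norm x < min e d" for x
  proof -
    have "norm (fst x) < e" "norm (snd x) < d"
      using that(2) norm_fst_le[of "fst x" "snd x"] norm_snd_le[of "snd x" "fst x"] by simp_all
    then have "fst x = 0" "snd x = 0" using that(1) e(2) d(2) by (cases x; simp)+
    then show ?thesis by (simp add: prod_eq_iff)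
  qed
  then show ?thesis unfolding discrete_set_def using e(1) d(1) by (intro exI[of _ "min e d"]) auto
qed

definition complex_linear :: "('a::complex_space \<Rightarrow> 'b::complex_space) \<Rightarrow> bool" where
  "complex_linear T \<longleftrightarrow> linear T \<and> (\<forall>c v. T (c *\<^sub>C v) = c *\<^sub>C T v)"

lemma complex_linear_compose:
  "complex_linear S \<Longrightarrow> complex_linear T \<Longrightarrow> complex_linear (\<lambda>x. S (T x))"
  unfolding complex_linear_def using linear_compose[of T S] by (auto simp: o_def)

text \<open>The values of \<open>T\<close> on the line through \<open>x\<close> contain arbitrarily small multiples of \<open>T x\<close>.\<close>
lemma linear_into_discrete_eq_0:
  assumes T: "linear T" and L: "discrete_set L" and TL: "\<And>x. T x \<in> L"
  shows "T x = 0"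
proof -
  obtain e where e: "e > 0" "\<And>x. x \<in> L \<Longrightarrow> norm x < e \<Longrightarrow> x = 0"
    using L unfolding discrete_set_def by blast
  define t where "t = e / (2 * (norm (T x) + 1))"
  have pos: "norm (T x) + 1 > 0" using norm_ge_zero[of "T x"] by linarith
  then have t: "t > 0" using e(1) by (simp add: t_def)
  have "norm (T (t *\<^sub>R x)) = e / 2 * (norm (T x) / (norm (T x) + 1))"
    using t e(1) pos by (simp add: linear_scale[OF T] t_def field_simps)
  also have "\<dots> \<le> e / 2 * 1"
    by (intro mult_left_mono) (use e(1) pos in \<open>auto simp: divide_simps\<close>)
  also have "\<dots> < e" using e(1) by simp
  finally have "T (t *\<^sub>R x) = 0" using e(2)[OF TL] by blast
  then show ?thesis using t by (simp add: linear_scale[OF T])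
qed

lemma torus_proj_eq: "torus_proj L x = (\<lambda>l. l + x) ` L"
  unfolding torus_proj_def r_coset_def add_grp_def by auto

lemma carrier_torus: "carrier (torus L) = range (torus_proj L)"
  unfolding torus_def carrier_FactGroup torus_proj_def by (simp add: add_grp_def)

lemma torus_proj_in_carrier [simp]: "torus_proj L x \<in> carrier (torus L)"
  by (simp add: carrier_torus)

lemma group_add_grp: "group (add_grp :: 'a::ab_group_add monoid)"
  unfolding add_grp_def
proof (rule groupI; simp add: add.assoc)
  fix x :: 'a show "\<exists>y. y + x = 0" by (rule exI[of _ "- x"]) simp
qed

lemma normal_add_grp:
  fixes L :: "'a::ab_group_add set"
  assumes "add_subgroup L"
  shows "L \<lhd> add_grp"
proof -
  interpret comm_group "add_grp :: 'a monoid"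
    by (rule group.group_comm_groupI[OF group_add_grp]) (simp add: add_grp_def add.commute)
  have inv: "inv\<^bsub>add_grp\<^esub> x = - x" for x :: 'a
    by (rule inv_equality) (auto simp: add_grp_def)
  have "subgroup L add_grp"
    by (rule subgroupI) (use add_subgroupD[OF assms] in \<open>auto simp: inv, auto simp: add_grp_def\<close>)
  then show ?thesis by (rule subgroup_imp_normal)
qed

lemma group_torus: "add_subgroup L \<Longrightarrow> group (torus L)"
  unfolding torus_def by (rule normal.factorgroup_is_group[OF normal_add_grp])

lemma mem_torus_proj: "y \<in> torus_proj L x \<longleftrightarrow> y - x \<in> L"
proof
  assume "y - x \<in> L"
  then have "(y - x) + x \<in> torus_proj L x" unfolding torus_proj_eq by (rule imageI)
  then show "y \<in> torus_proj L x" by simp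
qed (auto simp: torus_proj_eq)

lemma torus_proj_eq_iff:
  assumes "add_subgroup L"
  shows "torus_proj L x = torus_proj L y \<longleftrightarrow> x - y \<in> L"
proof
  assume "torus_proj L x = torus_proj L y"
  moreover have "x \<in> torus_proj L x"
    unfolding torus_proj_eq using add_subgroupD(1)[OF assms] by force
  ultimately show "x - y \<in> L" unfolding torus_proj_eq by auto
next
  assume xy: "x - y \<in> L"
  have "z - x \<in> L \<longleftrightarrow> z - y \<in> L" for z
    using add_subgroupD(4)[OF assms _ xy, of "z - x"] add_subgroupD(2)[OF assms _ xy, of "z - y"]
    by auto
  moreover have "torus_proj L x = {z. z - x \<in> L}" for x
    by (auto simp: mem_torus_proj)
  ultimately show "torus_proj L x = torus_proj L y" by simp
qed

lemma torus_mult: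
  assumes "add_subgroup L"
  shows "torus_proj L x \<otimes>\<^bsub>torus L\<^esub> torus_proj L y = torus_proj L (x + y)"
proof -
  have *: "z \<in> torus_proj L x <#>\<^bsub>add_grp\<^esub> torus_proj L y \<longleftrightarrow> z - (x + y) \<in> L" for z
  proof
    assume "z \<in> torus_proj L x <#>\<^bsub>add_grp\<^esub> torus_proj L y"
    then obtain l l' where l: "l \<in> L" "l' \<in> L" and z: "z = (l + x) + (l' + y)"
      by (auto simp: set_mult_def torus_proj_eq add_grp_def)
    show "z - (x + y) \<in> L"
      using add_subgroupD(4)[OF assms l] unfolding z by (simp add: algebra_simps)
  next
    assume z: "z - (x + y) \<in> L"
    have "z - y \<in> torus_proj L x" "y \<in> torus_proj L y"
      using z add_subgroupD(1)[OF assms] by (simp_all add: mem_torus_proj algebra_simps)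
    then have "(z - y) \<otimes>\<^bsub>add_grp\<^esub> y \<in> torus_proj L x <#>\<^bsub>add_grp\<^esub> torus_proj L y"
      unfolding set_mult_def by blast
    then show "z \<in> torus_proj L x <#>\<^bsub>add_grp\<^esub> torus_proj L y" by (simp add: add_grp_def)
  qed
  show ?thesis unfolding torus_def mult_FactGroup
    using * by (auto simp only: set_eq_iff mem_torus_proj)
qed

lemma torus_one: "add_subgroup L \<Longrightarrow> \<one>\<^bsub>torus L\<^esub> = torus_proj L 0"
  unfolding torus_def one_FactGroup by (simp add: torus_proj_eq)

lemma torus_inv:
  assumes "add_subgroup L"
  shows "inv\<^bsub>torus L\<^esub> torus_proj L x = torus_proj L (- x)"
  by (rule group.inv_equality[OF group_torus[OF assms]])
     (auto simp: torus_mult[OF assms] torus_one[OF assms])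

lemma torus_pow_nat:
  assumes "add_subgroup L"
  shows "torus_proj L x [^]\<^bsub>torus L\<^esub> (n::nat) = torus_proj L (of_nat n *\<^sub>R x)"
  by (induction n)
     (auto simp: torus_one torus_mult assms
        scaleR_add_left add.commute)

lemma torus_pow_int:
  assumes "add_subgroup L"
  shows "torus_proj L x [^]\<^bsub>torus L\<^esub> (n::int) = torus_proj L (of_int n *\<^sub>R x)"
proof (cases "n \<ge> 0")
  case True
  then show ?thesis unfolding int_pow_def2 by (simp add: torus_pow_nat assms del: pow_nat)
next
  case False
  then have "of_int n = - real (nat (- n))" by simp
  then have "of_int n *\<^sub>R x = - (real (nat (- n)) *\<^sub>R x)" by (metis scaleR_minus_left)
  then show ?thesis
    using False unfolding int_pow_def2 by (simp add: torus_pow_nat torus_inv assms del: pow_nat)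
qed

lemma torus_proj_Times: "torus_proj (L \<times> M) (x, y) = torus_proj L x \<times> torus_proj M y"
  by (auto simp: mem_torus_proj)

lemma torus_proj_nonempty: "add_subgroup L \<Longrightarrow> torus_proj L x \<noteq> {}"
  by (auto simp: torus_proj_eq add_subgroup_def)

lemma torus_proj_components:
  assumes "add_subgroup L" "add_subgroup M"
  shows "fst ` torus_proj (L \<times> M) z = torus_proj L (fst z)"
    "snd ` torus_proj (L \<times> M) z = torus_proj M (snd z)"
  using torus_proj_nonempty[OF assms(1)] torus_proj_nonempty[OF assms(2)]
  by (cases z; simp add: torus_proj_Times fst_image_times snd_image_times)+

definition lifted_by ::
    "'a::complex_space set \<Rightarrow> 'b::complex_space set \<Rightarrow> ('a set \<Rightarrow> 'b set) \<Rightarrow> ('a \<Rightarrow> 'b) \<Rightarrow> bool" where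
  "lifted_by L M f T \<longleftrightarrow> (\<forall>x. f (torus_proj L x) = torus_proj M (T x))"

text \<open>A lift maps the lattice to the lattice, since lattice points project to the origin.\<close>
lemma lifted_by_lattice:
  assumes "lifted_by L M f T" "linear T" "add_subgroup L" "add_subgroup M" "x \<in> L"
  shows "T x \<in> M"
proof -
  have "torus_proj L x = torus_proj L 0" using assms by (simp add: torus_proj_eq_iff)
  then have "torus_proj M (T x) = torus_proj M (T 0)" using assms(1) unfolding lifted_by_def by metis
  then show ?thesis using assms by (simp add: torus_proj_eq_iff linear_0)
qed

lemma torus_homI:
  fixes L :: "'a::complex_space set" and M :: "'b::complex_space set"
  assumes L: "add_subgroup L" and M: "add_subgroup M"
    and T: "complex_linear T" and f: "lifted_by L M f T"
  shows "f \<in> torus_hom L M"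
proof -
  have lin: "linear T" using T by (simp add: complex_linear_def)
  have "f \<in> hom (torus L) (torus M)"
    using f unfolding hom_def carrier_torus lifted_by_def
    by (auto simp: torus_mult L M linear_add[OF lin])
  moreover have "cdifferentiable_on T UNIV"
    using T linear_imp_has_derivative[OF lin] unfolding cdifferentiable_on_def complex_linear_def
    by blast
  ultimately show ?thesis
    using f unfolding torus_hom_def torus_holomorphic_def lifted_by_def by fastforce
qed

text \<open>A holomorphic homomorphism is near \<open>0\<close> given by a map \<open>g\<close> with \<open>g 0 = 0\<close>. The difference
  \<open>g x - 2 g (x / 2)\<close> is a small lattice point, hence zero, so \<open>g x = 2\<^sup>n g (x / 2\<^sup>n)\<close> tends to
  the value at \<open>x\<close> of the derivative of \<open>g\<close> at \<open>0\<close>. Thus \<open>g\<close> agrees with its derivative near \<open>0\<close>,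
  and doubling propagates this to the whole torus.\<close>
lemma torus_hom_lift:
  fixes L :: "'a::complex_space set" and M :: "'b::complex_space set"
  assumes L: "add_subgroup L" and M: "add_subgroup M" and Md: "discrete_set M"
    and f: "f \<in> torus_hom L M"
  obtains T where "complex_linear T" "lifted_by L M f T"
proof -
  have fhom: "f \<in> hom (torus L) (torus M)" and fhol: "torus_holomorphic L M f"
    using f by (auto simp: torus_hom_def)
  obtain U h where U: "open U" "0 \<in> U" and h: "cdifferentiable_on h U"
    and fh: "\<And>y. y \<in> U \<Longrightarrow> f (torus_proj L y) = torus_proj M (h y)"
    using fhol unfolding torus_holomorphic_def by metis
  obtain D where D: "(h has_derivative D) (at 0)" and Dc: "\<And>c v. D (c *\<^sub>C v) = c *\<^sub>C D v"
    using h U(2) unfolding cdifferentiable_on_def by blast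
  have Dbl: "bounded_linear D" using D by (rule has_derivative_bounded_linear)
  have Dlin: "linear D" using Dbl by (rule bounded_linear.linear)
  have f2: "f (torus_proj L (x + y)) = f (torus_proj L x) \<otimes>\<^bsub>torus M\<^esub> f (torus_proj L y)" for x y
    using hom_mult[OF fhom, of "torus_proj L x" "torus_proj L y"] by (simp add: torus_mult[OF L])
  have "f (torus_proj L 0) = torus_proj M 0"
    using hom_one[OF fhom group_torus[OF L] group_torus[OF M]] by (simp add: torus_one L M)
  then have h0: "h 0 \<in> M" using fh[OF U(2)] torus_proj_eq_iff[OF M, of "h 0" 0] by simp
  define g where "g = (\<lambda>y. h y - h 0)"
  have fg: "f (torus_proj L y) = torus_proj M (g y)" if "y \<in> U" for y
    unfolding g_def fh[OF that] torus_proj_eq_iff[OF M] using h0 by simp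
  have approx: "\<exists>d>0. \<forall>y. norm y < d \<longrightarrow> norm (g y - D y) \<le> e * norm y" if "e > 0" for e
    using D that unfolding has_derivative_at_alt g_def by force
  obtain K where K: "K > 0" "\<And>y. norm (D y) \<le> norm y * K"
    using bounded_linear.pos_bounded[OF Dbl] by blast
  obtain e where e: "e > 0" "\<And>x. x \<in> M \<Longrightarrow> norm x < e \<Longrightarrow> x = 0"
    using Md unfolding discrete_set_def by blast
  obtain d where d: "d > 0" "\<And>y. norm y < d \<Longrightarrow> norm (g y - D y) \<le> 1 * norm y"
    using approx[of 1] by auto
  obtain d' where d': "d' > 0" "ball 0 d' \<subseteq> U" using U open_contains_ball by blast
  define \<delta> where "\<delta> = min (min d d') (e / (2 * (K + 1)))"
  have \<delta>: "\<delta> > 0" using d(1) d'(1) e(1) K(1) by (simp add: \<delta>_def)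
  have gb: "norm (g y) \<le> (K + 1) * norm y" if "norm y < d" for y
    using d(2)[OF that] K(2)[of y] norm_triangle_ineq[of "g y - D y" "D y"]
    by (simp add: algebra_simps)
  have half: "g y = 2 *\<^sub>R g ((1/2) *\<^sub>R y)" if y: "norm y < \<delta>" for y
  proof -
    have yd: "norm y < d" "norm y < d'" "norm y < e / (2 * (K + 1))" using y by (auto simp: \<delta>_def)
    define z where "z = (1/2::real) *\<^sub>R y"
    have z: "norm z = norm y / 2" "y = z + z" by (simp_all add: z_def flip: scaleR_add_left)
    have "norm z < d'" using yd(2) z(1) norm_ge_zero[of y] by linarith
    then have "y \<in> U" "z \<in> U" using yd(2) by (auto intro!: subsetD[OF d'(2)])
    then have "torus_proj M (g y) = torus_proj M (g z + g z)"
      using fg f2[of z z] by (simp add: torus_mult[OF M] flip: z(2))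
    then have "g y - (g z + g z) \<in> M" by (simp add: torus_proj_eq_iff[OF M])
    moreover have "norm (g y - (g z + g z)) < e"
    proof -
      have "norm (g y - (g z + g z)) \<le> norm (g y) + (norm (g z) + norm (g z))"
        by (meson norm_triangle_ineq4 norm_triangle_ineq add_left_mono order_trans)
      also have "\<dots> \<le> (K + 1) * norm y + (K + 1) * norm y"
        using gb[OF yd(1)] gb[of z] yd(1) z(1) norm_ge_zero[of y] by (simp add: field_simps)
      also have "\<dots> < e" using yd(3) K(1) by (simp add: field_simps)
      finally show ?thesis .
    qed
    ultimately have "g y - (g z + g z) = 0" using e(2) by blast
    then show ?thesis unfolding z_def by (simp add: scaleR_2)
  qed
  have halves: "g y = 2 ^ n *\<^sub>R g ((1 / 2 ^ n) *\<^sub>R y)" if y: "norm y < \<delta>" for y n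
  proof (induction n)
    case (Suc n)
    have "norm ((1 / 2 ^ n) *\<^sub>R y) \<le> norm y"
      by (simp add: divide_le_eq mult_le_cancel_left1)
    then have "norm ((1 / 2 ^ n) *\<^sub>R y) < \<delta>" using y by linarith
    from half[OF this] show ?case using Suc by (simp add: field_simps)
  qed simp
  have gD: "g y = D y" if y: "norm y < \<delta>" for y
  proof -
    have "norm (g y - D y) \<le> r * norm y" if r: "r > 0" for r
    proof -
      obtain \<rho> where \<rho>: "\<rho> > 0" "\<And>y. norm y < \<rho> \<Longrightarrow> norm (g y - D y) \<le> r * norm y"
        using approx[OF r] by blast
      obtain n :: nat where n: "norm y / \<rho> < 2 ^ n" using real_arch_pow[of 2] by auto
      define z where "z = (1 / 2 ^ n :: real) *\<^sub>R y"
      have "norm z < \<rho>" using n \<rho>(1) by (simp add: z_def field_simps)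
      have "D y = 2 ^ n *\<^sub>R D z" by (simp add: z_def linear_scale[OF Dlin])
      then have "g y - D y = 2 ^ n *\<^sub>R (g z - D z)"
        using halves[OF y, of n] by (simp add: z_def scaleR_diff_right)
      then have "norm (g y - D y) = 2 ^ n * norm (g z - D z)" by simp
      also have "\<dots> \<le> 2 ^ n * (r * norm z)"
        using \<rho>(2)[OF \<open>norm z < \<rho>\<close>] by (intro mult_left_mono) auto
      also have "\<dots> = r * norm y" by (simp add: z_def)
      finally show ?thesis .
    qed
    then have bound: "norm (g y - D y) \<le> r * norm y" if "r > 0" for r using that by blast
    have "norm (g y - D y) \<le> 0 + r" if r: "r > 0" for r
    proof -
      have y1: "norm y + 1 > 0" using norm_ge_zero[of y] by linarith
      have "norm (g y - D y) \<le> r / (norm y + 1) * norm y" using bound[of "r / (norm y + 1)"] r y1 by simp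
      also have "\<dots> \<le> r / (norm y + 1) * (norm y + 1)" using r y1 by (intro mult_left_mono) auto
      also have "\<dots> = 0 + r" using y1 by simp
      finally show ?thesis .
    qed
    then have "norm (g y - D y) \<le> 0" by (rule field_le_epsilon)
    then show ?thesis by simp
  qed
  have "f (torus_proj L x) = torus_proj M (D x)" if "norm x < 2 ^ n * \<delta>" for n x
    using that
  proof (induction n arbitrary: x)
    case 0
    then have "x \<in> U" using d'(2) by (auto simp: \<delta>_def)
    then show ?case using fg gD 0 by simp
  next
    case (Suc n)
    define z where "z = (1/2::real) *\<^sub>R x"
    have z: "norm z = norm x / 2" "x = z + z" by (simp_all add: z_def flip: scaleR_add_left)
    have "f (torus_proj L z) = torus_proj M (D z)" using Suc z(1) by simp
    then show ?case using f2[of z z]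
      by (simp add: torus_mult[OF M] linear_add[OF Dlin, symmetric] flip: z(2))
  qed
  moreover have "\<exists>n. norm x < 2 ^ n * \<delta>" for x :: 'a
    using real_arch_pow[of 2 "norm x / \<delta>"] \<delta> by (auto simp: field_simps)
  ultimately have "lifted_by L M f D" unfolding lifted_by_def by blast
  moreover have "complex_linear D" using Dlin Dc by (simp add: complex_linear_def)
  ultimately show thesis using that by blast
qed

section \<open>Lattices in the complex plane\<close>

definition lat :: "complex \<Rightarrow> complex \<Rightarrow> complex set" where
  "lat u v = {of_int x * u + of_int y * v | x y. True}"

text \<open>The signed area of the parallelogram spanned by \<open>u\<close> and \<open>v\<close>; its vanishing is linear
  dependence over the reals, and its quotients are coordinates by Cramer's rule.\<close>
definition area :: "complex \<Rightarrow> complex \<Rightarrow> real" where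
  "area u v = Im (cnj u * v)"

lemma lat_iff: "z \<in> lat u v \<longleftrightarrow> (\<exists>x y. z = of_int x * u + of_int y * v)"
  by (auto simp: lat_def)

lemma latI: "of_int x * u + of_int y * v \<in> lat u v"
  by (auto simp: lat_def)

lemma real_coordinates:
  assumes "area u v \<noteq> 0"
  shows "of_real (area z v / area u v) * u + of_real (area u z / area u v) * v = z"
proof -
  have "of_real (area z v) * u + of_real (area u z) * v = of_real (area u v) * z"
    by (auto simp: complex_eq_iff area_def algebra_simps)
  then show ?thesis using assms by (simp add: divide_simps)
qed

lemma area_combination:
  "area (of_real x * u + of_real y * v) v = x * area u v"
  "area u (of_real x * u + of_real y * v) = y * area u v"
  by (simp_all add: area_def algebra_simps)

lemma real_coordinates_unique:
  assumes "area u v \<noteq> 0" "of_real x * u + of_real y * v = of_real x' * u + of_real y' * v"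
  shows "x = x'" "y = y'"
  using area_combination[where x = x and u = u and y = y and v = v]
    area_combination[where x = x' and u = u and y = y' and v = v] assms by auto

lemma int_coordinates_unique:
  assumes "area u v \<noteq> 0" "of_int x * u + of_int y * v = of_int x' * u + of_int y' * v"
  shows "x = x'" "y = y'"
  using real_coordinates_unique[of u v "of_int x" "of_int y" "of_int x'" "of_int y'"] assms by auto

lemma add_subgroup_lat: "add_subgroup (lat u v)"
  unfolding add_subgroup_def
proof (intro conjI ballI)
  show "0 \<in> lat u v" using latI[of 0 u 0 v] by simp
next
  fix z w assume "z \<in> lat u v" "w \<in> lat u v"
  then obtain x y x' y' where "z = of_int x * u + of_int y * v" "w = of_int x' * u + of_int y' * v"
    unfolding lat_iff by blast
  then have "z - w = of_int (x - x') * u + of_int (y - y') * v" by (simp add: algebra_simps)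
  then show "z - w \<in> lat u v" by (simp only: latI)
qed

lemma add_subgroup_int_mult:
  fixes x :: complex
  shows "add_subgroup M \<Longrightarrow> x \<in> M \<Longrightarrow> of_int n * x \<in> M"
  using add_subgroup_of_int[of M x n] by (simp add: scaleR_conv_of_real)

lemma countable_lat: "countable (lat u v)"
proof -
  have "lat u v = (\<lambda>(x, y). of_int x * u + of_int y * v) ` (UNIV :: (int \<times> int) set)"
    by (auto simp: lat_def)
  then show ?thesis by simp
qed

lemma discrete_lat:
  assumes "area u v \<noteq> 0"
  shows "discrete_set (lat u v)"
proof -
  define e where "e = \<bar>area u v\<bar> / (norm u + norm v + 1)"
  have pos: "norm u + norm v + 1 > 0" using norm_ge_zero[of u] norm_ge_zero[of v] by linarith
  have "z = 0" if z: "z \<in> lat u v" "norm z < e" for z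
  proof -
    obtain x y where xy: "z = of_int x * u + of_int y * v" using z(1) by (auto simp: lat_iff)
    have small: "\<bar>area z w\<bar> < \<bar>area u v\<bar>" "\<bar>area w z\<bar> < \<bar>area u v\<bar>"
      if w: "norm w \<le> norm u + norm v" for w
    proof -
      have *: "norm z * norm w < \<bar>area u v\<bar>"
      proof -
        have "norm z * norm w \<le> norm z * (norm u + norm v + 1)"
          using w by (intro mult_left_mono) auto
        also have "\<dots> < \<bar>area u v\<bar>" using z(2) pos by (simp add: e_def field_simps)
        finally show ?thesis .
      qed
      show "\<bar>area z w\<bar> < \<bar>area u v\<bar>" "\<bar>area w z\<bar> < \<bar>area u v\<bar>"
        using * abs_Im_le_cmod[of "cnj z * w"] abs_Im_le_cmod[of "cnj w * z"]
        by (auto simp: area_def norm_mult mult.commute)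
    qed
    have "area z v = of_int x * area u v" "area u z = of_int y * area u v"
      using area_combination[where x = "of_int x" and u = u and y = "of_int y" and v = v]
      by (simp_all add: xy)
    then have "\<bar>of_int x * area u v\<bar> < 1 * \<bar>area u v\<bar>" "\<bar>of_int y * area u v\<bar> < 1 * \<bar>area u v\<bar>"
      using small(1)[of v] small(2)[of u] by simp_all
    then have "\<bar>real_of_int x\<bar> < 1" "\<bar>real_of_int y\<bar> < 1"
      using assms unfolding abs_mult by (simp_all add: mult_less_cancel_right)
    then have "x = 0" "y = 0" by linarith+
    then show ?thesis by (simp add: xy)
  qed
  moreover have "e > 0" using pos assms by (simp add: e_def)
  ultimately show ?thesis unfolding discrete_set_def by blast
qed

lemma Z_span_pair: "u \<noteq> v \<Longrightarrow> Z_span {u, v} = lat u v"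
proof -
  assume uv: "u \<noteq> v"
  have "\<exists>n. of_int x * u + of_int y * v = (\<Sum>b\<in>{u, v}. of_int (n b) *\<^sub>R b)" for x y
    using uv by (intro exI[of _ "\<lambda>b. if b = u then x else y"]) (simp add: scaleR_conv_of_real)
  moreover have "\<exists>x y. (\<Sum>b\<in>{u, v}. of_int (n b) *\<^sub>R b) = of_int x * u + of_int y * v" for n
    using uv by (intro exI[of _ "n u"] exI[of _ "n v"]) (simp add: scaleR_conv_of_real)
  ultimately show ?thesis unfolding Z_span_def lat_def by auto
qed

lemma independent_pair_iff: "u \<noteq> v \<and> independent {u, v} \<longleftrightarrow> area u v \<noteq> 0"
proof
  assume uv: "u \<noteq> v \<and> independent {u, v}"
  show "area u v \<noteq> 0"
  proof
    assume 0: "area u v = 0"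
    have u: "u \<noteq> 0" using uv dependent_zero by auto
    have "cnj u * v = of_real (Re (cnj u * v))"
      using 0 by (auto simp: complex_eq_iff area_def)
    then have "u * cnj u * v = of_real (Re (cnj u * v)) * u" by (metis mult.assoc mult.commute)
    then have "of_real ((cmod u)\<^sup>2) * v = of_real (Re (cnj u * v)) * u"
      by (simp only: complex_norm_square)
    then have "v = of_real (Re (cnj u * v) / (cmod u)\<^sup>2) * u"
      using u by (simp add: field_simps)
    then have "v \<in> span {u}" by (metis span_base span_scale scaleR_conv_of_real insertI1)
    moreover have "v \<notin> span {u}"
      using uv independent_insert[of v "{u}"] by (auto simp: insert_commute)
    ultimately show False by blast
  qed
next
  assume a: "area u v \<noteq> 0"
  then have u: "u \<noteq> 0" and uv: "u \<noteq> v" by (auto simp: area_def)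
  have "v \<notin> span {u}"
  proof
    assume "v \<in> span {u}"
    then obtain k where "v = k *\<^sub>R u" by (auto simp: span_singleton)
    then show False using a by (simp add: area_def)
  qed
  then have "independent (insert v {u})" using u by (simp add: independent_insert)
  then show "u \<noteq> v \<and> independent {u, v}" using uv by (simp add: insert_commute)
qed

lemma is_lattice_complex_iff: "is_lattice L \<longleftrightarrow> (\<exists>u v. area u v \<noteq> 0 \<and> L = lat u v)"
proof
  assume "is_lattice L"
  then obtain B where B: "independent B" "span B = UNIV" "L = Z_span B"
    unfolding is_lattice_def Z_basis_def by blast
  have "card B = 2"
    using B dim_eq_card[of B UNIV] by (simp add: dim_UNIV)
  then obtain u v where uv: "B = {u, v}" "u \<noteq> v" by (auto simp: card_2_iff)
  then show "\<exists>u v. area u v \<noteq> 0 \<and> L = lat u v"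
    using B independent_pair_iff[of u v] Z_span_pair[of u v] by blast
next
  assume "\<exists>u v. area u v \<noteq> 0 \<and> L = lat u v"
  then obtain u v where uv: "area u v \<noteq> 0" "L = lat u v" by blast
  have "z \<in> span {u, v}" for z
  proof -
    have "of_real (area z v / area u v) * u + of_real (area u z / area u v) * v \<in> span {u, v}"
      unfolding scaleR_conv_of_real[symmetric]
      by (intro span_add span_scale span_base) auto
    then show ?thesis by (simp only: real_coordinates[OF uv(1)])
  qed
  then have "Z_basis L {u, v}"
    using independent_pair_iff[of u v] Z_span_pair[of u v] uv unfolding Z_basis_def by auto
  then show "is_lattice L" unfolding is_lattice_def by blast
qed

lemma lattice_properties:
  assumes "is_lattice (L :: complex set)"
  shows "add_subgroup L" "discrete_set L" "countable L"
proof -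
  obtain u v where "area u v \<noteq> 0" "L = lat u v" using assms is_lattice_complex_iff by blast
  then show "add_subgroup L" "discrete_set L" "countable L"
    using add_subgroup_lat discrete_lat countable_lat by auto
qed

lemma lat_scale: "(\<lambda>z. c * z) ` lat u v = lat (c * u) (c * v)"
proof -
  have "c * (of_int x * u + of_int y * v) = of_int x * (c * u) + of_int y * (c * v)" for x y
    by (simp add: algebra_simps)
  then show ?thesis unfolding lat_def by (auto simp: image_iff) metis+
qed

lemma area_scale: "area (c * u) (c * v) = (cmod c)\<^sup>2 * area u v"
proof -
  have "cnj (c * u) * (c * v) = of_real ((cmod c)\<^sup>2) * (cnj u * v)"
    by (simp only: complex_norm_square complex_cnj_mult mult_ac)
  moreover have "Im (of_real r * z) = r * Im z" for r z by simp
  ultimately show ?thesis unfolding area_def by (simp only:)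
qed

section \<open>Isomorphisms, quotients and embedded curves in terms of lifts\<close>

lemma complex_linear_mult: "complex_linear (\<lambda>z :: complex. c * z)"
  unfolding complex_linear_def by (auto simp: scaleC_complex_def linear_iff algebra_simps scaleR_conv_of_real)

lemma complex_linear_pair: "complex_linear (\<lambda>z :: complex. (p * z, q * z))"
  unfolding complex_linear_def
  by (auto simp: scaleC_complex_def scaleC_prod_def linear_iff algebra_simps scaleR_conv_of_real)

lemma complex_linear_matrix:
  "complex_linear (\<lambda>z :: complex \<times> complex. (p * fst z + p' * snd z, q * fst z + q' * snd z))"
  unfolding complex_linear_def
  by (auto simp: scaleC_complex_def scaleC_prod_def linear_iff algebra_simps scaleR_conv_of_real)

lemma complex_linear_curve_eq:
  assumes "complex_linear (T :: complex \<Rightarrow> 'b::complex_space)"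
  shows "T z = z *\<^sub>C T 1"
  using assms unfolding complex_linear_def by (metis mult.right_neutral scaleC_complex_def)

lemma complex_linear_complex:
  assumes "complex_linear (T :: complex \<Rightarrow> complex)"
  obtains c where "T = (\<lambda>z. c * z)"
proof
  show "T = (\<lambda>z. T 1 * z)"
    by (rule ext, subst complex_linear_curve_eq[OF assms]) (simp add: scaleC_complex_def)
qed

lemma complex_linear_into_plane:
  assumes "complex_linear (T :: complex \<Rightarrow> complex \<times> complex)"
  obtains p q where "T = (\<lambda>z. (p * z, q * z))"
proof
  show "T = (\<lambda>z. (fst (T 1) * z, snd (T 1) * z))"
    by (rule ext, subst complex_linear_curve_eq[OF assms])
       (simp add: scaleC_complex_def scaleC_prod_def)
qed

lemma complex_linear_from_plane:
  assumes "complex_linear (T :: complex \<times> complex \<Rightarrow> complex \<times> complex)"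
  obtains p q p' q' where "T = (\<lambda>z. (p * fst z + p' * snd z, q * fst z + q' * snd z))"
proof -
  have T: "T z = fst z *\<^sub>C T (1, 0) + snd z *\<^sub>C T (0, 1)" for z
  proof -
    have lin: "linear T" and sc: "\<And>c v. T (c *\<^sub>C v) = c *\<^sub>C T v"
      using assms by (auto simp: complex_linear_def)
    have "z = fst z *\<^sub>C (1, 0) + snd z *\<^sub>C (0, 1)"
      by (simp add: scaleC_prod_def scaleC_complex_def)
    then have "T z = T (fst z *\<^sub>C (1, 0) + snd z *\<^sub>C (0, 1))" by (rule arg_cong)
    then show ?thesis by (simp add: linear_add[OF lin] sc)
  qed
  show thesis
  proof (rule that)
    show "T = (\<lambda>z. (fst (T (1, 0)) * fst z + fst (T (0, 1)) * snd z,
        snd (T (1, 0)) * fst z + snd (T (0, 1)) * snd z))"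
      by (rule ext, subst T) (simp add: scaleC_prod_def scaleC_complex_def)
  qed
qed

definition induced_map ::
    "'b::complex_space set \<Rightarrow> ('a::complex_space \<Rightarrow> 'b) \<Rightarrow> 'a set \<Rightarrow> 'b set" where
  "induced_map M T P = torus_proj M (T (SOME x. x \<in> P))"

lemma lifted_by_induced_map:
  assumes L: "add_subgroup L" and M: "add_subgroup M" and T: "linear T"
    and TL: "\<And>x. x \<in> L \<Longrightarrow> T x \<in> M"
  shows "lifted_by L M (induced_map M T) T"
  unfolding lifted_by_def
proof
  fix x
  define y where "y = (SOME y. y \<in> torus_proj L x)"
  have "y \<in> torus_proj L x" unfolding y_def
    by (rule someI[of _ x]) (simp add: mem_torus_proj add_subgroupD(1)[OF L])
  then have "T y - T x \<in> M" using TL by (simp add: mem_torus_proj flip: linear_diff[OF T])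
  then show "induced_map M T (torus_proj L x) = torus_proj M (T x)"
    by (simp add: induced_map_def torus_proj_eq_iff[OF M] flip: y_def)
qed

lemma torus_isoI:
  assumes L: "add_subgroup L" and M: "add_subgroup M"
    and T: "complex_linear T" and S: "complex_linear S"
    and ST: "\<And>x. S (T x) = x" and TS: "\<And>y. T (S y) = y"
    and SM: "\<And>y. y \<in> M \<Longrightarrow> S y \<in> L"
    and f: "lifted_by L M f T"
  shows "torus_iso L M f"
proof -
  have g: "lifted_by M L (induced_map L S) S"
    by (rule lifted_by_induced_map) (use L M S SM in \<open>auto simp: complex_linear_def\<close>)
  show ?thesis unfolding torus_iso_def
    using torus_homI[OF L M T f] torus_homI[OF M L S g] f g
    by (auto intro!: bexI[of _ "induced_map L S"] simp: carrier_torus lifted_by_def ST TS)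
qed

lemma torus_iso_lift:
  assumes L: "add_subgroup L" "discrete_set L" and M: "add_subgroup M" "discrete_set M"
    and f: "torus_iso L M f"
  obtains T S where "complex_linear T" "complex_linear S" "\<And>x. S (T x) = x" "\<And>y. T (S y) = y"
    "\<And>x. x \<in> L \<longleftrightarrow> T x \<in> M" "lifted_by L M f T"
proof -
  obtain g where fh: "f \<in> torus_hom L M" and gh: "g \<in> torus_hom M L"
    and gf: "\<And>x. g (f (torus_proj L x)) = torus_proj L x"
    and fg: "\<And>y. f (g (torus_proj M y)) = torus_proj M y"
    using f unfolding torus_iso_def by auto
  obtain T where T: "complex_linear T" "lifted_by L M f T"
    using torus_hom_lift[OF L(1) M fh] by blast
  obtain S where S: "complex_linear S" "lifted_by M L g S"
    using torus_hom_lift[OF M(1) L gh] by blast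
  have lin: "linear T" "linear S" using S T by (auto simp: complex_linear_def)
  have id: "S (T x) = x" "T (S y) = y" for x y
  proof -
    have "linear (\<lambda>x. S (T x) - x)"
      using linear_compose[OF lin] by (intro linear_compose_sub) (auto simp: o_def linear_id[unfolded id_def])
    moreover have "S (T x) - x \<in> L" for x
      using gf[of x] T(2) S(2) by (simp add: lifted_by_def torus_proj_eq_iff[OF L(1)])
    ultimately show "S (T x) = x" using linear_into_discrete_eq_0[of "\<lambda>x. S (T x) - x" L x] L(2) by simp
    have "linear (\<lambda>x. T (S x) - x)"
      using linear_compose[OF lin(2,1)] by (intro linear_compose_sub) (auto simp: o_def linear_id[unfolded id_def])
    moreover have "T (S x) - x \<in> M" for x
      using fg[of x] T(2) S(2) by (simp add: lifted_by_def torus_proj_eq_iff[OF M(1)])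
    ultimately show "T (S y) = y" using linear_into_discrete_eq_0[of "\<lambda>x. T (S x) - x" M y] M(2) by simp
  qed
  have "x \<in> L \<longleftrightarrow> T x \<in> M" for x
    using lifted_by_lattice[OF T(2) lin(1) L(1) M(1)] lifted_by_lattice[OF S(2) lin(2) M(1) L(1)] id
    by metis
  then show thesis using that T S id by blast
qed

definition homothetic :: "complex set \<Rightarrow> complex set \<Rightarrow> bool" where
  "homothetic K K' \<longleftrightarrow> (\<exists>c. c \<noteq> 0 \<and> K' = (\<lambda>z. c * z) ` K)"

lemma mem_scaled: "c \<noteq> 0 \<Longrightarrow> z \<in> (\<lambda>z. c * z) ` K \<longleftrightarrow> z / c \<in> (K :: complex set)"
  by (auto simp: image_iff) (metis mult.commute nonzero_mult_div_cancel_left divide_eq_eq)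

lemma homothetic_sym: "homothetic K K' \<Longrightarrow> homothetic K' K"
  unfolding homothetic_def
proof (elim exE conjE)
  fix c assume "c \<noteq> 0" "K' = (\<lambda>z. c * z) ` K"
  moreover from this have "(\<lambda>x. inverse c * (c * x)) = (\<lambda>x. x)" by auto
  ultimately show "\<exists>c. c \<noteq> 0 \<and> K = (\<lambda>z. c * z) ` K'"
    by (intro exI[of _ "inverse c"]) (simp only: image_image image_ident, simp)
qed

lemma homothetic_trans: "homothetic K K' \<Longrightarrow> homothetic K' K'' \<Longrightarrow> homothetic K K''"
  unfolding homothetic_def
proof (elim exE conjE)
  fix c d assume "c \<noteq> 0" "K' = (\<lambda>z. c * z) ` K" "d \<noteq> 0" "K'' = (\<lambda>z. d * z) ` K'"
  then show "\<exists>c. c \<noteq> 0 \<and> K'' = (\<lambda>z. c * z) ` K"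
    by (intro exI[of _ "d * c"]) (auto simp: image_image mult.assoc)
qed

lemma torus_iso_iff_homothetic:
  assumes K: "add_subgroup K" "discrete_set K" and K': "add_subgroup K'" "discrete_set K'"
  shows "(\<exists>f. torus_iso K K' f) \<longleftrightarrow> homothetic K K'"
proof
  assume "\<exists>f. torus_iso K K' f"
  then obtain f where f: "torus_iso K K' f" ..
  obtain T S where T: "complex_linear T" and S: "complex_linear S"
    and ST: "\<And>x. S (T x) = x" and TS: "\<And>y. T (S y) = y" and TK: "\<And>x. x \<in> K \<longleftrightarrow> T x \<in> K'"
    using torus_iso_lift[OF K K' f] by metis
  obtain c where c: "T = (\<lambda>z. c * z)" using complex_linear_complex[OF T] .
  have "c \<noteq> 0" using TS[of 1] c by auto
  moreover have "K' = (\<lambda>z. c * z) ` K"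
  proof (rule Set.set_eqI)
    fix z
    show "z \<in> K' \<longleftrightarrow> z \<in> (\<lambda>z. c * z) ` K"
      using TK[of "z / c"] c \<open>c \<noteq> 0\<close> by (simp add: mem_scaled)
  qed
  ultimately show "homothetic K K'" unfolding homothetic_def by blast
next
  assume "homothetic K K'"
  then obtain c where c: "c \<noteq> 0" "K' = (\<lambda>z. c * z) ` K" unfolding homothetic_def by blast
  have lin: "linear (\<lambda>z. c * z)" using complex_linear_mult[of c] by (simp add: complex_linear_def)
  have "torus_iso K K' (induced_map K' (\<lambda>z. c * z))"
    by (rule torus_isoI[OF K(1) K'(1) complex_linear_mult[of c] complex_linear_mult[of "inverse c"]])
       (use c lifted_by_induced_map[OF K(1) K'(1) lin] in \<open>auto simp flip: mult.assoc\<close>)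
  then show "\<exists>f. torus_iso K K' f" by blast
qed

text \<open>When the lift \<open>Q\<close> of the quotient map is invertible with inverse \<open>R\<close>, the factored
  homomorphism exists and is lifted by \<open>F \<circ> R\<close>; surjectivity of \<open>q\<close> makes it unique, which gives the
  definite description its value.\<close>
lemma lifted_by_factor_map:
  assumes L: "add_subgroup L" and K: "add_subgroup K" and M: "add_subgroup M"
    and q: "lifted_by L K q Q" and f: "lifted_by L M f F"
    and R: "complex_linear R" and F: "complex_linear F"
    and QR: "\<And>y. Q (R y) = y" and RQ: "\<And>x. R (Q x) = x"
    and FR: "\<And>y. y \<in> K \<Longrightarrow> F (R y) \<in> M"
  shows "lifted_by K M (factor_map L K M q f) (\<lambda>y. F (R y))"
proof -
  have FRl: "complex_linear (\<lambda>y. F (R y))" by (rule complex_linear_compose[OF F R])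
  define g where "g = restrict (induced_map M (\<lambda>y. F (R y))) (carrier (torus K))"
  have "lifted_by K M (induced_map M (\<lambda>y. F (R y))) (\<lambda>y. F (R y))"
    by (rule lifted_by_induced_map) (use FRl FR K M in \<open>auto simp: complex_linear_def\<close>)
  then have gl: "lifted_by K M g (\<lambda>y. F (R y))" by (simp add: lifted_by_def g_def)
  have ext: "g \<in> extensional (carrier (torus K))" by (simp add: g_def)
  have "factor_map L K M q f = g" unfolding factor_map_def
  proof (rule the_equality)
    show "g \<in> torus_hom K M \<and> g \<in> extensional (carrier (torus K)) \<and>
        (\<forall>P\<in>carrier (torus L). g (q P) = f P)"
      using torus_homI[OF K M FRl gl] gl q f RQ ext
      by (auto simp: carrier_torus[of L] lifted_by_def)
  next
    fix h assume h: "h \<in> torus_hom K M \<and> h \<in> extensional (carrier (torus K)) \<and>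
        (\<forall>P\<in>carrier (torus L). h (q P) = f P)"
    have "h P = g P" if P: "P \<in> carrier (torus K)" for P
    proof -
      obtain y where y: "P = torus_proj K y" using P unfolding carrier_torus by blast
      have "h (q (torus_proj L (R y))) = f (torus_proj L (R y))" using h by simp
      then show ?thesis using q f gl QR y by (simp add: lifted_by_def)
    qed
    then show "h = g" using h ext by (auto intro: extensionalityI)
  qed
  then show ?thesis using gl by simp
qed

text \<open>Injectivity of the embedding says that the lattice of the curve is cut out by \<open>A\<close> on the tangent
  line. The direction is nonzero, as otherwise the lattice would be the whole plane.\<close>
lemma curve_embedding_lift:
  assumes A: "add_subgroup A" "discrete_set A" and emb: "curve_embedding A K \<iota> F"
  obtains p q where "p \<noteq> 0 \<or> q \<noteq> 0" "lifted_by K A \<iota> (\<lambda>z. (p * z, q * z))"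
    "K = {z. (p * z, q * z) \<in> A}" "F = range (\<lambda>z. torus_proj A (p * z, q * z))"
proof -
  have lat: "is_lattice K" and hom: "\<iota> \<in> torus_hom K A"
    and inj: "inj_on \<iota> (carrier (torus K))" and img: "\<iota> ` carrier (torus K) = F"
    using emb unfolding curve_embedding_def by auto
  note K = lattice_properties[OF lat]
  obtain T where T: "complex_linear T" "lifted_by K A \<iota> T" using torus_hom_lift[OF K(1) A hom] .
  obtain p q where pq: "T = (\<lambda>z. (p * z, q * z))" using complex_linear_into_plane[OF T(1)] .
  have lift: "\<iota> (torus_proj K z) = torus_proj A (p * z, q * z)" for z
    using T(2) by (simp add: lifted_by_def pq)
  have Keq: "z \<in> K \<longleftrightarrow> (p * z, q * z) \<in> A" for z
  proof -
    have "z \<in> K \<longleftrightarrow> torus_proj K z = torus_proj K 0" by (simp add: torus_proj_eq_iff[OF K(1)])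
    also have "\<dots> \<longleftrightarrow> \<iota> (torus_proj K z) = \<iota> (torus_proj K 0)"
      using inj_onD[OF inj, of "torus_proj K z" "torus_proj K 0"] by auto
    also have "\<dots> \<longleftrightarrow> (p * z, q * z) \<in> A"
      unfolding lift torus_proj_eq_iff[OF A(1)] by simp
    finally show ?thesis .
  qed
  have "p \<noteq> 0 \<or> q \<noteq> 0"
  proof (rule ccontr)
    assume "\<not> (p \<noteq> 0 \<or> q \<noteq> 0)"
    then have "z \<in> K" for z using Keq add_subgroupD(1)[OF A(1)] by (simp add: zero_prod_def)
    then have "(1::complex) = 0"
      using linear_into_discrete_eq_0[of "\<lambda>z. z" K 1] K(2) linear_id[unfolded id_def] by simp
    then show False by simp
  qed
  moreover have "F = range (\<lambda>z. torus_proj A (p * z, q * z))"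
    using img by (auto simp: carrier_torus image_image lift)
  ultimately show thesis using that T(2) pq Keq by blast
qed

text \<open>The directions of two lines with the same image in the torus are proportional: otherwise every
  complex number would be the value at a point of the countable set \<open>A\<close> of the linear form
  vanishing on the first line.\<close>
lemma curve_embedding_unique:
  assumes A: "add_subgroup A" "discrete_set A" "countable A"
    and emb: "curve_embedding A K \<iota> F" and emb': "curve_embedding A K' \<iota>' F"
  shows "homothetic K K'"
proof -
  obtain p q where pq: "p \<noteq> 0 \<or> q \<noteq> 0" "K = {z. (p * z, q * z) \<in> A}"
    "F = range (\<lambda>z. torus_proj A (p * z, q * z))"
    by (rule curve_embedding_lift[OF A(1,2) emb])
  obtain p' q' where pq': "p' \<noteq> 0 \<or> q' \<noteq> 0" "K' = {z. (p' * z, q' * z) \<in> A}"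
    "F = range (\<lambda>z. torus_proj A (p' * z, q' * z))"
    by (rule curve_embedding_lift[OF A(1,2) emb'])
  define D where "D = q * p' - p * q'"
  have "D = 0"
  proof (rule ccontr)
    assume D: "D \<noteq> 0"
    have "z * D \<in> (\<lambda>a. q * fst a - p * snd a) ` A" for z
    proof -
      obtain w where "torus_proj A (p' * z, q' * z) = torus_proj A (p * w, q * w)"
        using pq(3) pq'(3) by blast
      then have "(p' * z - p * w, q' * z - q * w) \<in> A" by (simp add: torus_proj_eq_iff[OF A(1)])
      moreover have "z * D = q * (p' * z - p * w) - p * (q' * z - q * w)"
        by (simp add: D_def algebra_simps)
      ultimately show ?thesis by (intro image_eqI[of _ _ "(p' * z - p * w, q' * z - q * w)"]) auto
    qed
    then have "z \<in> (\<lambda>a. q * fst a - p * snd a) ` A" for z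
      using D by (metis nonzero_divide_eq_eq)
    then have "(\<lambda>a. q * fst a - p * snd a) ` A = UNIV" by blast
    then have "countable (UNIV :: complex set)" using A(3) by (metis countable_image)
    then show False using uncountable_UNIV_complex by simp
  qed
  then have D: "q * p' = p * q'" by (simp add: D_def)
  define c where "c = (if p \<noteq> 0 then p' / p else q' / q)"
  have c: "p' = c * p" "q' = c * q" using D pq(1) by (auto simp: c_def field_simps)
  then have c0: "c \<noteq> 0" using pq'(1) by auto
  have "K = (\<lambda>z. c * z) ` K'"
  proof (rule Set.set_eqI)
    fix z
    show "z \<in> K \<longleftrightarrow> z \<in> (\<lambda>z. c * z) ` K'"
      unfolding mem_scaled[OF c0] using c0 by (simp add: pq(2) pq'(2) c)
  qed
  then show ?thesis using c0 homothetic_sym unfolding homothetic_def by blast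
qed

text \<open>The identifications of \<open>F\<close> and \<open>F'\<close> with lattices may be fixed in advance, since they are
  unique up to homothety.\<close>
lemma curve_isomorphic_iff:
  assumes A: "add_subgroup A" "discrete_set A" "countable A"
    and emb: "curve_embedding A K \<iota> F" and emb': "curve_embedding A K' \<iota>' F'"
  shows "curve_isomorphic A F F' \<longleftrightarrow> homothetic K K'"
proof -
  have lat: "is_lattice J" if "curve_embedding A J j G" for J j G
    using that by (simp add: curve_embedding_def)
  have iso: "(\<exists>f. torus_iso J J' f) \<longleftrightarrow> homothetic J J'"
    if "curve_embedding A J j G" "curve_embedding A J' j' G'" for J j G J' j' G'
    by (intro torus_iso_iff_homothetic lattice_properties lat[OF that(1)] lat[OF that(2)])
  show ?thesis
  proof
    assume "curve_isomorphic A F F'"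
    then obtain J j J' j' f where J: "curve_embedding A J j F" "curve_embedding A J' j' F'"
      "torus_iso J J' f"
      unfolding curve_isomorphic_def by blast
    then have "homothetic J J'" using iso by blast
    then show "homothetic K K'"
      using curve_embedding_unique[OF A emb J(1)] curve_embedding_unique[OF A J(2) emb']
        homothetic_trans by blast
  next
    assume "homothetic K K'"
    then show "curve_isomorphic A F F'"
      unfolding curve_isomorphic_def using iso[OF emb emb'] emb emb' by blast
  qed
qed

section \<open>The N\'eron--Severi group of a product of two elliptic curves\<close>

text \<open>Gaussian elimination without division: more integer vectors than coordinates satisfy a
  nontrivial integral relation. A vector \<open>c\<close> with nonzero entry at \<open>s\<close> eliminates that coordinate
  from the others.\<close>
lemma integer_relation:
  fixes f :: "'b \<Rightarrow> 's \<Rightarrow> int"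
  assumes "finite S" "finite B" "card S < card B"
  shows "\<exists>n. (\<exists>b\<in>B. n b \<noteq> 0) \<and> (\<forall>s\<in>S. (\<Sum>b\<in>B. n b * f b s) = 0)"
  using assms
proof (induction S arbitrary: B f rule: finite_induct)
  case empty
  then show ?case by (intro exI[of _ "\<lambda>_. 1"]) (auto simp: card_gt_0_iff)
next
  case (insert s S)
  show ?case
  proof (cases "\<forall>b\<in>B. f b s = 0")
    case True
    have "card S < card B" using insert by simp
    from insert.IH[OF insert.prems(1) this] obtain n where
      n: "\<exists>b\<in>B. n b \<noteq> 0" "\<forall>s\<in>S. (\<Sum>b\<in>B. n b * f b s) = 0" by blast
    then show ?thesis using True by (intro exI[of _ n]) auto
  next
    case False
    then obtain c where c: "c \<in> B" "f c s \<noteq> 0" by blast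
    define B' where "B' = B - {c}"
    have B': "finite B'" "c \<notin> B'" "B = insert c B'" using insert.prems(1) c by (auto simp: B'_def)
    then have card: "card S < card B'" using insert by simp
    from insert.IH[OF B'(1) card, of "\<lambda>b t. f c s * f b t - f b s * f c t"] obtain n where
      n: "\<exists>b\<in>B'. n b \<noteq> 0"
        "\<And>t. t \<in> S \<Longrightarrow> (\<Sum>b\<in>B'. n b * (f c s * f b t - f b s * f c t)) = 0" by blast
    define m where "m = (\<lambda>b. if b = c then - (\<Sum>b\<in>B'. n b * f b s) else f c s * n b)"
    have sum: "(\<Sum>b\<in>B. m b * f b t) = (\<Sum>b\<in>B'. n b * (f c s * f b t - f b s * f c t))" for t
    proof -
      have "(\<Sum>b\<in>B'. m b * f b t) = (\<Sum>b\<in>B'. n b * f c s * f b t)"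
        using B'(2) by (intro sum.cong) (auto simp: m_def)
      then show ?thesis
        by (simp add: B' m_def[THEN fun_cong, of c] sum_distrib_right sum_distrib_left
            sum_subtractf algebra_simps)
    qed
    have "(\<Sum>b\<in>B. m b * f b s) = 0" unfolding sum by (simp add: mult.commute)
    moreover have "\<exists>b\<in>B. m b \<noteq> 0" using n(1) c(2) B' by (auto simp: m_def)
    ultimately show ?thesis using n(2) by (intro exI[of _ m]) (auto simp: sum)
  qed
qed

text \<open>Every \<open>\<i>\<close>-invariant alternating form on the product has this shape: \<open>\<alpha>\<close> and \<open>\<beta>\<close> give the
  restrictions to the two factors, and the mixed part comes from multiplication by \<open>\<mu>\<close>, a complex
  linear map from the first factor to the second.\<close>
definition product_form ::
    "real \<Rightarrow> real \<Rightarrow> complex \<Rightarrow> complex \<times> complex \<Rightarrow> complex \<times> complex \<Rightarrow> real" where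
  "product_form \<alpha> \<beta> \<mu> = (\<lambda>x y. \<alpha> * area (fst x) (fst y) + \<beta> * area (snd x) (snd y)
     + (area (\<mu> * fst x) (snd y) + area (snd x) (\<mu> * fst y)))"

lemma product_form_values:
  "product_form \<alpha> \<beta> \<mu> (1, 0) (\<i>, 0) = \<alpha>" "product_form \<alpha> \<beta> \<mu> (0, 1) (0, \<i>) = \<beta>"
  "product_form \<alpha> \<beta> \<mu> (1, 0) (0, 1) = - Im \<mu>" "product_form \<alpha> \<beta> \<mu> (1, 0) (0, \<i>) = Re \<mu>"
  by (simp_all add: product_form_def area_def)

lemma product_form_inject:
  "product_form \<alpha> \<beta> \<mu> = product_form \<alpha>' \<beta>' \<mu>' \<longleftrightarrow> \<alpha> = \<alpha>' \<and> \<beta> = \<beta>' \<and> \<mu> = \<mu>'"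
proof
  assume "product_form \<alpha> \<beta> \<mu> = product_form \<alpha>' \<beta>' \<mu>'"
  then have eq: "product_form \<alpha> \<beta> \<mu> x y = product_form \<alpha>' \<beta>' \<mu>' x y" for x y by simp
  show "\<alpha> = \<alpha>' \<and> \<beta> = \<beta>' \<and> \<mu> = \<mu>'"
    using eq[of "(1, 0)" "(\<i>, 0)"] eq[of "(0, 1)" "(0, \<i>)"] eq[of "(1, 0)" "(0, 1)"]
      eq[of "(1, 0)" "(0, \<i>)"]
    unfolding product_form_values by (simp add: complex_eq_iff)
qed auto

lemma area_lattice_Ints:
  assumes "area u v \<noteq> 0" "z \<in> lat u v" "w \<in> lat u v"
  shows "area z w / area u v \<in> \<int>"
proof -
  obtain x y x' y' where z: "z = of_int x * u + of_int y * v" and w: "w = of_int x' * u + of_int y' * v"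
    using assms(2,3) unfolding lat_iff by blast
  have "area z w = of_int (x * y' - y * x') * area u v"
    unfolding z w by (simp add: area_def algebra_simps)
  then show ?thesis using assms(1) by simp
qed

lemma product_form_in_NS:
  assumes a: "area u1 v1 \<noteq> 0" "area u2 v2 \<noteq> 0"
    and \<alpha>: "\<alpha> * area u1 v1 \<in> \<int>" and \<beta>: "\<beta> * area u2 v2 \<in> \<int>"
    and \<mu>: "\<And>x. x \<in> lat u1 v1 \<Longrightarrow> of_real (area u2 v2) * \<mu> * x \<in> lat u2 v2"
  shows "product_form \<alpha> \<beta> \<mu> \<in> NS (lat u1 v1 \<times> lat u2 v2)"
  unfolding NS_def
proof (intro CollectI conjI allI ballI)
  show "bilinear (product_form \<alpha> \<beta> \<mu>)"
    unfolding bilinear_def linear_iff product_form_def area_def by (auto simp: algebra_simps)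
  show "product_form \<alpha> \<beta> \<mu> x x = 0" for x
    by (simp add: product_form_def area_def algebra_simps)
  show "product_form \<alpha> \<beta> \<mu> (\<i> *\<^sub>C x) (\<i> *\<^sub>C y) = product_form \<alpha> \<beta> \<mu> x y" for x y
    by (simp add: product_form_def area_def scaleC_prod_def scaleC_complex_def algebra_simps)
  fix x y assume "x \<in> lat u1 v1 \<times> lat u2 v2" "y \<in> lat u1 v1 \<times> lat u2 v2"
  then have x: "fst x \<in> lat u1 v1" "snd x \<in> lat u2 v2" and y: "fst y \<in> lat u1 v1" "snd y \<in> lat u2 v2"
    by auto
  define A2 where "A2 = area u2 v2"
  have "A2 \<noteq> 0" using a by (simp add: A2_def)
  have "area (of_real A2 * \<mu> * fst x) (snd y) / A2 \<in> \<int>"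
    "area (snd x) (of_real A2 * \<mu> * fst y) / A2 \<in> \<int>"
    unfolding A2_def by (intro area_lattice_Ints a \<mu> x y)+
  moreover have "area (of_real A2 * \<mu> * fst x) (snd y) / A2 = area (\<mu> * fst x) (snd y)"
    "area (snd x) (of_real A2 * \<mu> * fst y) / A2 = area (snd x) (\<mu> * fst y)"
    using \<open>A2 \<noteq> 0\<close> by (simp_all add: area_def field_simps)
  moreover have "(\<alpha> * area u1 v1) * (area (fst x) (fst y) / area u1 v1) \<in> \<int>"
    "(\<beta> * area u2 v2) * (area (snd x) (snd y) / area u2 v2) \<in> \<int>"
    by (intro Ints_mult \<alpha> \<beta> area_lattice_Ints a x y)+
  ultimately show "product_form \<alpha> \<beta> \<mu> x y \<in> \<int>"
    using a unfolding product_form_def by (auto intro!: Ints_add)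
qed

lemma product_basis_span:
  assumes "area u1 v1 \<noteq> 0" "area u2 v2 \<noteq> 0"
  shows "span {(u1, 0), (v1, 0), (0, u2), (0, v2)} = (UNIV :: (complex \<times> complex) set)"
proof -
  have "z \<in> span {(u1, 0), (v1, 0), (0, u2), (0, v2)}" for z :: "complex \<times> complex"
  proof -
    have "z = (area (fst z) v1 / area u1 v1) *\<^sub>R (u1, 0) + (area u1 (fst z) / area u1 v1) *\<^sub>R (v1, 0)
       + (area (snd z) v2 / area u2 v2) *\<^sub>R (0, u2) + (area u2 (snd z) / area u2 v2) *\<^sub>R (0, v2)"
      using real_coordinates[OF assms(1), of "fst z"] real_coordinates[OF assms(2), of "snd z"]
      by (simp add: prod_eq_iff scaleR_conv_of_real)
    moreover have "\<dots> \<in> span {(u1, 0), (v1, 0), (0, u2), (0, v2)}"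
      by (intro span_add span_scale span_base) auto
    ultimately show ?thesis by (simp only:)
  qed
  then show ?thesis by blast
qed

text \<open>The supremum in the definition of the Picard number is meaningful because the cardinalities are
  bounded: an integral form is determined by its integral values on the pairs of basis vectors, so
  \<open>integer_relation\<close> bounds the size of an independent set.\<close>
lemma card_le_picard_number:
  assumes a: "area u1 v1 \<noteq> 0" "area u2 v2 \<noteq> 0"
    and B: "finite B" "B \<subseteq> NS (lat u1 v1 \<times> lat u2 v2)" "Z_independent_forms B"
  shows "card B \<le> picard_number (lat u1 v1 \<times> lat u2 v2)"
proof -
  define S where "S = {(u1, 0), (v1, 0), (0, u2), (0, v2)}"
  have SL: "S \<subseteq> lat u1 v1 \<times> lat u2 v2"
    using latI[of 1 u1 0 v1] latI[of 0 u1 1 v1] latI[of 0 u1 0 v1]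
      latI[of 1 u2 0 v2] latI[of 0 u2 1 v2] latI[of 0 u2 0 v2] by (simp add: S_def)
  have le: "card B \<le> card (S \<times> S)"
    if B: "finite B" "B \<subseteq> NS (lat u1 v1 \<times> lat u2 v2)" "Z_independent_forms B"
    for B :: "(complex \<times> complex \<Rightarrow> complex \<times> complex \<Rightarrow> real) set"
  proof (rule ccontr)
    assume "\<not> card B \<le> card (S \<times> S)"
    then have card: "card (S \<times> S) < card B" by (rule not_le_imp_less)
    have fin: "finite (S \<times> S)" by (simp add: S_def)
    obtain n where n: "\<exists>E\<in>B. n E \<noteq> 0"
      "\<And>s. s \<in> S \<times> S \<Longrightarrow> (\<Sum>E\<in>B. n E * \<lfloor>E (fst s) (snd s)\<rfloor>) = 0"
      using integer_relation[OF fin B(1) card, of "\<lambda>E s. \<lfloor>E (fst s) (snd s)\<rfloor>"] by blast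
    define F where "F = (\<lambda>x y. \<Sum>E\<in>B. of_int (n E) * E x y)"
    have bil: "bilinear E" if "E \<in> B" for E using B(2) that by (auto simp: NS_def)
    have "linear (\<lambda>x. r * f x)" if "linear f" for r and f :: "complex \<times> complex \<Rightarrow> real"
      using that by (auto simp: linear_iff algebra_simps)
    then have "bilinear F"
      unfolding bilinear_def F_def
      by (intro conjI allI linear_compose_sum ballI) (use bil in \<open>auto simp: bilinear_def\<close>)
    moreover have "bilinear (\<lambda>x y :: complex \<times> complex. 0 :: real)"
      by (auto simp: bilinear_def linear_iff)
    moreover have "F x y = 0" if xy: "x \<in> S" "y \<in> S" for x y
    proof -
      have "F x y = (\<Sum>E\<in>B. of_int (n E * \<lfloor>E x y\<rfloor>))"
        unfolding F_def
      proof (intro sum.cong refl)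
        fix E assume "E \<in> B"
        then have "\<forall>x\<in>lat u1 v1 \<times> lat u2 v2. \<forall>y\<in>lat u1 v1 \<times> lat u2 v2. E x y \<in> \<int>"
          using B(2) unfolding NS_def by blast
        then have "E x y \<in> \<int>" using SL xy by blast
        then show "of_int (n E) * E x y = of_int (n E * \<lfloor>E x y\<rfloor>)" by (auto elim: Ints_cases)
      qed
      also have "\<dots> = of_int (\<Sum>E\<in>B. n E * \<lfloor>E x y\<rfloor>)" by (rule of_int_sum[symmetric])
      also have "\<dots> = 0" using n(2)[of "(x, y)"] xy by simp
      finally show ?thesis .
    qed
    ultimately have "F x y = 0" for x y
      using bilinear_eq[of F "\<lambda>x y. 0" UNIV S UNIV S x y] product_basis_span[OF a]
      by (auto simp: S_def)
    then show False using B(3) n(1) unfolding Z_independent_forms_def F_def by blast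
  qed
  have "bdd_above {card B | B. finite B \<and> B \<subseteq> NS (lat u1 v1 \<times> lat u2 v2) \<and> Z_independent_forms B}"
    using le by (auto intro!: bdd_aboveI[of _ "card (S \<times> S)"])
  then show ?thesis
    unfolding picard_number_def using B by (intro cSup_upper) auto
qed

text \<open>The area forms of the factors and the forms of two independent homomorphisms would be four
  independent classes. The divisions by the areas make the forms integral on the lattices.\<close>
lemma hom_relation:
  assumes a: "area u1 v1 \<noteq> 0" "area u2 v2 \<noteq> 0"
    and \<rho>: "picard_number (lat u1 v1 \<times> lat u2 v2) \<le> 3"
    and \<mu>: "\<And>x. x \<in> lat u1 v1 \<Longrightarrow> \<mu> * x \<in> lat u2 v2"
    and \<nu>: "\<And>x. x \<in> lat u1 v1 \<Longrightarrow> \<nu> * x \<in> lat u2 v2"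
  shows "\<exists>m n :: int. (m \<noteq> 0 \<or> n \<noteq> 0) \<and> of_int m * \<mu> + of_int n * \<nu> = 0"
proof (rule ccontr)
  assume neg: "\<not> ?thesis"
  define A1 A2 where "A1 = area u1 v1" and "A2 = area u2 v2"
  have A: "A1 \<noteq> 0" "A2 \<noteq> 0" using a by (auto simp: A1_def A2_def)
  have indep: "m = 0 \<and> n = 0" if "of_int m * \<mu> + of_int n * \<nu> = 0" for m n :: int
    using neg that by blast
  have ne: "\<mu> \<noteq> 0" "\<nu> \<noteq> 0" "\<mu> \<noteq> \<nu>"
    using indep[of 1 0] indep[of 0 1] indep[of 1 "-1"] by auto
  define E1 E2 E3 E4 where "E1 = product_form (1 / A1) 0 0" and "E2 = product_form 0 (1 / A2) 0"
    and "E3 = product_form 0 0 (\<mu> / of_real A2)" and "E4 = product_form 0 0 (\<nu> / of_real A2)"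
  note E = E1_def E2_def E3_def E4_def
  define B where "B = {E1, E2, E3, E4}"
  have dist: "E1 \<noteq> E2" "E1 \<noteq> E3" "E1 \<noteq> E4" "E2 \<noteq> E3" "E2 \<noteq> E4" "E3 \<noteq> E4"
    using A ne by (simp_all add: E product_form_inject)
  have "Z_independent_forms B"
    unfolding Z_independent_forms_def
  proof (intro allI impI)
    fix n :: "(complex \<times> complex \<Rightarrow> complex \<times> complex \<Rightarrow> real) \<Rightarrow> int"
    assume n: "\<forall>x y. (\<Sum>E\<in>B. of_int (n E) * E x y) = 0"
    have rel: "of_int (n E1) * E1 x y + of_int (n E2) * E2 x y + of_int (n E3) * E3 x y
        + of_int (n E4) * E4 x y = 0" for x y
      using n[rule_format, of x y] dist by (simp add: B_def add.assoc)
    have "n E1 = 0" using rel[of "(1, 0)" "(\<i>, 0)"] A by (simp add: E product_form_values)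
    moreover have "n E2 = 0" using rel[of "(0, 1)" "(0, \<i>)"] A by (simp add: E product_form_values)
    moreover have "n E3 = 0 \<and> n E4 = 0"
    proof (rule indep)
      have "of_int (n E3) * Re (\<mu> / of_real A2) + of_int (n E4) * Re (\<nu> / of_real A2) = 0"
        using rel[of "(1, 0)" "(0, \<i>)"] A by (simp add: E product_form_values)
      moreover have "of_int (n E3) * Im (\<mu> / of_real A2) + of_int (n E4) * Im (\<nu> / of_real A2) = 0"
        using rel[of "(1, 0)" "(0, 1)"] A by (simp add: E product_form_values)
      ultimately show "of_int (n E3) * \<mu> + of_int (n E4) * \<nu> = 0"
        using A by (simp add: complex_eq_iff field_simps)
    qed
    ultimately show "\<forall>E\<in>B. n E = 0" by (simp add: B_def)
  qed
  moreover have "B \<subseteq> NS (lat u1 v1 \<times> lat u2 v2)"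
  proof -
    have 0: "0 \<in> lat u2 v2" using latI[of 0 u2 0 v2] by simp
    have "E1 \<in> NS (lat u1 v1 \<times> lat u2 v2)" "E2 \<in> NS (lat u1 v1 \<times> lat u2 v2)"
      "E3 \<in> NS (lat u1 v1 \<times> lat u2 v2)" "E4 \<in> NS (lat u1 v1 \<times> lat u2 v2)"
      unfolding E by (intro product_form_in_NS a; use A \<mu> \<nu> 0 in \<open>simp add: A1_def A2_def\<close>)+
    then show ?thesis by (simp add: B_def)
  qed
  ultimately have "card B \<le> 3"
    using card_le_picard_number[OF a, of B] \<rho> by (simp add: B_def)
  then show False using dist by (simp add: B_def)
qed

text \<open>In units of the standard volume, the intersection form is the orthogonal sum of a hyperbolic
  plane, spanned by the area forms of the two factors, and of the negative definite form \<open>-2 |\<mu>|\<^sup>2\<close>.\<close>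
lemma wedge_product_forms:
  "wedge (product_form \<alpha> \<beta> \<mu>) (product_form \<alpha>' \<beta>' \<mu>') x1 x2 x3 x4 =
     (\<alpha> * \<beta>' + \<alpha>' * \<beta> - 2 * Re (cnj \<mu> * \<mu>')) * std_volume_form x1 x2 x3 x4"
  unfolding wedge_def std_volume_form_def product_form_def area_def
    times_complex.sel complex_cnj cnj.sel
  by algebra

lemma Z_span_four:
  fixes x1 x2 x3 x4 :: "'a::real_vector"
  assumes "distinct [x1, x2, x3, x4]"
  shows "Z_span {x1, x2, x3, x4} =
    {of_int n1 *\<^sub>R x1 + of_int n2 *\<^sub>R x2 + of_int n3 *\<^sub>R x3 + of_int n4 *\<^sub>R x4 | n1 n2 n3 n4. True}"
proof -
  have sum: "(\<Sum>b\<in>{x1, x2, x3, x4}. of_int (n b) *\<^sub>R b) =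
      of_int (n x1) *\<^sub>R x1 + of_int (n x2) *\<^sub>R x2 + of_int (n x3) *\<^sub>R x3 + of_int (n x4) *\<^sub>R x4"
    for n using assms by (simp add: add.assoc)
  have "\<exists>n. n x1 = n1 \<and> n x2 = n2 \<and> n x3 = n3 \<and> n x4 = n4" for n1 n2 n3 n4 :: int
    using assms
    by (intro exI[of _ "\<lambda>x. if x = x1 then n1 else if x = x2 then n2 else if x = x3 then n3 else n4"])
       auto
  then have "\<exists>n. of_int n1 *\<^sub>R x1 + of_int n2 *\<^sub>R x2 + of_int n3 *\<^sub>R x3 + of_int n4 *\<^sub>R x4 =
      of_int (n x1) *\<^sub>R x1 + of_int (n x2) *\<^sub>R x2 + of_int (n x3) *\<^sub>R x3 + of_int (n x4) *\<^sub>R x4"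
    for n1 n2 n3 n4 :: int by metis
  then show ?thesis unfolding Z_span_def sum by auto
qed

lemma product_Z_basis:
  assumes a: "area u1 v1 \<noteq> 0" "area u2 v2 \<noteq> 0"
  shows "distinct [(u1, 0), (v1, 0), (0, u2), (0, v2)]"
    "Z_basis (lat u1 v1 \<times> lat u2 v2) {(u1, 0), (v1, 0), (0, u2), (0, v2)}"
    "std_volume_form (u1, 0) (v1, 0) (0, u2) (0, v2) = area u1 v1 * area u2 v2"
proof -
  have uv: "u1 \<noteq> v1" "u2 \<noteq> v2" "u1 \<noteq> 0" "v1 \<noteq> 0" "u2 \<noteq> 0" "v2 \<noteq> 0"
    using a by (auto simp: area_def)
  then show dist: "distinct [(u1, 0), (v1, 0), (0, u2), (0, v2)]" by auto
  have "independent {(u1, 0), (v1, 0), (0, u2), (0, v2)}"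
    using uv product_basis_span[OF a]
    by (intro card_le_dim_spanning[of _ UNIV]) (auto simp: dim_UNIV)
  moreover have "lat u1 v1 \<times> lat u2 v2 = Z_span {(u1, 0), (v1, 0), (0, u2), (0, v2)}"
    unfolding Z_span_four[OF dist] lat_def by (auto simp: scaleR_conv_of_real)
  ultimately show "Z_basis (lat u1 v1 \<times> lat u2 v2) {(u1, 0), (v1, 0), (0, u2), (0, v2)}"
    unfolding Z_basis_def using product_basis_span[OF a] by blast
  show "std_volume_form (u1, 0) (v1, 0) (0, u2) (0, v2) = area u1 v1 * area u2 v2"
    by (simp add: std_volume_form_def wedge_def area_def)
qed

text \<open>The determinant of the integer matrix with rows \<open>p\<close>, \<open>q\<close>, \<open>r\<close>, \<open>s\<close>, in the Laplace expansion
  along the first two rows; this is the shape of a wedge product of two 2-forms.\<close>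
definition int_det :: "int \<Rightarrow> int \<Rightarrow> int \<Rightarrow> int \<Rightarrow> int \<Rightarrow> int \<Rightarrow> int \<Rightarrow> int \<Rightarrow>
    int \<Rightarrow> int \<Rightarrow> int \<Rightarrow> int \<Rightarrow> int \<Rightarrow> int \<Rightarrow> int \<Rightarrow> int \<Rightarrow> int" where
  "int_det p1 p2 p3 p4 q1 q2 q3 q4 r1 r2 r3 r4 s1 s2 s3 s4 =
     (p1 * q2 - p2 * q1) * (r3 * s4 - r4 * s3) - (p1 * q3 - p3 * q1) * (r2 * s4 - r4 * s2)
   + (p1 * q4 - p4 * q1) * (r2 * s3 - r3 * s2) + (p2 * q3 - p3 * q2) * (r1 * s4 - r4 * s1)
   - (p2 * q4 - p4 * q2) * (r1 * s3 - r3 * s1) + (p3 * q4 - p4 * q3) * (r1 * s2 - r2 * s1)"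

lemma wedge_linear_combination:
  fixes E F :: "'a::real_vector \<Rightarrow> 'a \<Rightarrow> real" and p1 p2 p3 p4 q1 q2 q3 q4 r1 r2 r3 r4 s1 s2 s3 s4 :: int
    and x1 x2 x3 x4 :: 'a
  defines "c \<equiv> \<lambda>n1 n2 n3 n4 :: int. of_int n1 *\<^sub>R x1 + of_int n2 *\<^sub>R x2 + of_int n3 *\<^sub>R x3 + of_int n4 *\<^sub>R x4"
  assumes E: "bilinear E" "\<And>x. E x x = 0" and F: "bilinear F" "\<And>x. F x x = 0"
  shows "wedge E F (c p1 p2 p3 p4) (c q1 q2 q3 q4) (c r1 r2 r3 r4) (c s1 s2 s3 s4) =
     of_int (int_det p1 p2 p3 p4 q1 q2 q3 q4 r1 r2 r3 r4 s1 s2 s3 s4) * wedge E F x1 x2 x3 x4"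
proof -
  have expand: "G (c p1 p2 p3 p4) (c q1 q2 q3 q4) =
      of_int (p1 * q2 - p2 * q1) * G x1 x2 + of_int (p1 * q3 - p3 * q1) * G x1 x3
    + of_int (p1 * q4 - p4 * q1) * G x1 x4 + of_int (p2 * q3 - p3 * q2) * G x2 x3
    + of_int (p2 * q4 - p4 * q2) * G x2 x4 + of_int (p3 * q4 - p4 * q3) * G x3 x4"
    if G: "bilinear G" "\<And>x. G x x = 0" for p1 p2 p3 p4 q1 q2 q3 q4 and G :: "'a \<Rightarrow> 'a \<Rightarrow> real"
  proof -
    have swap: "G y x = - G x y" for x y
      using G(2)[of "x + y"] G(2)[of x] G(2)[of y]
      by (simp add: bilinear_ladd[OF G(1)] bilinear_radd[OF G(1)])
    show ?thesis
      unfolding c_def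
      by (simp add: bilinear_ladd[OF G(1)] bilinear_radd[OF G(1)] bilinear_lmul[OF G(1)]
          bilinear_rmul[OF G(1)] G(2) swap[of x2 x1] swap[of x3 x1] swap[of x4 x1] swap[of x3 x2]
          swap[of x4 x2] swap[of x4 x3] algebra_simps)
  qed
  show ?thesis
    unfolding wedge_def expand[OF E] expand[OF F] int_det_def of_int_add of_int_diff of_int_mult
    by algebra
qed

text \<open>The two bases are related by an integral matrix \<open>P\<close>, so the volume \<open>A\<close> of the product basis
  (the product of the two areas) is \<open>det P\<close> times the volume of the given basis. The latter is a
  multiple of \<open>A\<close>, since the volume form divided by \<open>A\<close> is a wedge product of integral forms.\<close>
lemma positive_basis_volume:
  assumes pos: "area u1 v1 * area u2 v2 > 0"
    and dist: "distinct [x1, x2, x3, x4]" and B: "Z_basis (lat u1 v1 \<times> lat u2 v2) {x1, x2, x3, x4}"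
    and vol: "std_volume_form x1 x2 x3 x4 > 0"
  shows "std_volume_form x1 x2 x3 x4 = area u1 v1 * area u2 v2"
proof -
  define A1 A2 where "A1 = area u1 v1" and "A2 = area u2 v2"
  have A: "A1 \<noteq> 0" "A2 \<noteq> 0" "A1 * A2 > 0" using pos by (auto simp: A1_def A2_def)
  have a: "area u1 v1 \<noteq> 0" "area u2 v2 \<noteq> 0" using A by (auto simp: A1_def A2_def)
  define L where "L = lat u1 v1 \<times> lat u2 v2"
  have L: "L = {of_int n1 *\<^sub>R x1 + of_int n2 *\<^sub>R x2 + of_int n3 *\<^sub>R x3 + of_int n4 *\<^sub>R x4 | n1 n2 n3 n4. True}"
    using B Z_span_four[OF dist] by (simp add: Z_basis_def L_def)
  define E1 E2 where "E1 = product_form (1 / A1) 0 0" and "E2 = product_form 0 (1 / A2) 0"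
  have 0: "0 \<in> lat u2 v2" using latI[of 0 u2 0 v2] by simp
  have NS: "E1 \<in> NS L" "E2 \<in> NS L"
    unfolding E1_def E2_def L_def
    by (intro product_form_in_NS a; use A 0 in \<open>simp add: A1_def A2_def\<close>)+
  have wedge: "wedge E1 E2 y1 y2 y3 y4 = std_volume_form y1 y2 y3 y4 / (A1 * A2)" for y1 y2 y3 y4
    unfolding E1_def E2_def wedge_product_forms by simp
  have "wedge E1 E2 y1 y2 y3 y4 \<in> \<int>" if "y1 \<in> L" "y2 \<in> L" "y3 \<in> L" "y4 \<in> L" for y1 y2 y3 y4
    unfolding wedge_def
    by (intro Ints_add Ints_diff Ints_mult) (use NS that in \<open>unfold NS_def, blast+\<close>)
  moreover have "x1 \<in> L" "x2 \<in> L" "x3 \<in> L" "x4 \<in> L"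
  proof -
    have "of_int n1 *\<^sub>R x1 + of_int n2 *\<^sub>R x2 + of_int n3 *\<^sub>R x3 + of_int n4 *\<^sub>R x4 \<in> L" for n1 n2 n3 n4
      unfolding L by blast
    from this[of 1 0 0 0] this[of 0 1 0 0] this[of 0 0 1 0] this[of 0 0 0 1]
    show "x1 \<in> L" "x2 \<in> L" "x3 \<in> L" "x4 \<in> L" by simp_all
  qed
  ultimately obtain k where k: "wedge E1 E2 x1 x2 x3 x4 = of_int k" by (metis Ints_cases)
  have "z \<in> L \<Longrightarrow> \<exists>n1 n2 n3 n4. z = of_int n1 *\<^sub>R x1 + of_int n2 *\<^sub>R x2 + of_int n3 *\<^sub>R x3 + of_int n4 *\<^sub>R x4"
    for z unfolding L by blast
  moreover have "(u1, 0) \<in> L" "(v1, 0) \<in> L" "(0, u2) \<in> L" "(0, v2) \<in> L"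
    using latI[of 1 u1 0 v1] latI[of 0 u1 1 v1] latI[of 0 u1 0 v1]
      latI[of 1 u2 0 v2] latI[of 0 u2 1 v2] 0 by (simp_all add: L_def)
  ultimately obtain p1 p2 p3 p4 q1 q2 q3 q4 r1 r2 r3 r4 s1 s2 s3 s4 :: int where
    comb: "(u1, 0) = of_int p1 *\<^sub>R x1 + of_int p2 *\<^sub>R x2 + of_int p3 *\<^sub>R x3 + of_int p4 *\<^sub>R x4"
      "(v1, 0) = of_int q1 *\<^sub>R x1 + of_int q2 *\<^sub>R x2 + of_int q3 *\<^sub>R x3 + of_int q4 *\<^sub>R x4"
      "(0, u2) = of_int r1 *\<^sub>R x1 + of_int r2 *\<^sub>R x2 + of_int r3 *\<^sub>R x3 + of_int r4 *\<^sub>R x4"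
      "(0, v2) = of_int s1 *\<^sub>R x1 + of_int s2 *\<^sub>R x2 + of_int s3 *\<^sub>R x3 + of_int s4 *\<^sub>R x4"
    by meson
  define d where "d = int_det p1 p2 p3 p4 q1 q2 q3 q4 r1 r2 r3 r4 s1 s2 s3 s4"
  have "wedge E1 E2 (u1, 0) (v1, 0) (0, u2) (0, v2) = of_int d * wedge E1 E2 x1 x2 x3 x4"
    unfolding comb d_def
    by (intro wedge_linear_combination) (use NS in \<open>auto simp: NS_def\<close>)
  moreover have "wedge E1 E2 (u1, 0) (v1, 0) (0, u2) (0, v2) = 1"
    using A unfolding wedge product_Z_basis(3)[OF a] by (simp add: A1_def A2_def)
  ultimately have "of_int (d * k) = (1 :: real)" unfolding k by simp
  then have "d * k = 1" by linarith
  moreover have "k > 0"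
  proof -
    have "wedge E1 E2 x1 x2 x3 x4 > 0" unfolding wedge using vol A(3) by simp
    then show ?thesis unfolding k by simp
  qed
  ultimately have "k = 1" by (metis zmult_eq_1_iff less_irrefl mult.commute neg_0_less_iff_less not_one_less_zero)
  then show ?thesis using k A(3) unfolding wedge by (simp add: A1_def A2_def)
qed

lemma intersection_number_product_forms:
  assumes pos: "area u1 v1 * area u2 v2 > 0"
  shows "intersection_number (lat u1 v1 \<times> lat u2 v2) (product_form \<alpha> \<beta> \<mu>) (product_form \<alpha>' \<beta>' \<mu>') =
    (\<alpha> * \<beta>' + \<alpha>' * \<beta> - 2 * Re (cnj \<mu> * \<mu>')) * (area u1 v1 * area u2 v2)"
  unfolding intersection_number_def
proof (rule the_equality)
  show "\<forall>x1 x2 x3 x4. distinct [x1, x2, x3, x4] \<longrightarrow> Z_basis (lat u1 v1 \<times> lat u2 v2) {x1, x2, x3, x4} \<longrightarrow>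
      0 < std_volume_form x1 x2 x3 x4 \<longrightarrow>
      wedge (product_form \<alpha> \<beta> \<mu>) (product_form \<alpha>' \<beta>' \<mu>') x1 x2 x3 x4 =
        (\<alpha> * \<beta>' + \<alpha>' * \<beta> - 2 * Re (cnj \<mu> * \<mu>')) * (area u1 v1 * area u2 v2)"
    unfolding wedge_product_forms using positive_basis_volume[OF pos] by simp
next
  have a: "area u1 v1 \<noteq> 0" "area u2 v2 \<noteq> 0" using pos by auto
  fix c assume "\<forall>x1 x2 x3 x4. distinct [x1, x2, x3, x4] \<longrightarrow>
      Z_basis (lat u1 v1 \<times> lat u2 v2) {x1, x2, x3, x4} \<longrightarrow> 0 < std_volume_form x1 x2 x3 x4 \<longrightarrow>
      wedge (product_form \<alpha> \<beta> \<mu>) (product_form \<alpha>' \<beta>' \<mu>') x1 x2 x3 x4 = c"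
  then show "c = (\<alpha> * \<beta>' + \<alpha>' * \<beta> - 2 * Re (cnj \<mu> * \<mu>')) * (area u1 v1 * area u2 v2)"
    using product_Z_basis[OF a] pos unfolding wedge_product_forms by metis
qed

text \<open>Multiplication by \<open>\<mu>\<close> has degree \<open>|\<mu>|\<^sup>2 area u1 v1 / area u2 v2\<close>, as a ratio of covolumes.
  The forms of the two factors and the form of \<open>\<mu>\<close> span a sublattice of discriminant
  \<open>2 deg \<mu>\<close>, which is the discriminant \<open>2N\<close> of the whole group times a square.\<close>
lemma degree_hom_eq_square_times:
  assumes pos: "area u1 v1 * area u2 v2 > 0"
    and iso: "NS_isometric_U_plus (lat u1 v1 \<times> lat u2 v2) N"
    and \<mu>: "\<And>x. x \<in> lat u1 v1 \<Longrightarrow> \<mu> * x \<in> lat u2 v2"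
  shows "\<exists>k::int. (cmod \<mu>)\<^sup>2 * area u1 v1 = of_int (k\<^sup>2 * int N) * area u2 v2"
proof -
  define A1 A2 where "A1 = area u1 v1" and "A2 = area u2 v2"
  have A: "A1 \<noteq> 0" "A2 \<noteq> 0" "A1 * A2 > 0" using pos by (auto simp: A1_def A2_def)
  have a: "area u1 v1 \<noteq> 0" "area u2 v2 \<noteq> 0" using A by (auto simp: A1_def A2_def)
  define L where "L = lat u1 v1 \<times> lat u2 v2"
  define E1 E2 E3 where "E1 = product_form (1 / A1) 0 0" and "E2 = product_form 0 (1 / A2) 0"
    and "E3 = product_form 0 0 (\<mu> / of_real A2)"
  note E = E1_def E2_def E3_def
  have 0: "0 \<in> lat u2 v2" using latI[of 0 u2 0 v2] by simp
  have NS: "E1 \<in> NS L" "E2 \<in> NS L" "E3 \<in> NS L"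
    unfolding E L_def
    by (intro product_form_in_NS a; use A 0 \<mu> in \<open>simp add: A1_def A2_def\<close>)+
  obtain \<psi> where \<psi>: "bij_betw \<psi> UNIV (NS L)"
    and int: "\<And>m n. intersection_number L (\<psi> m) (\<psi> n) = of_int (U_plus_form N m n)"
    using iso unfolding NS_isometric_U_plus_def L_def by blast
  have surj: "E \<in> NS L \<Longrightarrow> \<exists>m. \<psi> m = E" for E using \<psi> unfolding bij_betw_def by (metis rangeE)
  obtain m1 m2 m3 where m: "\<psi> m1 = E1" "\<psi> m2 = E2" "\<psi> m3 = E3" using surj NS by meson
  note inter = intersection_number_product_forms[OF pos, folded L_def A1_def A2_def]
  define t where "t = U_plus_form N m3 m3"
  have Re: "Re (cnj (\<mu> / of_real A2) * (\<mu> / of_real A2)) = (cmod \<mu>)\<^sup>2 / A2\<^sup>2"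
    by (simp add: cmod_power2 add_divide_distrib) (simp add: power2_eq_square)
  have t: "of_int t = - 2 * ((cmod \<mu>)\<^sup>2 * A1 / A2)"
    unfolding t_def int[symmetric] m E inter Re using A by (simp add: field_simps power2_eq_square)
  have "U_plus_form N m1 m1 = 0" "U_plus_form N m2 m2 = 0" "U_plus_form N m1 m3 = 0"
    "U_plus_form N m2 m3 = 0" "U_plus_form N m1 m2 = 1"
    using int[of m1 m1] int[of m2 m2] int[of m1 m3] int[of m2 m3] int[of m1 m2] A
    unfolding m E inter by simp_all
  moreover obtain x1 y1 z1 x2 y2 z2 x3 y3 z3 where
    c: "m1 = (x1, y1, z1)" "m2 = (x2, y2, z2)" "m3 = (x3, y3, z3)" by (metis prod_cases3)
  ultimately have gram: "2 * (x1 * y1 - int N * z1 * z1) = 0" "2 * (x2 * y2 - int N * z2 * z2) = 0"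
    "x1 * y3 + y1 * x3 - 2 * int N * z1 * z3 = 0" "x2 * y3 + y2 * x3 - 2 * int N * z2 * z3 = 0"
    "x1 * y2 + y1 * x2 - 2 * int N * z1 * z2 = 1"
    by (simp_all add: U_plus_form_def algebra_simps)
  define k where "k = x1 * (y2 * z3 - z2 * y3) - y1 * (x2 * z3 - z2 * x3) + z1 * (x2 * y3 - y2 * x3)"
  have "t = 2 * (x3 * y3 - int N * z3 * z3)" by (simp add: t_def c U_plus_form_def algebra_simps)
  then have "t = - 2 * (k\<^sup>2 * int N)" using gram unfolding k_def by algebra
  then have "of_int t = - 2 * (of_int (k\<^sup>2 * int N) :: real)" by simp
  then have "(cmod \<mu>)\<^sup>2 * A1 = of_int (k\<^sup>2 * int N) * A2" unfolding t using A by (simp add: field_simps)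
  then show ?thesis unfolding A1_def A2_def by blast
qed

text \<open>Two homomorphisms have a rational ratio. If one of them has degree \<open>N\<close>, the square of the ratio is
  the square of an integer, since the degree of the other is \<open>N\<close> times a square.\<close>
lemma hom_cyclic:
  assumes pos: "area u1 v1 * area u2 v2 > 0"
    and \<rho>: "picard_number (lat u1 v1 \<times> lat u2 v2) \<le> 3"
    and iso: "NS_isometric_U_plus (lat u1 v1 \<times> lat u2 v2) N"
    and \<nu>: "\<And>x. x \<in> lat u1 v1 \<Longrightarrow> \<nu> * x \<in> lat u2 v2" "\<nu> \<noteq> 0"
    and deg: "(cmod \<nu>)\<^sup>2 * area u1 v1 = of_nat N * area u2 v2"
    and \<mu>: "\<And>x. x \<in> lat u1 v1 \<Longrightarrow> \<mu> * x \<in> lat u2 v2"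
  shows "\<exists>j::int. \<mu> = of_int j * \<nu>"
proof -
  have a: "area u1 v1 \<noteq> 0" "area u2 v2 \<noteq> 0" using pos by auto
  obtain m n :: int where mn: "m \<noteq> 0 \<or> n \<noteq> 0" "of_int m * \<mu> + of_int n * \<nu> = 0"
    using hom_relation[OF a \<rho> \<mu> \<nu>(1)] by blast
  then have m: "m \<noteq> 0" using \<nu>(2) by auto
  have \<mu>_eq: "\<mu> = - of_real (of_int n / of_int m) * \<nu>"
    using mn(2) m by (simp add: field_simps add_eq_0_iff)
  obtain k :: int where k: "(cmod \<mu>)\<^sup>2 * area u1 v1 = of_int (k\<^sup>2 * int N) * area u2 v2"
    using degree_hom_eq_square_times[OF pos iso \<mu>] by blast
  also have "\<dots> = of_int (k\<^sup>2) * ((cmod \<nu>)\<^sup>2 * area u1 v1)" unfolding deg by simp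
  finally have "(cmod \<mu>)\<^sup>2 = (of_int k)\<^sup>2 * (cmod \<nu>)\<^sup>2" using a by simp
  moreover have "(cmod \<mu>)\<^sup>2 = (of_int n / of_int m)\<^sup>2 * (cmod \<nu>)\<^sup>2"
    unfolding \<mu>_eq norm_mult norm_minus_cancel norm_of_real
    by (simp only: power_mult_distrib power2_abs)
  ultimately have "(of_int n / of_int m)\<^sup>2 * (cmod \<nu>)\<^sup>2 = (of_int k)\<^sup>2 * (cmod \<nu>)\<^sup>2" by metis
  then have "(of_int n / of_int m)\<^sup>2 = (of_int k :: real)\<^sup>2"
    using \<nu>(2) by (subst (asm) mult_right_cancel) auto
  then have "of_int n / of_int m = (of_int k :: real) \<or> of_int n / of_int m = - (of_int k :: real)"
    by (simp add: power2_eq_iff)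
  then show ?thesis
  proof
    assume "of_int n / of_int m = (of_int k :: real)"
    then show ?thesis using \<mu>_eq by (intro exI[of _ "- k"]) simp
  next
    assume "of_int n / of_int m = - (of_int k :: real)"
    then show ?thesis using \<mu>_eq by (intro exI[of _ k]) simp
  qed
qed

section \<open>Stacked bases and indices of sublattices\<close>

lemma lat_swap: "lat v u = lat u v"
  unfolding lat_def by (auto simp: add.commute) (metis add.commute)+

lemma lat_shear: "lat (u + of_int q * v) v = lat u v"
proof (intro equalityI subsetI)
  fix z assume "z \<in> lat (u + of_int q * v) v"
  then obtain x y where "z = of_int x * (u + of_int q * v) + of_int y * v" unfolding lat_iff by blast
  then have "z = of_int x * u + of_int (x * q + y) * v" by (simp add: algebra_simps)
  then show "z \<in> lat u v" by (simp only: latI)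
next
  fix z assume "z \<in> lat u v"
  then obtain x y where "z = of_int x * u + of_int y * v" unfolding lat_iff by blast
  then have "z = of_int x * (u + of_int q * v) + of_int (y - x * q) * v" by (simp add: algebra_simps)
  then show "z \<in> lat (u + of_int q * v) v" by (simp only: latI)
qed

lemma area_shear: "area (u + of_int q * v) v = area u v"
  by (simp add: area_def algebra_simps)

lemma area_swap: "area v u = - area u v"
  by (simp add: area_def algebra_simps)

lemma mem_sublattice_iff:
  assumes "area u v \<noteq> 0"
  shows "of_int x * u + of_int y * v \<in> lat (of_nat a * u) (of_nat b * v) \<longleftrightarrow> int a dvd x \<and> int b dvd y"
proof
  assume "of_int x * u + of_int y * v \<in> lat (of_nat a * u) (of_nat b * v)"
  then obtain x' y' where "of_int x * u + of_int y * v = of_int x' * (of_nat a * u) + of_int y' * (of_nat b * v)"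
    unfolding lat_iff by blast
  then have "of_int x * u + of_int y * v = of_int (x' * int a) * u + of_int (y' * int b) * v" by simp
  from int_coordinates_unique[OF assms this] show "int a dvd x \<and> int b dvd y" by simp
next
  assume "int a dvd x \<and> int b dvd y"
  then obtain x' y' where "x = int a * x'" "y = int b * y'" by (auto elim!: dvdE)
  then have "of_int x * u + of_int y * v = of_int x' * (of_nat a * u) + of_int y' * (of_nat b * v)" by simp
  then show "of_int x * u + of_int y * v \<in> lat (of_nat a * u) (of_nat b * v)" by (simp only: latI)
qed

lemma index_sublattice:
  assumes uv: "area u v \<noteq> 0" and ab: "a > 0" "b > 0"
  shows "card (torus_proj (lat (of_nat a * u) (of_nat b * v)) ` lat u v) = a * b"
proof -
  define L where "L = lat (of_nat a * u) (of_nat b * v)"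
  have L: "add_subgroup L" unfolding L_def by (rule add_subgroup_lat)
  define g where "g = (\<lambda>(i, j). torus_proj L (of_int (int i) * u + of_int (int j) * v))"
  have diff: "of_int x * u + of_int y * v - (of_int x' * u + of_int y' * v) \<in> L \<longleftrightarrow>
      int a dvd x - x' \<and> int b dvd y - y'" for x y x' y'
    unfolding L_def using mem_sublattice_iff[OF uv, of "x - x'" "y - y'" a b] by (simp add: algebra_simps)
  have eq: "torus_proj L (of_int x * u + of_int y * v) = torus_proj L (of_int x' * u + of_int y' * v) \<longleftrightarrow>
      x mod int a = x' mod int a \<and> y mod int b = y' mod int b" for x y x' y'
    unfolding torus_proj_eq_iff[OF L] diff by (simp add: mod_eq_dvd_iff)
  have "bij_betw g ({..<a} \<times> {..<b}) (torus_proj L ` lat u v)"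
    unfolding bij_betw_def
  proof
    show "inj_on g ({..<a} \<times> {..<b})"
      by (rule inj_onI) (auto simp: g_def eq simp del: of_int_of_nat_eq)
    show "g ` ({..<a} \<times> {..<b}) = torus_proj L ` lat u v"
    proof (intro equalityI subsetI)
      fix P assume "P \<in> torus_proj L ` lat u v"
      then obtain x y where P: "P = torus_proj L (of_int x * u + of_int y * v)" unfolding lat_def by blast
      have "P = g (nat (x mod int a), nat (y mod int b))"
        unfolding P g_def prod.case eq using ab by simp
      moreover have "(nat (x mod int a), nat (y mod int b)) \<in> {..<a} \<times> {..<b}"
        using ab by (simp add: nat_less_iff)
      ultimately show "P \<in> g ` ({..<a} \<times> {..<b})" by blast
    qed (use latI in \<open>auto simp: g_def simp del: of_int_of_nat_eq\<close>)
  qed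
  from bij_betw_same_card[OF this] show ?thesis by (simp add: L_def card_cartesian_product)
qed

text \<open>Take the smallest positive integer \<open>k\<close> occurring as a coordinate of a point of \<open>L\<close> with respect
  to some basis of \<open>M\<close>. Division with remainder by \<open>k\<close> changes bases into bases, so by minimality all
  remainders vanish, and \<open>k\<close> divides every coordinate that appears.\<close>
lemma stacked_basis:
  assumes a: "area u1 v1 \<noteq> 0" "area u2 v2 \<noteq> 0" and sub: "lat u1 v1 \<subseteq> lat u2 v2"
  obtains w1 w2 :: complex and k n :: nat where "k > 0" "n > 0" "area w1 w2 \<noteq> 0" "lat u2 v2 = lat w1 w2"
    "lat u1 v1 = lat (of_nat k * w1) (of_nat (k * n) * w2)"
proof -
  define L M where "L = lat u1 v1" and "M = lat u2 v2"
  have L: "add_subgroup L" unfolding L_def by (rule add_subgroup_lat)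
  have mult: "z \<in> L \<Longrightarrow> of_int c * z \<in> L" for c z
    by (rule add_subgroup_int_mult[OF L])
  define basis where "basis = (\<lambda>u v. lat u v = M \<and> area u v \<noteq> 0)"
  have swap: "basis u v \<Longrightarrow> basis v u" for u v unfolding basis_def by (metis lat_swap area_swap neg_equal_0_iff_equal)
  have shear: "basis u v \<Longrightarrow> basis (u + of_int q * v) v" for u v q
    unfolding basis_def by (simp add: lat_shear area_shear)
  define occurs where "occurs = (\<lambda>c::nat. c > 0 \<and> (\<exists>u v d. basis u v \<and> of_nat c * u + of_int d * v \<in> L))"
  have occursI: "occurs (nat \<bar>c\<bar>)" if "basis u v" "of_int c * u + of_int d * v \<in> L" "c \<noteq> 0" for c d u v
  proof (cases "c > 0")
    case True
    then show ?thesis unfolding occurs_def using that by (intro conjI exI[of _ u] exI[of _ v] exI[of _ d]) auto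
  next
    case False
    have "of_int (- c) * u + of_int (- d) * v \<in> L"
      using add_subgroupD(3)[OF L that(2)] by simp
    then show ?thesis unfolding occurs_def using that False
      by (intro conjI exI[of _ u] exI[of _ v] exI[of _ "- d"]) auto
  qed
  have uL: "u1 \<in> L" "v1 \<in> L" using latI[of 1 u1 0 v1] latI[of 0 u1 1 v1] by (simp_all add: L_def)
  have "\<exists>c. occurs c"
  proof -
    have "u1 \<in> M" using uL sub by (auto simp: L_def M_def)
    then obtain x y where xy: "u1 = of_int x * u2 + of_int y * v2" unfolding M_def lat_iff by blast
    have "u1 \<noteq> 0" using a by (auto simp: area_def)
    then have "x \<noteq> 0 \<or> y \<noteq> 0" using xy by auto
    moreover have b: "basis u2 v2" using a by (simp add: basis_def M_def)
    moreover have "of_int x * u2 + of_int y * v2 \<in> L" "of_int y * v2 + of_int x * u2 \<in> L"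
      using uL(1) xy by (simp_all add: add.commute)
    ultimately show ?thesis using occursI swap by blast
  qed
  define k where "k = (LEAST c. occurs c)"
  have k: "occurs k" unfolding k_def using \<open>\<exists>c. occurs c\<close> by (rule LeastI_ex)
  have kpos: "k > 0" using k by (simp add: occurs_def)
  have remainder: "r = 0" if "basis u v" "of_int r * u + of_int d * v \<in> L" "0 \<le> r" "r < int k" for u v r d
  proof (rule ccontr)
    assume "r \<noteq> 0"
    then have "k \<le> nat \<bar>r\<bar>" unfolding k_def using occursI[OF that(1,2)] by (intro Least_le)
    then show False using that(3,4) by simp
  qed
  have dvd: "int k dvd d" if b: "basis u v" and in_L: "of_nat k * u + of_int d * v \<in> L" for u v d
  proof -
    have "of_nat k * u + of_int d * v =
        of_nat k * u + of_int (int k * (d div int k) + d mod int k) * v" by simp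
    also have "\<dots> = of_int (d mod int k) * v + of_int (int k) * (u + of_int (d div int k) * v)"
      by (simp only: of_int_add of_int_mult) (simp add: algebra_simps)
    finally have "of_int (d mod int k) * v + of_int (int k) * (u + of_int (d div int k) * v) \<in> L"
      using in_L by simp
    from remainder[OF swap[OF shear[OF b]] this] kpos show ?thesis by (simp add: dvd_eq_mod_eq_0)
  qed
  obtain u w2 d where b: "basis u w2" and in_L: "of_nat k * u + of_int d * w2 \<in> L"
    using k unfolding occurs_def by blast
  define w1 where "w1 = u + of_int (d div int k) * w2"
  have B: "basis w1 w2" unfolding w1_def by (rule shear[OF b])
  have "d = int k * (d div int k)" using dvd[OF b in_L] by simp
  then have "of_int d = of_nat k * (of_int (d div int k) :: complex)"
    by (metis of_int_mult of_int_of_nat_eq)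
  then have kw1: "of_nat k * w1 \<in> L" using in_L unfolding w1_def by (simp add: algebra_simps)
  have coords: "int k dvd e \<and> of_int f * w2 \<in> L" if y: "of_int e * w1 + of_int f * w2 \<in> L" for e f
  proof -
    have e: "of_int e = of_int (e div int k) * of_nat k + (of_int (e mod int k) :: complex)"
      by (metis div_mult_mod_eq of_int_add of_int_mult of_int_of_nat_eq)
    have "of_int e * w1 + of_int f * w2 - of_int (e div int k) * (of_nat k * w1) \<in> L"
      using add_subgroupD(2)[OF L y mult[OF kw1]] .
    then have "of_int (e mod int k) * w1 + of_int f * w2 \<in> L" unfolding e by (simp add: algebra_simps)
    moreover from remainder[OF B this] kpos have "e mod int k = 0" by simp
    ultimately show ?thesis by (simp add: dvd_eq_mod_eq_0)
  qed
  have LM: "\<exists>e f. z = of_int e * w1 + of_int f * w2" if "z \<in> L" for z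
    using that sub B unfolding basis_def L_def M_def by (metis lat_iff subsetD)
  have "\<exists>g::nat. g > 0 \<and> of_nat g * w2 \<in> L"
  proof -
    obtain e f e' f' where ef: "u1 = of_int e * w1 + of_int f * w2" "v1 = of_int e' * w1 + of_int f' * w2"
      using LM uL by meson
    have "f \<noteq> 0 \<or> f' \<noteq> 0" using a(1) by (auto simp: ef area_def)
    moreover have "of_int f * w2 \<in> L" "of_int f' * w2 \<in> L" using coords uL by (simp_all add: ef)
    ultimately obtain h where h: "h \<noteq> 0" "of_int h * w2 \<in> L" by blast
    then have "of_nat (nat \<bar>h\<bar>) * w2 \<in> L" using add_subgroupD(3)[OF L h(2)] by (cases "h > 0") auto
    then show ?thesis using h(1) by (intro exI[of _ "nat \<bar>h\<bar>"]) auto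
  qed
  define g where "g = (LEAST g::nat. g > 0 \<and> of_nat g * w2 \<in> L)"
  have g: "g > 0" "of_nat g * w2 \<in> L"
    using LeastI_ex[OF \<open>\<exists>g::nat. g > 0 \<and> of_nat g * w2 \<in> L\<close>] by (simp_all add: g_def)
  have gdvd: "int g dvd f" if f: "of_int f * w2 \<in> L" for f
  proof -
    have e: "of_int f = of_int (f div int g) * of_nat g + (of_int (f mod int g) :: complex)"
      by (metis div_mult_mod_eq of_int_add of_int_mult of_int_of_nat_eq)
    have "of_int f * w2 - of_int (f div int g) * (of_nat g * w2) \<in> L"
      using add_subgroupD(2)[OF L f mult[OF g(2)]] .
    then have "of_int (f mod int g) * w2 \<in> L" unfolding e by (simp add: algebra_simps)
    then have "of_nat (nat (f mod int g)) * w2 \<in> L" using g(1) by simp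
    moreover have "nat (f mod int g) < g" using g(1) by (simp add: nat_less_iff)
    ultimately have "\<not> nat (f mod int g) > 0" unfolding g_def by (auto dest: not_less_Least)
    moreover have "f mod int g \<ge> 0" using g(1) by simp
    ultimately have "f mod int g = 0" by linarith
    then show ?thesis by (rule mod_0_imp_dvd)
  qed
  have "of_nat k * w1 + of_int (int g) * w2 \<in> L" using add_subgroupD(4)[OF L kw1 g(2)] by simp
  then have "int k dvd int g" by (rule dvd[OF B])
  then obtain n where n: "g = k * n" by (auto elim!: dvdE)
  have "L = lat (of_nat k * w1) (of_nat g * w2)"
  proof (intro equalityI subsetI)
    fix z assume z: "z \<in> L"
    then obtain e f where ef: "z = of_int e * w1 + of_int f * w2" using LM by blast
    have "int k dvd e" "int g dvd f" using coords[of e f] gdvd z ef by auto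
    then show "z \<in> lat (of_nat k * w1) (of_nat g * w2)"
      using mem_sublattice_iff[of w1 w2 e f k g] B unfolding ef basis_def by simp
  next
    fix z assume "z \<in> lat (of_nat k * w1) (of_nat g * w2)"
    then obtain x y where "z = of_int x * (of_nat k * w1) + of_int y * (of_nat g * w2)"
      unfolding lat_iff by blast
    then show "z \<in> L" using add_subgroupD(4)[OF L mult[OF kw1] mult[OF g(2)]] by simp
  qed
  moreover have "n > 0" using g(1) n by simp
  moreover have "area w1 w2 \<noteq> 0" "lat u2 v2 = lat w1 w2" using B by (simp_all add: basis_def M_def)
  ultimately show thesis using kpos by (intro that[of k n w1 w2]) (simp_all add: n L_def)
qed

section \<open>Decompositions as linear isomorphisms\<close>

text \<open>A linear isomorphism \<open>T\<close> that matches \<open>K1 \<times> K2\<close> with \<open>A\<close> restricts to embeddings of the two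
  factors, and the sum of these embeddings is the isomorphism itself.\<close>
lemma decomposition_of_iso:
  fixes A :: "(complex \<times> complex) set"
  assumes K1: "is_lattice K1" and K2: "is_lattice K2" and A: "add_subgroup A"
    and T: "complex_linear T" and S: "complex_linear S"
    and ST: "\<And>z. S (T z) = z" and TS: "\<And>z. T (S z) = z"
    and TA: "\<And>z. T z \<in> A \<longleftrightarrow> z \<in> K1 \<times> K2" and f: "lifted_by (K1 \<times> K2) A f T"
  defines "\<iota>1 \<equiv> \<lambda>P. f (P \<times> \<one>\<^bsub>torus K2\<^esub>)" and "\<iota>2 \<equiv> \<lambda>Q. f (\<one>\<^bsub>torus K1\<^esub> \<times> Q)"
  shows "curve_embedding A K1 \<iota>1 (\<iota>1 ` carrier (torus K1))"
    "curve_embedding A K2 \<iota>2 (\<iota>2 ` carrier (torus K2))"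
    "(\<iota>1 ` carrier (torus K1), \<iota>2 ` carrier (torus K2)) \<in> decompositions A"
proof -
  note sub = lattice_properties(1)[OF K1] lattice_properties(1)[OF K2]
  have lin: "linear T" using T by (simp add: complex_linear_def)
  obtain p q p' q' where M: "T = (\<lambda>z. (p * fst z + p' * snd z, q * fst z + q' * snd z))"
    using complex_linear_from_plane[OF T] .
  have l1: "lifted_by K1 A \<iota>1 (\<lambda>z. T (z, 0))" and l2: "lifted_by K2 A \<iota>2 (\<lambda>z. T (0, z))"
    using f unfolding lifted_by_def \<iota>1_def \<iota>2_def torus_one[OF sub(1)] torus_one[OF sub(2)]
    by (simp_all flip: torus_proj_Times)
  have c1: "complex_linear (\<lambda>z. T (z, 0))" and c2: "complex_linear (\<lambda>z. T (0, z))"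
    unfolding M using complex_linear_pair[of p q] complex_linear_pair[of p' q'] by simp_all
  have inj1: "inj_on \<iota>1 (carrier (torus K1))"
  proof (rule inj_onI)
    fix P Q assume "P \<in> carrier (torus K1)" "Q \<in> carrier (torus K1)" and eq: "\<iota>1 P = \<iota>1 Q"
    then obtain x y where P: "P = torus_proj K1 x" and Q: "Q = torus_proj K1 y"
      unfolding carrier_torus by blast
    have "T (x, 0) - T (y, 0) \<in> A"
      using eq l1 unfolding P Q by (simp add: lifted_by_def torus_proj_eq_iff[OF A])
    then have "x - y \<in> K1" using TA[of "(x - y, 0)"] by (simp flip: linear_diff[OF lin])
    then show "P = Q" unfolding P Q by (simp add: torus_proj_eq_iff[OF sub(1)])
  qed
  have inj2: "inj_on \<iota>2 (carrier (torus K2))"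
  proof (rule inj_onI)
    fix P Q assume "P \<in> carrier (torus K2)" "Q \<in> carrier (torus K2)" and eq: "\<iota>2 P = \<iota>2 Q"
    then obtain x y where P: "P = torus_proj K2 x" and Q: "Q = torus_proj K2 y"
      unfolding carrier_torus by blast
    have "T (0, x) - T (0, y) \<in> A"
      using eq l2 unfolding P Q by (simp add: lifted_by_def torus_proj_eq_iff[OF A])
    then have "x - y \<in> K2" using TA[of "(0, x - y)"] by (simp flip: linear_diff[OF lin])
    then show "P = Q" unfolding P Q by (simp add: torus_proj_eq_iff[OF sub(2)])
  qed
  show e1: "curve_embedding A K1 \<iota>1 (\<iota>1 ` carrier (torus K1))"
    using K1 inj1 torus_homI[OF sub(1) A c1 l1] by (simp add: curve_embedding_def)
  show e2: "curve_embedding A K2 \<iota>2 (\<iota>2 ` carrier (torus K2))"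
    using K2 inj2 torus_homI[OF sub(2) A c2 l2] by (simp add: curve_embedding_def)
  have split: "T z = T (fst z, 0) + T (0, snd z)" for z by (simp add: M)
  have "torus_iso (K1 \<times> K2) A (\<lambda>R. \<iota>1 (fst ` R) \<otimes>\<^bsub>torus A\<^esub> \<iota>2 (snd ` R))"
  proof (rule torus_isoI[OF add_subgroup_Times[OF sub] A T S ST TS])
    show "S y \<in> K1 \<times> K2" if "y \<in> A" for y using TA[of "S y"] that by (simp add: TS)
    have "\<iota>1 (torus_proj K1 x) \<otimes>\<^bsub>torus A\<^esub> \<iota>2 (torus_proj K2 y) = torus_proj A (T (x, 0) + T (0, y))" for x y
      using l1 l2 by (simp add: lifted_by_def torus_mult[OF A])
    then show "lifted_by (K1 \<times> K2) A (\<lambda>R. \<iota>1 (fst ` R) \<otimes>\<^bsub>torus A\<^esub> \<iota>2 (snd ` R)) T"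
      unfolding lifted_by_def torus_proj_components[OF sub] by (simp flip: split)
  qed
  then show "(\<iota>1 ` carrier (torus K1), \<iota>2 ` carrier (torus K2)) \<in> decompositions A"
    unfolding decompositions_def using e1 e2 by blast
qed

text \<open>A decomposition as a matrix with columns \<open>(p, q)\<close> and \<open>(p', q')\<close>, together with its inverse, which
  has rows \<open>(c, d)\<close> and \<open>(e, f)\<close>.\<close>
lemma decomposition_lift:
  assumes A: "add_subgroup A" "discrete_set A" and F: "(F1, F2) \<in> decompositions A"
  obtains K1 \<iota>1 K2 \<iota>2 p q p' q' c d e f where
    "curve_embedding A K1 \<iota>1 F1" "curve_embedding A K2 \<iota>2 F2"
    "\<And>x y. (p * x + p' * y, q * x + q' * y) \<in> A \<longleftrightarrow> x \<in> K1 \<and> y \<in> K2"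
    "\<And>x y. p * (c * x + d * y) + p' * (e * x + f * y) = x"
    "\<And>x y. q * (c * x + d * y) + q' * (e * x + f * y) = y"
    "\<And>x y. c * (p * x + p' * y) + d * (q * x + q' * y) = x"
    "\<And>x y. e * (p * x + p' * y) + f * (q * x + q' * y) = y"
proof -
  obtain K1 \<iota>1 K2 \<iota>2 where emb: "curve_embedding A K1 \<iota>1 F1" "curve_embedding A K2 \<iota>2 F2"
    and iso: "torus_iso (K1 \<times> K2) A (\<lambda>R. \<iota>1 (fst ` R) \<otimes>\<^bsub>torus A\<^esub> \<iota>2 (snd ` R))"
    using F unfolding decompositions_def by blast
  have K1: "is_lattice K1" and K2: "is_lattice K2" using emb by (auto simp: curve_embedding_def)
  obtain T S where T: "complex_linear T" and S: "complex_linear S" and ST: "\<And>z. S (T z) = z"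
    and TS: "\<And>z. T (S z) = z" and TA: "\<And>z. z \<in> K1 \<times> K2 \<longleftrightarrow> T z \<in> A"
    and "lifted_by (K1 \<times> K2) A (\<lambda>R. \<iota>1 (fst ` R) \<otimes>\<^bsub>torus A\<^esub> \<iota>2 (snd ` R)) T"
    by (rule torus_iso_lift[OF add_subgroup_Times[OF lattice_properties(1)[OF K1] lattice_properties(1)[OF K2]]
          discrete_set_Times[OF lattice_properties(2)[OF K1] lattice_properties(2)[OF K2]] A iso])
      (rule that)
  obtain p q p' q' where TM: "T = (\<lambda>z. (p * fst z + p' * snd z, q * fst z + q' * snd z))"
    using complex_linear_from_plane[OF T] .
  obtain c e d f where SM: "S = (\<lambda>z. (c * fst z + d * snd z, e * fst z + f * snd z))"
    using complex_linear_from_plane[OF S] .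
  show thesis
  proof (rule that[OF emb, of p p' q q' c d e f])
    show "(p * x + p' * y, q * x + q' * y) \<in> A \<longleftrightarrow> x \<in> K1 \<and> y \<in> K2" for x y
      using TA[of "(x, y)"] by (simp add: TM)
    show "p * (c * x + d * y) + p' * (e * x + f * y) = x"
      "q * (c * x + d * y) + q' * (e * x + f * y) = y" for x y
      using TS[of "(x, y)"] by (simp_all add: TM SM)
    show "c * (p * x + p' * y) + d * (q * x + q' * y) = x"
      "e * (p * x + p' * y) + f * (q * x + q' * y) = y" for x y
      using ST[of "(x, y)"] by (simp_all add: TM SM)
  qed
qed

section \<open>The curves between the two ends of a cyclic isogeny\<close>

lemma set_mult_torus_proj:
  assumes K: "add_subgroup K" and L: "0 \<in> L" "L \<subseteq> K"
  shows "K <#>\<^bsub>add_grp\<^esub> torus_proj L z = torus_proj K z"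
proof (intro equalityI subsetI)
  fix x assume "x \<in> K <#>\<^bsub>add_grp\<^esub> torus_proj L z"
  then obtain k l where "k \<in> K" "l \<in> L" "x = k + (l + z)"
    by (auto simp: set_mult_def torus_proj_eq add_grp_def)
  then show "x \<in> torus_proj K z"
    using add_subgroupD(4)[OF K, of k l] L by (auto simp: mem_torus_proj)
next
  fix x assume "x \<in> torus_proj K z"
  then have "x - z \<in> K" "z \<in> torus_proj L z" using L by (auto simp: mem_torus_proj)
  then have "(x - z) \<otimes>\<^bsub>add_grp\<^esub> z \<in> K <#>\<^bsub>add_grp\<^esub> torus_proj L z"
    unfolding set_mult_def by blast
  then show "x \<in> K <#>\<^bsub>add_grp\<^esub> torus_proj L z" by (simp add: add_grp_def)
qed

lemma Union_torus_proj_image: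
  assumes K: "add_subgroup K" and L: "0 \<in> L" "L \<subseteq> K"
  shows "\<Union> (torus_proj L ` K) = K"
proof (intro equalityI subsetI)
  fix x assume "x \<in> \<Union> (torus_proj L ` K)"
  then obtain z where z: "z \<in> K" "x - z \<in> L" by (auto simp: mem_torus_proj)
  then have "(x - z) + z \<in> K" using add_subgroupD(4)[OF K] L by blast
  then show "x \<in> K" by simp
next
  fix x assume "x \<in> K"
  moreover have "x \<in> torus_proj L x" using L by (simp add: mem_torus_proj)
  ultimately show "x \<in> \<Union> (torus_proj L ` K)" by blast
qed

lemma area_of_nat_mult: "area u (of_nat s * v) = of_nat s * area u v"
  using area_combination(2)[of u 0 "of_nat s" v] by simp

lemma coprime_cofactors:
  fixes g x y :: int
  assumes "g = gcd x y" "g > 0" "x = g * x'" "y = g * y'"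
  shows "coprime x' y'"
proof -
  have "g * gcd x' y' = g * 1" using assms gcd_mult_distrib_int[of g x' y'] by simp
  then show ?thesis using assms(2) by (simp add: coprime_iff_gcd_eq_1)
qed

text \<open>The normal form of the situation: \<open>\<phi>\<close> is multiplication by \<open>\<nu>\<close>, its kernel is cyclic of order
  \<open>N\<close>, generated by the class of \<open>w2 / \<nu>\<close>, and it generates the homomorphisms from \<open>L1\<close> to \<open>L2\<close>.\<close>
locale cyclic_isogeny =
  fixes L1 L2 :: "complex set" and \<phi> :: "complex set \<Rightarrow> complex set"
    and \<nu> w1 w2 :: complex and N :: nat
  assumes area: "area w1 w2 \<noteq> 0" and \<nu>0: "\<nu> \<noteq> 0" and N0: "N > 0"
    and L2_eq: "L2 = lat w1 w2" and L1_eq: "L1 = lat (w1 / \<nu>) (of_nat N * (w2 / \<nu>))"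
    and \<phi>: "lifted_by L1 L2 \<phi> (\<lambda>z. \<nu> * z)"
    and hom: "\<And>\<mu>. (\<And>x. x \<in> L1 \<Longrightarrow> \<mu> * x \<in> L2) \<Longrightarrow> \<exists>j::int. \<mu> = of_int j * \<nu>"
begin

text \<open>For \<open>s\<close> dividing \<open>N\<close>, the lattices between \<open>L1\<close>, which is \<open>mid N\<close>, and
  \<open>L2\<close> divided by \<open>\<nu>\<close>, which is \<open>mid 1\<close>.\<close>
definition mid :: "nat \<Rightarrow> complex set" where
  "mid s = lat (w1 / \<nu>) (of_nat s * (w2 / \<nu>))"

lemma L1_mid: "L1 = mid N"
  by (simp add: L1_eq mid_def)

lemma area': "area (w1 / \<nu>) (w2 / \<nu>) \<noteq> 0"
  using area_scale[of "1 / \<nu>" w1 w2] area \<nu>0 by simp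

lemma mid_iff: "of_int x * (w1 / \<nu>) + of_int y * (w2 / \<nu>) \<in> mid s \<longleftrightarrow> int s dvd y"
  using mem_sublattice_iff[OF area', of x y 1 s] by (simp add: mid_def)

lemma mid_elem:
  assumes "z \<in> mid s"
  obtains x y where "z = of_int x * (w1 / \<nu>) + of_int y * (w2 / \<nu>)" "int s dvd y"
proof -
  obtain x y where "z = of_int x * (w1 / \<nu>) + of_int y * (of_nat s * (w2 / \<nu>))"
    using assms unfolding mid_def lat_iff by blast
  then have "z = of_int x * (w1 / \<nu>) + of_int (y * int s) * (w2 / \<nu>)" by simp
  then show thesis by (rule that) simp
qed

lemma mid_mono: "s dvd t \<Longrightarrow> mid t \<subseteq> mid s"
proof
  fix z assume st: "s dvd t" and "z \<in> mid t"
  then obtain x y where z: "z = of_int x * (w1 / \<nu>) + of_int y * (w2 / \<nu>)" "int t dvd y"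
    using mid_elem by blast
  then show "z \<in> mid s" using st unfolding z(1) mid_iff by (meson dvd_trans of_nat_dvd_iff)
qed

lemma cofactor_mult_mid:
  assumes "r * s = N" "z \<in> mid s"
  shows "of_nat r * z \<in> L1"
proof -
  obtain x y where xy: "z = of_int x * (w1 / \<nu>) + of_int y * (w2 / \<nu>)" "int s dvd y"
    using mid_elem[OF assms(2)] .
  have "of_nat r * z = of_int (int r * x) * (w1 / \<nu>) + of_int (int r * y) * (w2 / \<nu>)"
    by (simp add: xy(1) algebra_simps)
  moreover have "int N dvd int r * y" using xy(2) assms(1) by auto
  ultimately show ?thesis unfolding L1_mid by (simp only: mid_iff)
qed

lemma sub_mid: "add_subgroup (mid s)"
  unfolding mid_def by (rule add_subgroup_lat)

lemma lattice_mid: "s > 0 \<Longrightarrow> is_lattice (mid s)"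
  unfolding is_lattice_complex_iff mid_def
  by (rule exI, rule exI, rule conjI[rotated], rule refl)
     (use area' in \<open>simp add: area_of_nat_mult del: times_divide_eq_right\<close>)

lemma L2_iff: "\<nu> * z \<in> L2 \<longleftrightarrow> z \<in> mid 1"
proof -
  have "L2 = (\<lambda>z. \<nu> * z) ` mid 1" unfolding mid_def lat_scale L2_eq using \<nu>0 by simp
  then show ?thesis using mem_scaled[OF \<nu>0, of "\<nu> * z" "mid 1"] \<nu>0 by simp
qed

lemma sub_L1: "add_subgroup L1" and sub_L2: "add_subgroup L2"
  by (simp_all add: L1_eq L2_eq add_subgroup_lat)

lemma kernel_phi: "kernel (torus L1) (torus L2) \<phi> = torus_proj L1 ` mid 1"
proof -
  have "\<phi> (torus_proj L1 z) = \<one>\<^bsub>torus L2\<^esub> \<longleftrightarrow> z \<in> mid 1" for z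
    using \<phi> by (simp add: lifted_by_def torus_one[OF sub_L2] torus_proj_eq_iff[OF sub_L2] L2_iff)
  then show ?thesis unfolding kernel_def carrier_torus by auto
qed

text \<open>If \<open>z\<close> has second coordinate \<open>y\<close> and is killed by \<open>p\<^sup>k\<close> with \<open>p\<close> dividing \<open>r\<close>, then \<open>s\<close> divides \<open>p\<^sup>k y\<close>
  and is prime to \<open>p\<^sup>k\<close>, so \<open>s\<close> divides \<open>y\<close>.\<close>
lemma kernel_part_subset:
  assumes rs: "r * s = N" "coprime r s"
  shows "kernel_part L1 L2 \<phi> r \<subseteq> torus_proj L1 ` mid s"
proof
  fix P assume "P \<in> kernel_part L1 L2 \<phi> r"
  then show "P \<in> torus_proj L1 ` mid s"
    unfolding kernel_part_def
  proof (induction rule: generate.induct)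
    case one
    show ?case unfolding torus_one[OF sub_L1] using add_subgroupD(1)[OF sub_mid] by blast
  next
    case (eng P Q)
    then show ?case using torus_mult[OF sub_L1] add_subgroupD(4)[OF sub_mid[of s]] by auto
  next
    have prim: "P \<in> torus_proj L1 ` mid s"
      if P: "P \<in> (\<Union>p\<in>{p. prime p \<and> p dvd r}.
        primary_component (torus L1) (kernel (torus L1) (torus L2) \<phi>) p)" for P
    proof -
      obtain p k where p: "prime p" "p dvd r" and PG: "P \<in> torus_proj L1 ` mid 1"
        and pow: "P [^]\<^bsub>torus L1\<^esub> (p ^ k) = \<one>\<^bsub>torus L1\<^esub>"
        using P unfolding primary_component_def kernel_phi by blast
      obtain z where z: "P = torus_proj L1 z" "z \<in> mid 1" using PG by blast
      obtain x y where xy: "z = of_int x * (w1 / \<nu>) + of_int y * (w2 / \<nu>)" using mid_elem[OF z(2)] by metis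
      have "of_nat (p ^ k) *\<^sub>R z \<in> L1"
        using pow by (simp add: z(1) torus_pow_nat[OF sub_L1] torus_one[OF sub_L1] torus_proj_eq_iff[OF sub_L1])
      moreover have "of_nat (p ^ k) *\<^sub>R z =
          of_int (int (p ^ k) * x) * (w1 / \<nu>) + of_int (int (p ^ k) * y) * (w2 / \<nu>)"
        by (simp add: xy scaleR_conv_of_real algebra_simps)
      ultimately have "int N dvd int (p ^ k) * y" using mid_iff[of "int (p ^ k) * x" "int (p ^ k) * y" N]
        unfolding L1_mid by simp
      then have "int s dvd int (p ^ k) * y" using rs(1) by (metis dvd_trans dvd_triv_right of_nat_dvd_iff)
      moreover have "coprime s (p ^ k)" using p rs(2) by (metis coprime_commute coprime_divisors coprime_power_right_iff dvd_refl)
      then have "coprime (int s) (int (p ^ k))" by simp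
      ultimately have "int s dvd y" by (simp only: coprime_dvd_mult_right_iff)
      then have "z \<in> mid s" unfolding xy mid_iff .
      then show ?thesis using z(1) by blast
    qed
    case (incl P) then show ?case by (rule prim)
    case (inv P)
    then obtain z where "P = torus_proj L1 z" "z \<in> mid s" using prim by blast
    then show ?case using torus_inv[OF sub_L1] add_subgroupD(3)[OF sub_mid[of s]] by auto
  qed
qed

text \<open>By induction over \<open>d\<close>, a point of \<open>ker \<phi>\<close> killed by a number \<open>d\<close> with prime factors in \<open>r\<close> is a
  sum of primary points: if \<open>d = p\<^sup>k m\<close> with \<open>m\<close> prime to \<open>p\<close> and \<open>u p\<^sup>k + v m = 1\<close>, then
  \<open>z = u p\<^sup>k z + v m z\<close>, where \<open>v m z\<close> is \<open>p\<close>-primary and \<open>u p\<^sup>k z\<close> is killed by \<open>m\<close>.\<close>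
lemma torsion_in_kernel_part:
  assumes "d > 0" "\<And>p. prime p \<Longrightarrow> p dvd d \<Longrightarrow> p dvd r" "z \<in> mid 1" "of_nat d * z \<in> L1"
  shows "torus_proj L1 z \<in> kernel_part L1 L2 \<phi> r"
  using assms
proof (induction d arbitrary: z rule: less_induct)
  case (less d)
  show ?case
  proof (cases "d = 1")
    case True
    then have "torus_proj L1 z = \<one>\<^bsub>torus L1\<^esub>"
      using less.prems by (simp add: torus_one[OF sub_L1] torus_proj_eq_iff[OF sub_L1])
    then show ?thesis unfolding kernel_part_def by (simp add: generate.one)
  next
    case False
    then obtain p where p: "prime p" "p dvd d" using prime_factor_nat by blast
    obtain m where m: "d = p ^ multiplicity p d * m" "\<not> p dvd m"
      using multiplicity_decompose'[of d p] less.prems(1) prime_gt_1_nat[OF p(1)] by auto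
    define k where "k = multiplicity p d"
    have dm: "d = p ^ k * m" using m(1) by (simp add: k_def)
    have "k > 0" using p less.prems(1) by (simp add: k_def prime_multiplicity_gt_zero_iff)
    have "coprime (int (p ^ k)) (int m)"
      using prime_imp_coprime[OF p(1) m(2)] by simp
    then obtain u v where uv: "u * int (p ^ k) + v * int m = 1"
      using bezout_int[of "int (p ^ k)" "int m"] by auto
    define z1 z2 where "z1 = of_int (u * int (p ^ k)) * z" and "z2 = of_int (v * int m) * z"
    have z: "z = z1 + z2"
    proof -
      have "z1 + z2 = of_int (u * int (p ^ k) + v * int m) * z"
        by (simp add: z1_def z2_def algebra_simps)
      then show ?thesis by (simp only: uv) simp
    qed
    have z12: "z1 \<in> mid 1" "z2 \<in> mid 1"
      unfolding z1_def z2_def by (intro add_subgroup_int_mult sub_mid less.prems)+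
    have "m < d" using p(1) \<open>k > 0\<close> less.prems(1) prime_gt_1_nat[OF p(1)] one_less_power[of p k]
      by (simp add: dm)
    moreover have "m > 0" using less.prems(1) by (cases m) (auto simp: dm)
    moreover have "of_nat m * z1 \<in> L1"
      using add_subgroup_int_mult[OF sub_L1 less.prems(4), of u] by (simp add: z1_def dm algebra_simps)
    ultimately have 1: "torus_proj L1 z1 \<in> kernel_part L1 L2 \<phi> r"
      using less.IH[of m z1] less.prems(2) z12(1) by (auto simp: dm)
    have "of_nat (p ^ k) * z2 \<in> L1"
      using add_subgroup_int_mult[OF sub_L1 less.prems(4), of v] by (simp add: z2_def dm algebra_simps)
    then have "torus_proj L1 z2 [^]\<^bsub>torus L1\<^esub> (p ^ k) = \<one>\<^bsub>torus L1\<^esub>"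
      by (simp add: torus_pow_nat[OF sub_L1] torus_one[OF sub_L1] torus_proj_eq_iff[OF sub_L1]
          scaleR_conv_of_real)
    then have "torus_proj L1 z2 \<in> primary_component (torus L1) (kernel (torus L1) (torus L2) \<phi>) p"
      unfolding primary_component_def kernel_phi using z12(2) by blast
    then have 2: "torus_proj L1 z2 \<in> kernel_part L1 L2 \<phi> r"
      unfolding kernel_part_def using p less.prems(2) by (intro generate.incl) blast
    show ?thesis
      using generate.eng[OF 1[unfolded kernel_part_def] 2[unfolded kernel_part_def]]
      by (simp add: torus_mult[OF sub_L1] kernel_part_def flip: z)
  qed
qed

text \<open>The cofactor \<open>s\<close> appears in place of \<open>r\<close> because \<open>mid s\<close> contains \<open>L1\<close> with index \<open>r\<close>; its classes are
  killed by \<open>r\<close>, so they are sums of primary points for primes dividing \<open>r\<close>.\<close>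
lemma kernel_part_eq:
  assumes rs: "r * s = N" "coprime r s"
  shows "kernel_part L1 L2 \<phi> r = torus_proj L1 ` mid s"
proof (intro equalityI kernel_part_subset[OF rs] subsetI)
  fix P assume "P \<in> torus_proj L1 ` mid s"
  then obtain z where z: "P = torus_proj L1 z" "z \<in> mid s" by blast
  have "of_nat r * z \<in> L1" by (rule cofactor_mult_mid[OF rs(1) z(2)])
  moreover have "r > 0" using rs(1) N0 by (cases r) auto
  moreover have "z \<in> mid 1" using z(2) mid_mono[of 1 s] by auto
  ultimately show "P \<in> kernel_part L1 L2 \<phi> r"
    unfolding z(1) by (intro torsion_in_kernel_part[of r]) auto
qed

lemma L1_subset_mid: "s dvd N \<Longrightarrow> L1 \<subseteq> mid s"
  unfolding L1_mid by (rule mid_mono)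

lemma mid_curve_eq:
  assumes rs: "r * s = N" "coprime r s"
  shows "mid_curve L1 L2 \<phi> r = mid s"
  unfolding mid_curve_def quot_lattice_def kernel_part_eq[OF rs]
  by (intro Union_torus_proj_image sub_mid add_subgroupD(1)[OF sub_L1] L1_subset_mid)
     (simp flip: rs(1))

lemma phi_plus_lift:
  assumes rs: "r * s = N" "coprime r s"
  shows "lifted_by L1 (mid s) (phi_plus L1 L2 \<phi> r) (\<lambda>z. z)"
  unfolding lifted_by_def phi_plus_def quot_map_def mid_curve_eq[OF rs, unfolded mid_curve_def]
  using set_mult_torus_proj[OF sub_mid add_subgroupD(1)[OF sub_L1] L1_subset_mid] rs(1) by auto

lemma phi_minus_lift:
  assumes rs: "r * s = N" "coprime r s"
  shows "lifted_by (mid s) L2 (phi_minus L1 L2 \<phi> r) (\<lambda>z. \<nu> * z)"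
  unfolding phi_minus_def mid_curve_eq[OF rs]
proof (rule lifted_by_factor_map[OF sub_L1 sub_mid sub_L2 phi_plus_lift[OF rs] \<phi>])
  show "complex_linear (\<lambda>z::complex. z)" using complex_linear_mult[of 1] by simp
  show "\<nu> * y \<in> L2" if "y \<in> mid s" for y using that mid_mono[of 1 s] by (auto simp: L2_iff)
qed (rule complex_linear_mult refl)+

lemma degree_phi_plus:
  assumes rs: "r * s = N" "coprime r s"
  shows "isogeny_degree L1 (mid s) (phi_plus L1 L2 \<phi> r) = r"
proof -
  have "phi_plus L1 L2 \<phi> r (torus_proj L1 z) = \<one>\<^bsub>torus (mid s)\<^esub> \<longleftrightarrow> z \<in> mid s" for z
    using phi_plus_lift[OF rs] by (simp add: lifted_by_def torus_one[OF sub_mid] torus_proj_eq_iff[OF sub_mid])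
  then have "kernel (torus L1) (torus (mid s)) (phi_plus L1 L2 \<phi> r) = torus_proj L1 ` mid s"
    unfolding kernel_def carrier_torus by auto
  moreover have "L1 = lat (of_nat 1 * (w1 / \<nu>)) (of_nat r * (of_nat s * (w2 / \<nu>)))"
    by (simp add: L1_eq mult.assoc flip: rs(1))
  moreover have "r > 0" "s > 0" using rs(1) N0 by (cases r; cases s; auto)+
  moreover have "area (w1 / \<nu>) (of_nat s * (w2 / \<nu>)) \<noteq> 0"
    using area' \<open>s > 0\<close> by (simp add: area_of_nat_mult del: times_divide_eq_right)
  ultimately show ?thesis
    using index_sublattice[of "w1 / \<nu>" "of_nat s * (w2 / \<nu>)" 1 r] by (simp add: isogeny_degree_def mid_def)
qed

lemma phi_plus_dual_lift:
  assumes rs: "r * s = N" "coprime r s"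
  shows "lifted_by (mid s) L1 (phi_plus_dual L1 L2 \<phi> r) (\<lambda>z. of_nat r * z)"
  unfolding phi_plus_dual_def mid_curve_eq[OF rs] dual_isogeny_def degree_phi_plus[OF rs]
proof (rule lifted_by_factor_map[OF sub_L1 sub_mid sub_L1 phi_plus_lift[OF rs],
      where R = "\<lambda>z. z" and F = "\<lambda>z. of_nat r * z"])
  show "lifted_by L1 L1 (\<lambda>P. P [^]\<^bsub>torus L1\<^esub> r) (\<lambda>z. of_nat r * z)"
    by (simp add: lifted_by_def torus_pow_nat[OF sub_L1] scaleR_conv_of_real)
  show "complex_linear (\<lambda>z::complex. z)" using complex_linear_mult[of 1] by simp
  show "of_nat r * z \<in> L1" if "z \<in> mid s" for z by (rule cofactor_mult_mid[OF rs(1) that])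
qed (rule complex_linear_mult refl)+

abbreviation A :: "(complex \<times> complex) set" where
  "A \<equiv> L1 \<times> L2"

lemma sub_A: "add_subgroup A" and discrete_A: "discrete_set A" and countable_A: "countable A"
proof -
  have "is_lattice L1" "is_lattice L2"
    using lattice_mid[OF N0] area by (auto simp: L1_mid is_lattice_complex_iff L2_eq)
  note lattice_properties[OF this(1)] lattice_properties[OF this(2)]
  then show "add_subgroup A" "discrete_set A" "countable A"
    by (auto intro: add_subgroup_Times discrete_set_Times)
qed

section \<open>The constructed decompositions\<close>

text \<open>The quotient map from \<open>L1\<close> to \<open>mid s\<close> is lifted by the identity, so its dual is lifted by
  multiplication by its degree \<open>r\<close>, and the second factor of \<open>\<phi>\<close> by multiplication by \<open>\<nu>\<close>.\<close>
lemma alpha_lift: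
  assumes rs: "r * s = N" "coprime r s"
  shows "lifted_by (mid s \<times> mid r) A (alpha L1 L2 \<phi> a b (r, s))
    (\<lambda>z. (of_nat r * fst z + of_int (b (r, s)) * of_nat s * snd z,
          - \<nu> * fst z + of_int (a (r, s)) * \<nu> * snd z))"
proof -
  have sr: "s * r = N" "coprime s r" using rs by (auto simp: coprime_commute)
  note l = phi_plus_dual_lift[OF rs] phi_plus_dual_lift[OF sr] phi_minus_lift[OF rs] phi_minus_lift[OF sr]
  show ?thesis
    unfolding lifted_by_def
  proof
    fix z :: "complex \<times> complex"
    have "alpha L1 L2 \<phi> a b (r, s) (torus_proj (mid s \<times> mid r) z) =
        torus_proj L1 (of_nat r * fst z + of_int (b (r, s)) *\<^sub>R (of_nat s * snd z)) \<times>
        torus_proj L2 (- (\<nu> * fst z) + of_int (a (r, s)) *\<^sub>R (\<nu> * snd z))"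
      using l unfolding alpha_def Let_def lifted_by_def
      by (simp add: torus_proj_components sub_mid torus_pow_int sub_L1 sub_L2 torus_mult torus_inv)
    then show "alpha L1 L2 \<phi> a b (r, s) (torus_proj (mid s \<times> mid r) z) =
        torus_proj A (of_nat r * fst z + of_int (b (r, s)) * of_nat s * snd z,
          - \<nu> * fst z + of_int (a (r, s)) * \<nu> * snd z)"
      by (simp add: torus_proj_Times scaleR_conv_of_real mult.assoc)
  qed
qed

text \<open>The lift of \<open>\<alpha>\<close> has determinant \<open>(a r + b s) \<nu> = \<nu>\<close>, and both it and its inverse
  preserve the lattices.\<close>
lemma alpha_decomposition_in_decompositions:
  assumes rs: "r * s = N" "coprime r s" and ab: "a (r, s) * int r + b (r, s) * int s = 1"
  obtains \<iota>1 \<iota>2 where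
    "curve_embedding A (mid s) \<iota>1 (fst (alpha_decomposition L1 L2 \<phi> a b (r, s)))"
    "curve_embedding A (mid r) \<iota>2 (snd (alpha_decomposition L1 L2 \<phi> a b (r, s)))"
    "alpha_decomposition L1 L2 \<phi> a b (r, s) \<in> decompositions A"
proof -
  have sr: "s * r = N" "coprime s r" using rs by (auto simp: coprime_commute)
  have pos: "r > 0" "s > 0" using rs(1) N0 by (cases r; cases s; auto)+
  define \<alpha> \<beta> :: complex where "\<alpha> = of_int (a (r, s))" and "\<beta> = of_int (b (r, s))"
  define R S :: complex where "R = of_nat r" and "S = of_nat s"
  have "of_int (a (r, s) * int r + b (r, s) * int s) = (1 :: complex)" unfolding ab by simp
  then have det: "\<alpha> * R + \<beta> * S = 1" by (simp add: \<alpha>_def \<beta>_def R_def S_def)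
  define T where "T = (\<lambda>z :: complex \<times> complex. (R * fst z + \<beta> * S * snd z, - \<nu> * fst z + \<alpha> * \<nu> * snd z))"
  define T' where "T' = (\<lambda>z :: complex \<times> complex. (\<alpha> * fst z + - (\<beta> * S / \<nu>) * snd z, 1 * fst z + R / \<nu> * snd z))"
  have cancel: "k / \<nu> * (- \<nu> * x + \<alpha> * \<nu> * y) = k * (- x + \<alpha> * y)" for k x y
    using \<nu>0 by (simp add: field_simps)
  have T'T: "T' (T z) = z" for z
  proof (rule prod_eqI)
    have "fst (T' (T z)) =
        \<alpha> * (R * fst z + \<beta> * S * snd z) - \<beta> * S / \<nu> * (- \<nu> * fst z + \<alpha> * \<nu> * snd z)"
      by (simp add: T_def T'_def)
    also have "\<dots> = (\<alpha> * R + \<beta> * S) * fst z" unfolding cancel by (simp add: algebra_simps)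
    finally show "fst (T' (T z)) = fst z" by (simp only: det) simp
    have "snd (T' (T z)) = R * fst z + \<beta> * S * snd z + R / \<nu> * (- \<nu> * fst z + \<alpha> * \<nu> * snd z)"
      by (simp add: T_def T'_def)
    also have "\<dots> = (\<alpha> * R + \<beta> * S) * snd z" unfolding cancel by (simp add: algebra_simps)
    finally show "snd (T' (T z)) = snd z" by (simp only: det) simp
  qed
  have TT': "T (T' z) = z" for z
  proof (rule prod_eqI)
    define y where "y = snd z / \<nu>"
    have y: "snd z = \<nu> * y" using \<nu>0 by (simp add: y_def)
    have T'z: "T' z = (\<alpha> * fst z - \<beta> * S * y, fst z + R * y)" by (simp add: T'_def y_def)
    have "fst (T (T' z)) = (\<alpha> * R + \<beta> * S) * fst z"
      unfolding T'z by (simp add: T_def algebra_simps)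
    then show "fst (T (T' z)) = fst z" by (simp only: det) simp
    have "snd (T (T' z)) = (\<alpha> * R + \<beta> * S) * (\<nu> * y)"
      unfolding T'z by (simp add: T_def algebra_simps)
    then show "snd (T (T' z)) = snd z" by (simp only: det y) simp
  qed
  have lin: "complex_linear T" "complex_linear T'"
    unfolding T_def T'_def by (rule complex_linear_matrix)+
  have mid1: "of_nat t * z \<in> mid t" if "z \<in> mid 1" for t z
  proof -
    obtain x y where xy: "z = of_int x * (w1 / \<nu>) + of_int y * (w2 / \<nu>)"
      using mid_elem[OF \<open>z \<in> mid 1\<close>] by metis
    have "of_nat t * z = of_int (int t * x) * (w1 / \<nu>) + of_int (int t * y) * (w2 / \<nu>)"
      by (simp add: xy(1) algebra_simps)
    then show ?thesis by (simp only: mid_iff) simp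
  qed
  have up: "mid s \<subseteq> mid 1" "mid r \<subseteq> mid 1" "mid N \<subseteq> mid s" "mid N \<subseteq> mid r"
    using rs(1) by (auto intro!: mid_mono)
  have fwd: "T z \<in> A" if "z \<in> mid s \<times> mid r" for z
  proof -
    have z: "fst z \<in> mid s" "snd z \<in> mid r" using that by auto
    have "R * fst z \<in> mid N" "S * snd z \<in> mid N"
      unfolding R_def S_def using cofactor_mult_mid[OF rs(1) z(1)] cofactor_mult_mid[OF sr(1) z(2)]
      by (simp_all only: L1_mid)
    then have "R * fst z + \<beta> * (S * snd z) \<in> mid N"
      unfolding \<beta>_def by (intro add_subgroupD(4)[OF sub_mid] add_subgroup_int_mult sub_mid)
    moreover have "- fst z + \<alpha> * snd z \<in> mid 1"
      unfolding \<alpha>_def using z up by (intro add_subgroupD(3,4)[OF sub_mid] add_subgroup_int_mult sub_mid) auto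
    then have "\<nu> * (- fst z + \<alpha> * snd z) \<in> L2" by (simp only: L2_iff)
    ultimately show ?thesis by (simp add: T_def L1_mid algebra_simps)
  qed
  have bwd: "T' z \<in> mid s \<times> mid r" if "z \<in> A" for z
  proof -
    have z: "fst z \<in> mid N" "snd z \<in> L2" using that L1_mid by auto
    have y: "snd z / \<nu> \<in> mid 1" using L2_iff[of "snd z / \<nu>"] z(2) \<nu>0 by simp
    have "\<alpha> * fst z \<in> mid s" "\<beta> * (S * (snd z / \<nu>)) \<in> mid s"
      unfolding \<alpha>_def \<beta>_def S_def using z up mid1[OF y] by (intro add_subgroup_int_mult sub_mid; auto)+
    then have "\<alpha> * fst z - \<beta> * (S * (snd z / \<nu>)) \<in> mid s" by (rule add_subgroupD(2)[OF sub_mid])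
    moreover have "fst z + R * (snd z / \<nu>) \<in> mid r"
      unfolding R_def using z up mid1[OF y] by (intro add_subgroupD(4)[OF sub_mid]) auto
    ultimately show ?thesis by (simp add: T'_def algebra_simps)
  qed
  have TA: "T z \<in> A \<longleftrightarrow> z \<in> mid s \<times> mid r" for z
    using fwd[of z] bwd[of "T z"] by (auto simp: T'T)
  have lift: "lifted_by (mid s \<times> mid r) A (alpha L1 L2 \<phi> a b (r, s)) T"
    using alpha_lift[OF rs] unfolding T_def \<alpha>_def \<beta>_def R_def S_def .
  note dec = decomposition_of_iso[OF lattice_mid[OF pos(2)] lattice_mid[OF pos(1)] sub_A lin T'T TT' TA lift]
  have "alpha_decomposition L1 L2 \<phi> a b (r, s) =
     ((\<lambda>P. alpha L1 L2 \<phi> a b (r, s) (P \<times> \<one>\<^bsub>torus (mid r)\<^esub>)) ` carrier (torus (mid s)),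
      (\<lambda>Q. alpha L1 L2 \<phi> a b (r, s) (\<one>\<^bsub>torus (mid s)\<^esub> \<times> Q)) ` carrier (torus (mid r)))"
    unfolding alpha_decomposition_def Let_def mid_curve_eq[OF rs] mid_curve_eq[OF sr] prod.case ..
  then show thesis using that dec by simp
qed

section \<open>The constructed decompositions are pairwise non-isomorphic\<close>

text \<open>Composition with \<open>\<phi>\<close> embeds the other homomorphism groups into that from \<open>L1\<close> to \<open>L2\<close>, so both
  curves have no complex multiplication.\<close>
lemma End_L1: "(\<And>x. x \<in> L1 \<Longrightarrow> \<mu> * x \<in> L1) \<Longrightarrow> \<exists>j::int. \<mu> = of_int j"
proof -
  assume \<mu>: "\<And>x. x \<in> L1 \<Longrightarrow> \<mu> * x \<in> L1"
  have "\<nu> * \<mu> * x \<in> L2" if "x \<in> L1" for x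
    using \<mu>[OF that] mid_mono[of 1 N] by (auto simp: mult.assoc L2_iff L1_mid)
  from hom[OF this] show ?thesis using \<nu>0 by auto
qed

lemma End_L2: "(\<And>x. x \<in> L2 \<Longrightarrow> \<mu> * x \<in> L2) \<Longrightarrow> \<exists>j::int. \<mu> = of_int j"
proof -
  assume \<mu>: "\<And>x. x \<in> L2 \<Longrightarrow> \<mu> * x \<in> L2"
  have "\<nu> * \<mu> * x \<in> L2" if "x \<in> L1" for x
    using \<mu>[of "\<nu> * x"] that mid_mono[of 1 N] by (auto simp: mult_ac L2_iff L1_mid)
  from hom[OF this] show ?thesis using \<nu>0 by auto
qed

lemma Hom_L2_L1: "(\<And>x. x \<in> L2 \<Longrightarrow> \<mu> * x \<in> L1) \<Longrightarrow> \<exists>j::int. \<nu> * \<mu> = of_int j"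
proof (rule End_L2)
  fix x assume "\<And>x. x \<in> L2 \<Longrightarrow> \<mu> * x \<in> L1" "x \<in> L2"
  then have "\<mu> * x \<in> mid 1" using mid_mono[of 1 N] by (auto simp: L1_mid)
  then show "\<nu> * \<mu> * x \<in> L2" by (simp add: L2_iff mult.assoc)
qed

text \<open>All \<open>mid s\<close> lie between \<open>mid N\<close> and \<open>mid 1\<close>, so a factor \<open>c\<close> taking \<open>mid s\<close> to \<open>mid s'\<close> gives the
  homomorphism \<open>\<nu> c\<close> from \<open>L1\<close> to \<open>L2\<close> and is an integer. The same holds for \<open>1 / c\<close>, and
  multiplication by \<open>-1\<close> fixes each lattice.\<close>
lemma homothetic_mid:
  assumes "s dvd N" "s' dvd N" and hom: "homothetic (mid s) (mid s')"
  shows "s = s'"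
proof -
  obtain c where c: "c \<noteq> 0" "mid s' = (\<lambda>z. c * z) ` mid s" using hom unfolding homothetic_def by blast
  have int: "\<exists>j::int. c = of_int j" if c: "\<And>z. z \<in> mid s \<Longrightarrow> c * z \<in> mid s'" and "s dvd N" for c s s'
  proof -
    have "\<nu> * c * x \<in> L2" if "x \<in> L1" for x
      using c[of x] that L1_subset_mid[OF \<open>s dvd N\<close>] mid_mono[of 1 s'] by (auto simp: mult.assoc L2_iff)
    from cyclic_isogeny.hom[OF cyclic_isogeny_axioms this] show ?thesis using \<nu>0 by auto
  qed
  have mem: "z \<in> mid s' \<longleftrightarrow> z / c \<in> mid s" for z using mem_scaled[OF c(1)] c(2) by simp
  obtain j where j: "c = of_int j" using int[of s c s'] assms(1) c by auto
  obtain j' where j': "1 / c = of_int j'" using int[of s' "1 / c" s] assms(2) by (auto simp: mem)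
  have "of_int (j * j') = (1 :: complex)" using j j' c(1) by (metis of_int_mult nonzero_mult_div_cancel_left times_divide_eq_right mult.right_neutral)
  then have "j * j' = 1" by (metis of_int_1 of_int_eq_iff)
  then have "j = 1 \<or> j = - 1" using zmult_eq_1_iff by auto
  then have "z / c \<in> mid s \<longleftrightarrow> z \<in> mid s" for z
    using add_subgroupD(3)[OF sub_mid[of s], of z] add_subgroupD(3)[OF sub_mid[of s], of "- z"] by (auto simp: j)
  then have eq: "mid s' = mid s" using mem by blast
  have "int s dvd y \<longleftrightarrow> int s' dvd y" for y
    using mid_iff[of 0 y s] mid_iff[of 0 y s'] unfolding eq by simp
  from this[of "int s"] this[of "int s'"] show ?thesis by (simp add: dvd_antisym)
qed

section \<open>Every decomposition is isomorphic to a constructed one\<close>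

text \<open>The number \<open>s\<close> is \<open>N / gcd N P\<close>.\<close>
lemma dvd_product_iff_dvd_cofactor:
  fixes P :: int
  obtains s :: nat where "s dvd N" "\<And>y. int N dvd P * y \<longleftrightarrow> int s dvd y"
proof -
  define g where "g = gcd (int N) P"
  have g: "g > 0" "g dvd int N" "g dvd P" using N0 by (auto simp: g_def)
  obtain M where M: "int N = g * M" using g(2) by blast
  obtain Q where Q: "P = g * Q" using g(3) by blast
  have "coprime M Q"
    by (rule coprime_cofactors[OF g_def g(1) M Q])
  have Mpos: "M > 0" using M g(1) N0 by (metis of_nat_0_less_iff zero_less_mult_pos)
  have "int N dvd P * y \<longleftrightarrow> int (nat M) dvd y" for y
  proof -
    have "int N dvd P * y \<longleftrightarrow> M dvd Q * y" unfolding M Q using g(1) by (simp add: mult.assoc)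
    also have "\<dots> \<longleftrightarrow> M dvd y" using \<open>coprime M Q\<close> by (rule coprime_dvd_mult_right_iff)
    finally show ?thesis using Mpos by simp
  qed
  moreover have "nat M dvd N"
  proof -
    have "int (nat M) dvd int N" using M Mpos by simp
    then show ?thesis by (simp only: int_dvd_int_iff)
  qed
  ultimately show thesis using that by blast
qed

text \<open>A direction \<open>(p : q)\<close> of an elliptic curve in the surface is rational relative to \<open>\<nu>\<close>: after
  multiplication by a suitably rescaled component \<open>t\<close> of the projection of the surface to the curve, both entries become
  homomorphisms between \<open>L1\<close> and \<open>L2\<close>.\<close>
lemma curve_direction:
  assumes pq: "p \<noteq> 0 \<or> q \<noteq> 0" and cd: "c \<noteq> 0 \<or> d \<noteq> 0"
    and K: "\<And>z. z \<in> K \<longleftrightarrow> p * z \<in> L1 \<and> q * z \<in> L2"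
    and c: "\<And>x. x \<in> L1 \<Longrightarrow> c * x \<in> K" and d: "\<And>x. x \<in> L2 \<Longrightarrow> d * x \<in> K"
  obtains t P Q s where "t \<noteq> 0" "p * t = of_int P" "q * t = of_int Q * \<nu>"
    "\<And>z. t * z \<in> K \<longleftrightarrow> z \<in> mid s" "s dvd N" "\<And>y. int N dvd P * y \<longleftrightarrow> int s dvd y"
proof -
  (* c * x + d * y is the projection of the surface to the curve K; t is c, or d up to the factor
     needed to start from L1 instead of L2. *)
  have "\<exists>t P Q. t \<noteq> 0 \<and> p * t = of_int P \<and> q * t = of_int Q * \<nu>"
  proof (cases "c = 0")
    case False
    obtain P where "p * c = of_int P" using End_L1[of "p * c"] c K by (auto simp: mult.assoc)
    moreover obtain Q where "q * c = of_int Q * \<nu>" using hom[of "q * c"] c K by (auto simp: mult.assoc)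
    ultimately show ?thesis using False by blast
  next
    case True
    then have "d \<noteq> 0" using cd by simp
    obtain P where "\<nu> * (p * d) = of_int P" using Hom_L2_L1[of "p * d"] d K by (auto simp: mult.assoc)
    moreover obtain Q where "q * d = of_int Q" using End_L2[of "q * d"] d K by (auto simp: mult.assoc)
    ultimately show ?thesis using \<open>d \<noteq> 0\<close> \<nu>0
      by (intro exI[of _ "\<nu> * d"] exI[of _ P] exI[of _ Q]) (simp add: mult_ac)
  qed
  then obtain t0 P0 Q0 where t0: "t0 \<noteq> 0" "p * t0 = of_int P0" "q * t0 = of_int Q0 * \<nu>" by blast
  define g where "g = gcd P0 Q0"
  have "P0 \<noteq> 0 \<or> Q0 \<noteq> 0" using pq t0 by auto
  then have g: "g > 0" by (auto simp: g_def)
  obtain P where P: "P0 = g * P" unfolding g_def by (meson gcd_dvd1 dvdE)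
  obtain Q where Q: "Q0 = g * Q" unfolding g_def by (meson gcd_dvd2 dvdE)
  have "coprime P Q" by (rule coprime_cofactors[OF g_def g P Q])
  then obtain u v where uv: "u * P + v * Q = 1" using bezout_int[of P Q] by auto
  define t where "t = t0 / of_int g"
  have t: "t \<noteq> 0" "p * t = of_int P" "q * t = of_int Q * \<nu>"
    using t0 g by (simp_all add: t_def P Q)
  obtain s where s: "s dvd N" "\<And>y. int N dvd P * y \<longleftrightarrow> int s dvd y"
    by (rule dvd_product_iff_dvd_cofactor[of P]) (rule that)
  have "t * z \<in> K \<longleftrightarrow> z \<in> mid s" for z
  proof -
    have "t * z \<in> K \<longleftrightarrow> of_int P * z \<in> mid N \<and> of_int Q * z \<in> mid 1"
    proof -
      have "p * (t * z) = of_int P * z" "q * (t * z) = \<nu> * (of_int Q * z)"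
        using t by (simp_all flip: mult.assoc)
      then show ?thesis by (simp only: K L1_mid L2_iff)
    qed
    also have "\<dots> \<longleftrightarrow> z \<in> mid s"
    proof
      assume z: "of_int P * z \<in> mid N \<and> of_int Q * z \<in> mid 1"
      have "z = of_int (u * P + v * Q) * z" unfolding uv by simp
      also have "\<dots> = of_int u * (of_int P * z) + of_int v * (of_int Q * z)" by (simp add: algebra_simps)
      also have "\<dots> \<in> mid 1"
      proof (rule add_subgroupD(4)[OF sub_mid])
        show "of_int u * (of_int P * z) \<in> mid 1" "of_int v * (of_int Q * z) \<in> mid 1"
          using z mid_mono[of 1 N] by (auto intro: add_subgroup_int_mult[OF sub_mid])
      qed
      finally obtain x y where xy: "z = of_int x * (w1 / \<nu>) + of_int y * (w2 / \<nu>)" using mid_elem by metis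
      have "of_int P * z = of_int (P * x) * (w1 / \<nu>) + of_int (P * y) * (w2 / \<nu>)"
        by (simp add: xy algebra_simps)
      then have "int N dvd P * y" using z by (simp only: mid_iff)
      then show "z \<in> mid s" using s(2) unfolding xy mid_iff by simp
    next
      assume z: "z \<in> mid s"
      then obtain x y where xy: "z = of_int x * (w1 / \<nu>) + of_int y * (w2 / \<nu>)" "int s dvd y"
        using mid_elem by metis
      have "of_int P * z = of_int (P * x) * (w1 / \<nu>) + of_int (P * y) * (w2 / \<nu>)"
        by (simp add: xy(1) algebra_simps)
      moreover have "of_int Q * z \<in> mid 1" using z mid_mono[of 1 s] by (intro add_subgroup_int_mult sub_mid) auto
      ultimately show "of_int P * z \<in> mid N \<and> of_int Q * z \<in> mid 1"
        using s(2) xy(2) by (simp only: mid_iff)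
    qed
    finally show ?thesis .
  qed
  then show thesis using that[OF t _ s(1)] s(2) by blast
qed

text \<open>The integers \<open>P, P', Q, Q'\<close> form the matrix of a decomposition. It is surjective on the first
  coordinates of the lattices, so its determinant \<open>D\<close> is a unit. Solving for the point with second
  coordinates \<open>(0, 1)\<close> by Cramer's rule gives \<open>s | P'\<close> and \<open>s' | P\<close>. Hence a common divisor of \<open>s\<close>
  and \<open>s'\<close> divides \<open>D\<close>, and \<open>s s'\<close> divides \<open>N\<close>. Conversely \<open>N\<close> divides \<open>P s\<close> and \<open>P' s'\<close>, hence
  \<open>D s s'\<close>.\<close>
lemma complementary_cofactors:
  fixes P Q P' Q' :: int
  assumes s: "s dvd N" "\<And>y. int N dvd P * y \<longleftrightarrow> int s dvd y"
    and s': "s' dvd N" "\<And>y. int N dvd P' * y \<longleftrightarrow> int s' dvd y"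
    and T: "P * x1 + P' * y1 = 1" "Q * x1 + Q' * y1 = 0" "P * x2 + P' * y2 = 0" "Q * x2 + Q' * y2 = 1"
    and m: "P * (int s * m) + P' * (int s' * m') = 0" "Q * (int s * m) + Q' * (int s' * m') = 1"
  shows "s * s' = N" "coprime s s'"
proof -
  define D where "D = P * Q' - P' * Q"
  have "D * (x1 * y2 - x2 * y1) = 1" unfolding D_def using T by algebra
  then have D: "D = 1 \<or> D = - 1" using zmult_eq_1_iff by auto
  then have DD: "D * D = 1" by auto
  have 1: "P' = int s * (- D * D * D * m)" "P = int s' * (D * m')"
  proof -
    have "D * (int s * m) = - P'" "D * (int s' * m') = P" unfolding D_def using m by algebra+
    then show "P' = int s * (- D * D * D * m)" "P = int s' * (D * m')"
      using DD by (simp_all add: mult_ac)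
  qed
  show cop: "coprime s s'"
  proof -
    have "is_unit (gcd (int s) (int s'))"
    proof -
      have "gcd (int s) (int s') dvd P" "gcd (int s) (int s') dvd P'"
        using 1 by (metis dvd_mult2 gcd_dvd1 gcd_dvd2)+
      then have "gcd (int s) (int s') dvd D" unfolding D_def by simp
      then show ?thesis using D by auto
    qed
    then show ?thesis by (metis coprime_int_iff is_unit_gcd)
  qed
  have "int N dvd P * int s" "int N dvd P' * int s'" using s(2)[of "int s"] s'(2)[of "int s'"] by simp_all
  then have "int N dvd (P * int s) * (int s' * Q') - (P' * int s') * (int s * Q)"
    by (meson dvd_diff dvd_mult2)
  also have "(P * int s) * (int s' * Q') - (P' * int s') * (int s * Q) = D * (int s * int s')"
    by (simp add: D_def algebra_simps)
  finally have "int N dvd int s * int s'" using D by auto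
  then have "N dvd s * s'" by (metis int_dvd_int_iff of_nat_mult)
  moreover have "s * s' dvd N" using s(1) s'(1) cop by (rule divides_mult)
  ultimately show "s * s' = N" by (rule dvd_antisym[rotated])
qed

text \<open>After rescaling both curves, the decomposition becomes an integral matrix that maps
  \<open>mid s \<times> mid s'\<close> onto \<open>L1 \<times> L2\<close>. The coordinates with respect to \<open>w1\<close> and to \<open>w2\<close> are transformed by
  the same matrix, which yields the equations for \<open>complementary_cofactors\<close>.\<close>
lemma decomposition_classification:
  assumes F: "(F1, F2) \<in> decompositions A"
  obtains K1 \<iota>1 K2 \<iota>2 s s' where "curve_embedding A K1 \<iota>1 F1" "curve_embedding A K2 \<iota>2 F2"
    "s * s' = N" "coprime s s'" "homothetic K1 (mid s)" "homothetic K2 (mid s')"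
proof -
  obtain K1 \<iota>1 K2 \<iota>2 p q p' q' c d e f where
    emb: "curve_embedding A K1 \<iota>1 F1" "curve_embedding A K2 \<iota>2 F2"
    and A: "\<And>x y. (p * x + p' * y, q * x + q' * y) \<in> A \<longleftrightarrow> x \<in> K1 \<and> y \<in> K2"
    and TS: "\<And>x y. p * (c * x + d * y) + p' * (e * x + f * y) = x"
      "\<And>x y. q * (c * x + d * y) + q' * (e * x + f * y) = y"
    and ST: "\<And>x y. c * (p * x + p' * y) + d * (q * x + q' * y) = x"
      "\<And>x y. e * (p * x + p' * y) + f * (q * x + q' * y) = y"
    by (rule decomposition_lift[OF sub_A discrete_A F]) (rule that)
  have 0: "0 \<in> K1" "0 \<in> K2" "0 \<in> L1" "0 \<in> L2"
    using emb lattice_properties(1) add_subgroupD(1) sub_L1 sub_L2 unfolding curve_embedding_def by blast+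
  have K1: "z \<in> K1 \<longleftrightarrow> p * z \<in> L1 \<and> q * z \<in> L2" for z using A[of z 0] 0 by simp
  have K2: "z \<in> K2 \<longleftrightarrow> p' * z \<in> L1 \<and> q' * z \<in> L2" for z using A[of 0 z] 0 by simp
  have S: "c * x + d * y \<in> K1 \<and> e * x + f * y \<in> K2" if "x \<in> L1" "y \<in> L2" for x y
    using A[of "c * x + d * y" "e * x + f * y"] that by (simp add: TS)
  have SK: "\<And>x. x \<in> L1 \<Longrightarrow> c * x \<in> K1" "\<And>y. y \<in> L2 \<Longrightarrow> d * y \<in> K1"
    "\<And>x. x \<in> L1 \<Longrightarrow> e * x \<in> K2" "\<And>y. y \<in> L2 \<Longrightarrow> f * y \<in> K2"
    using S[OF _ 0(4)] S[OF 0(3)] by simp_all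
  have ne: "p \<noteq> 0 \<or> q \<noteq> 0" "c \<noteq> 0 \<or> d \<noteq> 0" "p' \<noteq> 0 \<or> q' \<noteq> 0" "e \<noteq> 0 \<or> f \<noteq> 0"
    using ST(1)[of 1 0] ST(2)[of 0 1] by auto
  obtain t P Q s where t: "t \<noteq> 0" "p * t = of_int P" "q * t = of_int Q * \<nu>"
    "\<And>z. t * z \<in> K1 \<longleftrightarrow> z \<in> mid s" and s: "s dvd N" "\<And>y. int N dvd P * y \<longleftrightarrow> int s dvd y"
    by (rule curve_direction[OF ne(1,2) K1 SK(1,2)], assumption, assumption) (rule that)
  obtain t' P' Q' s' where t': "t' \<noteq> 0" "p' * t' = of_int P'" "q' * t' = of_int Q' * \<nu>"
    "\<And>z. t' * z \<in> K2 \<longleftrightarrow> z \<in> mid s'" and s': "s' dvd N" "\<And>y. int N dvd P' * y \<longleftrightarrow> int s' dvd y"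
    by (rule curve_direction[OF ne(3,4) K2 SK(3,4)], assumption, assumption) (rule that)
  have surj: "\<exists>x y x' y'. x1 = P * x + P' * x' \<and> x2 = P * (int s * y) + P' * (int s' * y') \<and>
      y1 = Q * x + Q' * x' \<and> y2 = Q * (int s * y) + Q' * (int s' * y')"
    if x2: "int N dvd x2" for x1 x2 y1 y2
  proof -
    define X where "X = of_int x1 * (w1 / \<nu>) + of_int x2 * (w2 / \<nu>)"
    define Y where "Y = of_int y1 * (w1 / \<nu>) + of_int y2 * (w2 / \<nu>)"
    have "X \<in> L1" unfolding X_def L1_mid mid_iff by (rule x2)
    moreover have "\<nu> * Y \<in> L2" unfolding L2_iff Y_def mid_iff by simp
    ultimately have mem: "c * X + d * (\<nu> * Y) \<in> K1" "e * X + f * (\<nu> * Y) \<in> K2" using S by auto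
    define z z' where "z = (c * X + d * (\<nu> * Y)) / t" and "z' = (e * X + f * (\<nu> * Y)) / t'"
    have tz: "t * z = c * X + d * (\<nu> * Y)" "t' * z' = e * X + f * (\<nu> * Y)"
      using t(1) t'(1) by (simp_all add: z_def z'_def)
    have "z \<in> mid s" "z' \<in> mid s'"
      unfolding t(4)[symmetric] t'(4)[symmetric] tz by (rule mem)+
    then obtain x y x' y' where xy: "z = of_int x * (w1 / \<nu>) + of_int y * (w2 / \<nu>)" "int s dvd y"
      "z' = of_int x' * (w1 / \<nu>) + of_int y' * (w2 / \<nu>)" "int s' dvd y'"
      by (elim mid_elem)
    have "X = p * (t * z) + p' * (t' * z')" unfolding tz TS ..
    also have "\<dots> = of_int P * z + of_int P' * z'" using t(2) t'(2) by (simp flip: mult.assoc)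
    also have "\<dots> = of_int (P * x + P' * x') * (w1 / \<nu>) + of_int (P * y + P' * y') * (w2 / \<nu>)"
      by (simp add: xy algebra_simps)
    finally have 1: "x1 = P * x + P' * x'" "x2 = P * y + P' * y'"
      unfolding X_def by (rule int_coordinates_unique[OF area'])+
    have "\<nu> * Y = q * (t * z) + q' * (t' * z')" unfolding tz TS ..
    also have "\<dots> = (q * t) * z + (q' * t') * z'" by (simp only: mult.assoc)
    also have "\<dots> = \<nu> * (of_int Q * z + of_int Q' * z')"
      unfolding t(3) t'(3) by (simp add: algebra_simps)
    finally have "Y = of_int Q * z + of_int Q' * z'" using \<nu>0 by simp
    also have "\<dots> = of_int (Q * x + Q' * x') * (w1 / \<nu>) + of_int (Q * y + Q' * y') * (w2 / \<nu>)"
      by (simp add: xy algebra_simps)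
    finally have 2: "y1 = Q * x + Q' * x'" "y2 = Q * y + Q' * y'"
      unfolding Y_def by (rule int_coordinates_unique[OF area'])+
    obtain m m' where "y = int s * m" "y' = int s' * m'" using xy(2,4) by (elim dvdE)
    then show ?thesis using 1 2 by blast
  qed
  obtain x1 y1 where 1: "P * x1 + P' * y1 = 1" "Q * x1 + Q' * y1 = 0" using surj[of 0 1 0 0] by auto
  obtain x2 y2 where 2: "P * x2 + P' * y2 = 0" "Q * x2 + Q' * y2 = 1" using surj[of 0 0 1 0] by auto
  obtain m m' where 3: "P * (int s * m) + P' * (int s' * m') = 0" "Q * (int s * m) + Q' * (int s' * m') = 1"
    using surj[of 0 0 0 1] by auto
  note ss = complementary_cofactors[OF s s' 1 2 3]
  have homothetic: "homothetic K (mid v)"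
    if "u \<noteq> 0" and mem: "\<And>z. u * z \<in> K \<longleftrightarrow> z \<in> mid v" for u K v
  proof -
    have "z \<in> K \<longleftrightarrow> z \<in> (\<lambda>z. u * z) ` mid v" for z
      unfolding mem_scaled[OF \<open>u \<noteq> 0\<close>] mem[symmetric] using \<open>u \<noteq> 0\<close> by simp
    then have "K = (\<lambda>z. u * z) ` mid v" by (rule Set.set_eqI)
    then show ?thesis using \<open>u \<noteq> 0\<close> homothetic_sym unfolding homothetic_def by blast
  qed
  note h1 = homothetic[OF t(1,4)] and h2 = homothetic[OF t'(1,4)]
  show thesis by (rule that[OF emb ss h1 h2])
qed

lemma decomposition_iso_alpha_iff:
  assumes F: "(F1, F2) \<in> decompositions A"
    and emb: "curve_embedding A K1 \<iota>1 F1" "curve_embedding A K2 \<iota>2 F2"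
    and h: "homothetic K1 (mid t)" "homothetic K2 (mid t')" and t: "t * t' = N"
    and rs: "r * s = N" "coprime r s" and ab: "a (r, s) * int r + b (r, s) * int s = 1"
  shows "((F1, F2), alpha_decomposition L1 L2 \<phi> a b (r, s)) \<in> decomposition_iso A \<longleftrightarrow>
    t = s \<and> t' = r \<or> t = r \<and> t' = s"
proof -
  define G where "G = alpha_decomposition L1 L2 \<phi> a b (r, s)"
  obtain \<kappa>1 \<kappa>2 where G: "curve_embedding A (mid s) \<kappa>1 (fst G)" "curve_embedding A (mid r) \<kappa>2 (snd G)"
    "G \<in> decompositions A"
    by (rule alpha_decomposition_in_decompositions[where a = a and b = b, OF rs ab, folded G_def])
  have mid: "homothetic K (mid v) \<longleftrightarrow> u = v" if "homothetic K (mid u)" "u dvd N" "v dvd N" for K u v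
    using that homothetic_mid homothetic_sym homothetic_trans by metis
  have dvd: "t dvd N" "t' dvd N" "r dvd N" "s dvd N"
    using t rs(1) by (metis dvd_triv_left dvd_triv_right)+
  note iso = curve_isomorphic_iff[OF sub_A discrete_A countable_A]
  have "curve_isomorphic A F1 (fst G) \<longleftrightarrow> t = s" "curve_isomorphic A F2 (snd G) \<longleftrightarrow> t' = r"
    "curve_isomorphic A F1 (snd G) \<longleftrightarrow> t = r" "curve_isomorphic A F2 (fst G) \<longleftrightarrow> t' = s"
    using iso[OF emb(1) G(1)] iso[OF emb(2) G(2)] iso[OF emb(1) G(2)] iso[OF emb(2) G(1)]
      mid[OF h(1)] mid[OF h(2)] dvd by simp_all
  then show ?thesis
    using F G(3) by (cases G) (simp add: decomposition_iso_def flip: G_def)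
qed

end

section \<open>Decompositions of a product with Picard number three\<close>

text \<open>In a stacked basis the kernel of \<open>\<phi>\<close> has order \<open>k\<^sup>2 n\<close>, where \<open>\<phi>\<close> is divisible by \<open>k\<close>. By
  \<open>hom_cyclic\<close> all homomorphisms are multiples of \<open>\<phi>\<close>, so \<open>k = 1\<close>.\<close>
lemma cyclic_isogeny_of_minimal_degree:
  assumes L1: "is_lattice L1" and L2: "is_lattice L2"
    and \<rho>: "picard_number (L1 \<times> L2) \<le> 3" and N: "N > 0"
    and iso: "NS_isometric_U_plus (L1 \<times> L2) N"
    and \<phi>: "isogeny L1 L2 \<phi>" "isogeny_degree L1 L2 \<phi> = N"
  obtains \<nu> w1 w2 where "cyclic_isogeny L1 L2 \<phi> \<nu> w1 w2 N"
proof -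
  note sub1 = lattice_properties[OF L1] and sub2 = lattice_properties[OF L2]
  obtain u1 v1 where uv1: "area u1 v1 \<noteq> 0" "L1 = lat u1 v1" using L1 is_lattice_complex_iff by blast
  obtain u2 v2 where uv2: "area u2 v2 \<noteq> 0" "L2 = lat u2 v2" using L2 is_lattice_complex_iff by blast
  have \<phi>hom: "\<phi> \<in> torus_hom L1 L2" and surj: "\<phi> ` carrier (torus L1) = carrier (torus L2)"
    using \<phi>(1) by (auto simp: isogeny_def)
  obtain T where T: "complex_linear T" "lifted_by L1 L2 \<phi> T"
    using torus_hom_lift[OF sub1(1) sub2(1,2) \<phi>hom] .
  obtain \<nu> where \<nu>T: "T = (\<lambda>z. \<nu> * z)" using complex_linear_complex[OF T(1)] .
  have lift: "lifted_by L1 L2 \<phi> (\<lambda>z. \<nu> * z)" using T(2) \<nu>T by simp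
  have \<nu>0: "\<nu> \<noteq> 0"
  proof
    assume "\<nu> = 0"
    then have "\<phi> (torus_proj L1 z) = torus_proj L2 0" for z using lift by (simp add: lifted_by_def)
    then have "\<phi> ` carrier (torus L1) \<subseteq> {torus_proj L2 0}" by (auto simp: carrier_torus)
    then have "torus_proj L2 z = torus_proj L2 0" for z
      using surj torus_proj_in_carrier[of L2 z] by blast
    then have "z \<in> L2" for z by (simp add: torus_proj_eq_iff[OF sub2(1)])
    then show False using linear_into_discrete_eq_0[OF linear_id[unfolded id_def] sub2(2), of 1] by simp
  qed
  have \<nu>L1: "\<nu> * x \<in> L2" if "x \<in> L1" for x
    using lifted_by_lattice[OF lift _ sub1(1) sub2(1) that] complex_linear_mult[of \<nu>]
    by (simp add: complex_linear_def)
  have scaled: "lat (\<nu> * u1) (\<nu> * v1) \<subseteq> lat u2 v2"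
    using \<nu>L1 unfolding lat_scale[symmetric] uv1(2) uv2(2) by blast
  have "area (\<nu> * u1) (\<nu> * v1) \<noteq> 0" using uv1(1) \<nu>0 by (simp add: area_scale)
  then obtain w1 w2 and k n :: nat where kn: "k > 0" "n > 0" and w: "area w1 w2 \<noteq> 0"
    and L2w: "lat u2 v2 = lat w1 w2"
    and L1w: "lat (\<nu> * u1) (\<nu> * v1) = lat (of_nat k * w1) (of_nat (k * n) * w2)"
    using stacked_basis[OF _ uv2(1) scaled] by metis
  define x1 x2 where "x1 = w1 / \<nu>" and "x2 = w2 / \<nu>"
  have "L1 = (\<lambda>z. 1 / \<nu> * z) ` lat (\<nu> * u1) (\<nu> * v1)"
    unfolding lat_scale uv1(2) using \<nu>0 by simp
  then have L1x: "L1 = lat (of_nat k * x1) (of_nat (k * n) * x2)"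
    unfolding L1w lat_scale x1_def x2_def by simp
  have \<nu>x: "w1 = \<nu> * x1" "w2 = \<nu> * x2" using \<nu>0 by (simp_all add: x1_def x2_def)
  have L2x: "L2 = (\<lambda>z. \<nu> * z) ` lat x1 x2" unfolding uv2(2) L2w lat_scale \<nu>x ..
  have L2_iff: "\<nu> * z \<in> L2 \<longleftrightarrow> z \<in> lat x1 x2" for z
    unfolding L2x mem_scaled[OF \<nu>0] using \<nu>0 by simp
  have ax: "area x1 x2 \<noteq> 0" using w \<nu>0 unfolding \<nu>x by (simp add: area_scale)
  have "\<phi> (torus_proj L1 z) = \<one>\<^bsub>torus L2\<^esub> \<longleftrightarrow> z \<in> lat x1 x2" for z
    using lift by (simp add: lifted_by_def torus_one[OF sub2(1)] torus_proj_eq_iff[OF sub2(1)] L2_iff)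
  then have "kernel (torus L1) (torus L2) \<phi> = torus_proj L1 ` lat x1 x2"
    unfolding kernel_def carrier_torus by auto
  then have Nkn: "N = k * (k * n)"
    using \<phi>(2) index_sublattice[OF ax, of k "k * n"] kn L1x by (simp add: isogeny_degree_def)
  have aL1: "area (of_nat k * x1) (of_nat (k * n) * x2) = of_nat N * area x1 x2"
    by (simp add: area_def Nkn algebra_simps)
  have aw: "area w1 w2 = (cmod \<nu>)\<^sup>2 * area x1 x2" unfolding \<nu>x area_scale ..
  have pos: "area (of_nat k * x1) (of_nat (k * n) * x2) * area w1 w2 > 0"
  proof -
    have "area (of_nat k * x1) (of_nat (k * n) * x2) * area w1 w2 =
        of_nat N * (cmod \<nu>)\<^sup>2 * (area x1 x2)\<^sup>2"
      unfolding aL1 aw by (simp add: power2_eq_square)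
    also have "\<dots> > 0" using N \<nu>0 ax by simp
    finally show ?thesis .
  qed
  have L2w': "L2 = lat w1 w2" using uv2(2) L2w by simp
  have deg: "(cmod \<nu>)\<^sup>2 * area (of_nat k * x1) (of_nat (k * n) * x2) = of_nat N * area w1 w2"
    unfolding aL1 aw by simp
  have hom: "\<exists>j::int. \<mu> = of_int j * \<nu>" if "\<And>x. x \<in> L1 \<Longrightarrow> \<mu> * x \<in> L2" for \<mu>
    using hom_cyclic[OF pos _ _ _ \<nu>0 deg, of \<mu>] \<rho> iso \<nu>L1 that by (simp only: L1x[symmetric] L2w'[symmetric])
  have "\<nu> / of_nat k * x \<in> L2" if x: "x \<in> L1" for x
  proof -
    obtain i j where "x = of_int i * (of_nat k * x1) + of_int j * (of_nat (k * n) * x2)"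
      using x unfolding L1x lat_iff by blast
    then have "\<nu> / of_nat k * x = \<nu> * (of_int i * x1 + of_int (j * int n) * x2)"
      using kn(1) by (simp add: field_simps)
    then show ?thesis by (simp only: L2_iff latI)
  qed
  from hom[OF this] obtain j :: int where j: "\<nu> / of_nat k = of_int j * \<nu>" by blast
  then have "(1 :: complex) = of_int (j * int k)" using \<nu>0 kn(1) by (simp add: field_simps)
  then have "j * int k = 1" by (metis of_int_1 of_int_eq_iff)
  then have "k = 1" using kn(1) by (auto simp: zmult_eq_1_iff)
  then have L1w': "L1 = lat (w1 / \<nu>) (of_nat N * (w2 / \<nu>))" using L1x Nkn by (simp add: x1_def x2_def)
  have "cyclic_isogeny L1 L2 \<phi> \<nu> w1 w2 N"
    by (rule cyclic_isogeny.intro[OF w \<nu>0 N L2w' L1w' lift]) (rule hom)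
  then show thesis by (rule that)
qed

theorem theorem4p6:
  fixes L1 L2 :: "complex set" and N :: nat
    and \<phi> :: "complex set \<Rightarrow> complex set" and a b :: "nat \<times> nat \<Rightarrow> int"
  assumes "is_lattice L1" and "is_lattice L2"
    and "picard_number (L1 \<times> L2) = 3"
    and "N > 0" and "NS_isometric_U_plus (L1 \<times> L2) N"
    and "isogeny L1 L2 \<phi>" and "isogeny_degree L1 L2 \<phi> = N"
    and "\<forall>(r, s)\<in>coprime_splittings N. a (r, s) * int r + b (r, s) * int s = 1"
  shows "(\<forall>\<sigma>\<in>coprime_splittings N. alpha_decomposition L1 L2 \<phi> a b \<sigma> \<in> decompositions (L1 \<times> L2)) \<and>
         (\<forall>C\<in>Dec (L1 \<times> L2).
            \<exists>!\<sigma>. \<sigma> \<in> coprime_splittings N \<and> alpha_decomposition L1 L2 \<phi> a b \<sigma> \<in> C)"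
proof -
  obtain \<nu> w1 w2 where "cyclic_isogeny L1 L2 \<phi> \<nu> w1 w2 N"
    using cyclic_isogeny_of_minimal_degree[OF assms(1,2) _ assms(4-7)] assms(3) by auto
  then interpret cyclic_isogeny L1 L2 \<phi> \<nu> w1 w2 N .
  have ab: "a (r, s) * int r + b (r, s) * int s = 1" if "(r, s) \<in> coprime_splittings N" for r s
    using assms(8) that by blast
  have splitting: "(r, s) \<in> coprime_splittings N \<longleftrightarrow> r * s = N \<and> coprime r s \<and> r \<le> s" for r s
    using N0 by (auto simp: coprime_splittings_def intro!: gr0I)
  show ?thesis
  proof (intro conjI ballI)
    fix \<sigma> assume "\<sigma> \<in> coprime_splittings N"
    moreover obtain r s where "\<sigma> = (r, s)" by (cases \<sigma>)
    ultimately show "alpha_decomposition L1 L2 \<phi> a b \<sigma> \<in> decompositions (L1 \<times> L2)"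
      using alpha_decomposition_in_decompositions[where a = a and b = b, of r s] ab[of r s] splitting by blast
  next
    fix C assume "C \<in> Dec (L1 \<times> L2)"
    then obtain F1 F2 where F: "(F1, F2) \<in> decompositions A" and C: "C = decomposition_iso A `` {(F1, F2)}"
      unfolding Dec_def by (auto elim!: quotientE)
    obtain K1 \<iota>1 K2 \<iota>2 t t' where emb: "curve_embedding A K1 \<iota>1 F1" "curve_embedding A K2 \<iota>2 F2"
      and t: "t * t' = N" "coprime t t'" and h: "homothetic K1 (mid t)" "homothetic K2 (mid t')"
      by (rule decomposition_classification[OF F])
    have in_C: "alpha_decomposition L1 L2 \<phi> a b (r, s) \<in> C \<longleftrightarrow> t = s \<and> t' = r \<or> t = r \<and> t' = s"
      if "(r, s) \<in> coprime_splittings N" for r s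
      using decomposition_iso_alpha_iff[where a = a and b = b, OF F emb h t(1) _ _ ab[OF that]] that
      by (simp add: C splitting)
    show "\<exists>!\<sigma>. \<sigma> \<in> coprime_splittings N \<and> alpha_decomposition L1 L2 \<phi> a b \<sigma> \<in> C"
    proof (rule ex1I)
      have "(min t t', max t t') \<in> coprime_splittings N"
        using t by (auto simp: splitting min_def max_def mult.commute coprime_commute)
      then show "(min t t', max t t') \<in> coprime_splittings N \<and>
          alpha_decomposition L1 L2 \<phi> a b (min t t', max t t') \<in> C"
        using in_C by (auto simp: min_def max_def)
    next
      fix \<sigma> assume \<sigma>: "\<sigma> \<in> coprime_splittings N \<and> alpha_decomposition L1 L2 \<phi> a b \<sigma> \<in> C"
      obtain r s where rs: "\<sigma> = (r, s)" by (cases \<sigma>)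
      then have "t = s \<and> t' = r \<or> t = r \<and> t' = s" "r \<le> s" using \<sigma> in_C splitting by auto
      then show "\<sigma> = (min t t', max t t')" unfolding rs by auto
    qed
  qed
qed

end
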